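(* Suppose that $\varphi$ and $\psi$ are strong Pisot substitutions that both satisfy the Geometric Coincidence Condition (GCC) and the no cycle condition, and let $h:\mathcal T_\varphi\to\mathcal T_\psi$ be a homeomorphism. If $T,T'\in\mathcal T_\varphi$ are proximal in $\mathcal T_\varphi$, then there is $t_0\in\mathbb R$ such that $h(T)$ and $h(T')+t_0$ are proximal in $\mathcal T_\psi$.
   Context: **Substitutions.** Let $\mathcal A=\{1,\dots,d\}$, $d\ge 2$, be a finite alphabet and $\mathcal A^*$ the set of finite nonempty words. A substitution is a map $\varphi:\mathcal A\to\mathcal A^*$, extended to words by concatenation; its abelianization is the matrix $A=A_\varphi=(a_{ij})$, $a_{ij}$ being the number of occurrences of $i$ in $\varphi(j)$. A (finite or bi-infinite) word is allowed for $\varphi$ if each of its finite factors is a factor of $\varphi^n(i)$ for some $i\in\mathcal A$, $n\in\mathbb N$; $\mathcal L_\varphi$ is the set of finite allowed words. $\varphi$ is strong Pisot if every eigenvalue of $A_\varphi$ other than the dominant (Perron-Frobenius) eigenvalue $\lambda=\lambda_\varphi$ has modulus strictly between $0$ and $1$ (such $\varphi$ is automatically primitive and aperiodic). **Tiling space and proximality.** Let $\omega_L=(\omega_1,\dots,\omega_d)$ and $\omega_R$ be positive left and right eigenvectors of $A_\varphi$ for $\lambda$. The prototiles are $P_i=[0,\omega_i]$ (considered distinct for distinct $i$). A tiling is a collection $T=\{T_i\}_{i\in\mathbb Z}$ of translates of prototiles covering $\mathbb R$, consecutive tiles meeting in one point. $\mathcal T_\varphi$ is the set of tilings by prototiles whose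 bi-infinite word of tile types is allowed for $\varphi$; in its (compact metrizable) topology two tilings are close if, after a small translation of one of them, they agree on a large neighborhood of $0$. Let $d$ be a compatible metric. The translation flow is $(T,t)\mapsto T-t=\{T_i-t\}$. Tilings $T,T'$ are forward (backward) proximal if there is a sequence $t_k\to\infty$ (respectively $t_k\to-\infty$) with $d(T-t_k,T'-t_k)\to0$; they are proximal if they are forward or backward proximal. **No cycle condition.** Let $\varphi^+(a)$ and $\varphi^-(a)$ be the first and last letters of $\varphi(a)$; $S^\pm=\bigcap_{n\ge0}(\varphi^\pm)^n(\mathcal A)$; $\mathcal P_\varphi=\{(a,b)\in S^-\times S^+: ab\in\mathcal L_\varphi\}$. A cycle in $\mathcal P_\varphi$ is a string of elements $(a_1,a_2),(a_3,a_2),(a_3,a_4),\dots,(a_{2n-1},a_{2n}),(a_1,a_{2n})$ of $\mathcal P_\varphi$ with $n\ge2$, $a_1\ne a_3\ne\dots\ne a_{2n-1}$ and $a_2\ne a_4\ne\dots\ne a_{2n}$. $\varphi$ satisfies the no cycle condition if $\mathcal P_\varphi$ has no cycles. **GCC.** Let $E^s\subset\mathbb R^d$ be the $(d-1)$-dimensional $A$-invariant complement of $E^u=\mathbb R\omega_R$. Let $e_1,\dots,e_d$ be the standard basis and $I_i=\{se_i:0\le s<1\}$. For $I=I_i+v$ and $\varphi(i)=i_1\cdots i_k$, $\Phi(I)$ is the path formed by the segments $I_{i_n}+Av+\sum_{j<n}e_{i_j}$, $n=1,\dots,k$. A state is a segment $I_i+v$ ($v\in\mathbb R^d$) meeting $E^s$;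 for a state $I$, $\hat\Phi(I)$ is the unique state among the segments of $\Phi(I)$. $\varphi$ satisfies GCC if, whenever $I,J$ are states whose initial vertices differ by an element of $\mathbb Z^d$, for every $\epsilon>0$ there is $t\in\mathbb R$ with $|t|<\epsilon$ such that $I+t\omega_R$ and $J+t\omega_R$ are states and $\hat\Phi^n(I+t\omega_R)=\hat\Phi^n(J+t\omega_R)$ for some $n\ge0$. *)

theory Defs
  imports
    "HOL-Analysis.Analysis"
    "HOL-Library.Sublist"
    "HOL-Computational_Algebra.Polynomial"
begin

section \<open>Substitutions\<close>

text \<open>The alphabet is an arbitrary finite type \<open>'a\<close> and \<open>d = CARD('a)\<close>; a substitution is
  given by the images of the letters.\<close>

definition substitution :: "('a::finite \<Rightarrow> 'a list) \<Rightarrow> bool" where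
  "substitution \<phi> \<longleftrightarrow> CARD('a) \<ge> 2 \<and> (\<forall>i. \<phi> i \<noteq> [])"

definition subst_word :: "('a \<Rightarrow> 'a list) \<Rightarrow> 'a list \<Rightarrow> 'a list" where
  "subst_word \<phi> w = concat (map \<phi> w)"

definition abelianization :: "('a::finite \<Rightarrow> 'a list) \<Rightarrow> real^'a^'a" where
  "abelianization \<phi> = (\<chi> i j. real (count_list (\<phi> j) i))"

definition factor_of_iterate :: "('a \<Rightarrow> 'a list) \<Rightarrow> 'a list \<Rightarrow> bool" where
  "factor_of_iterate \<phi> w \<longleftrightarrow> (\<exists>i n. sublist w ((subst_word \<phi> ^^ n) [i]))"

definition language :: "('a \<Rightarrow> 'a list) \<Rightarrow> 'a list set" where
  "language \<phi> = {w. \<forall>u. sublist u w \<longrightarrow> factor_of_iterate \<phi> u}"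

definition allowed_biinfinite :: "('a \<Rightarrow> 'a list) \<Rightarrow> (int \<Rightarrow> 'a) \<Rightarrow> bool" where
  "allowed_biinfinite \<phi> w \<longleftrightarrow> (\<forall>m n. factor_of_iterate \<phi> (map w [m..n]))"


section \<open>Eigenvalues and the strong Pisot property\<close>

definition eigenvalue :: "complex^'n^'n \<Rightarrow> complex \<Rightarrow> bool" where
  "eigenvalue M c \<longleftrightarrow> (\<exists>v. v \<noteq> 0 \<and> M *v v = c *s v)"

definition charpoly :: "complex^'n^'n \<Rightarrow> complex poly" where
  "charpoly M = det (mat [:0, 1:] - map_matrix (\<lambda>x. [:x:]) M)"

definition complex_abelianization :: "('a::finite \<Rightarrow> 'a list) \<Rightarrow> complex^'a^'a" where
  "complex_abelianization \<phi> = map_matrix complex_of_real (abelianization \<phi>)"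

text \<open>The dominant (Perron-Frobenius) eigenvalue of a nonnegative matrix is its spectral
  radius.\<close>

definition pf_eigenvalue :: "('a::finite \<Rightarrow> 'a list) \<Rightarrow> real" where
  "pf_eigenvalue \<phi> = Max (cmod ` {c. eigenvalue (complex_abelianization \<phi>) c})"

text \<open>The other eigenvalues are understood with algebraic multiplicity, so the dominant one
  has to be a simple root of the characteristic polynomial; otherwise twice the identity matrix
  would qualify, and the substitution would not have to be primitive.\<close>

definition strong_pisot :: "('a::finite \<Rightarrow> 'a list) \<Rightarrow> bool" where
  "strong_pisot \<phi> \<longleftrightarrow>
     order (complex_of_real (pf_eigenvalue \<phi>)) (charpoly (complex_abelianization \<phi>)) = 1 \<and>
     (\<forall>c. eigenvalue (complex_abelianization \<phi>) c \<and> c \<noteq> complex_of_real (pf_eigenvalue \<phi>)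
          \<longrightarrow> 0 < cmod c \<and> cmod c < 1)"

definition left_pf_vector :: "('a::finite \<Rightarrow> 'a list) \<Rightarrow> real^'a \<Rightarrow> bool" where
  "left_pf_vector \<phi> \<omega> \<longleftrightarrow>
     (\<forall>i. \<omega> $ i > 0) \<and> \<omega> v* abelianization \<phi> = pf_eigenvalue \<phi> *s \<omega>"

definition right_pf_vector :: "('a::finite \<Rightarrow> 'a list) \<Rightarrow> real^'a \<Rightarrow> bool" where
  "right_pf_vector \<phi> \<omega> \<longleftrightarrow>
     (\<forall>i. \<omega> $ i > 0) \<and> abelianization \<phi> *v \<omega> = pf_eigenvalue \<phi> *s \<omega>"


section \<open>The tiling space\<close>

text \<open>A pair \<open>(i, x)\<close> is the tile \<open>P\<^sub>i + x\<close>; keeping the type \<open>i\<close> makes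
  prototiles of equal length distinct.  A tiling is the (unindexed) set of its tiles.\<close>

type_synonym 'a tile = "'a \<times> real"
type_synonym 'a tiling = "'a tile set"

definition supp :: "real^'a \<Rightarrow> 'a::finite tile \<Rightarrow> real set" where
  "supp \<omega> \<tau> = {snd \<tau> .. snd \<tau> + \<omega> $ fst \<tau>}"

definition tiling_space :: "('a::finite \<Rightarrow> 'a list) \<Rightarrow> real^'a \<Rightarrow> 'a tiling set" where
  "tiling_space \<phi> \<omega> =
     {T. \<exists>\<tau> :: int \<Rightarrow> 'a tile. T = range \<tau> \<and>
           (\<Union>k. supp \<omega> (\<tau> k)) = UNIV \<and>
           (\<forall>k. snd (\<tau> (k + 1)) = snd (\<tau> k) + \<omega> $ fst (\<tau> k)) \<and>
           allowed_biinfinite \<phi> (\<lambda>k. fst (\<tau> k))}"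

definition translate :: "'a tiling \<Rightarrow> real \<Rightarrow> 'a tiling" where
  "translate T t = (\<lambda>(i, x). (i, x + t)) ` T"

definition patch :: "real^'a \<Rightarrow> real \<Rightarrow> 'a::finite tiling \<Rightarrow> 'a tiling" where
  "patch \<omega> R T = {\<tau> \<in> T. supp \<omega> \<tau> \<inter> {-R<..<R} \<noteq> {}}"

definition tilings_close :: "real^'a \<Rightarrow> real \<Rightarrow> 'a::finite tiling \<Rightarrow> 'a tiling \<Rightarrow> bool" where
  "tilings_close \<omega> \<epsilon> T T' \<longleftrightarrow>
     (\<exists>s. \<bar>s\<bar> < \<epsilon> \<and> patch \<omega> (1 / \<epsilon>) T = patch \<omega> (1 / \<epsilon>) (translate T' s))"

definition tiling_open :: "('a::finite \<Rightarrow> 'a list) \<Rightarrow> real^'a \<Rightarrow> 'a tiling set \<Rightarrow> bool" where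
  "tiling_open \<phi> \<omega> U \<longleftrightarrow> U \<subseteq> tiling_space \<phi> \<omega> \<and>
     (\<forall>T\<in>U. \<exists>\<epsilon>>0. \<forall>T'\<in>tiling_space \<phi> \<omega>. tilings_close \<omega> \<epsilon> T T' \<longrightarrow> T' \<in> U)"

definition tiling_topology :: "('a::finite \<Rightarrow> 'a list) \<Rightarrow> real^'a \<Rightarrow> 'a tiling topology" where
  "tiling_topology \<phi> \<omega> = topology (tiling_open \<phi> \<omega>)"

lemma tilings_close_mono:
  assumes "tilings_close \<omega> \<delta> T T'" "0 < \<delta>" "\<delta> \<le> \<epsilon>"
  shows "tilings_close \<omega> \<epsilon> T T'"
proof -
  obtain s where s: "\<bar>s\<bar> < \<delta>" "patch \<omega> (1 / \<delta>) T = patch \<omega> (1 / \<delta>) (translate T' s)"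
    using assms(1) unfolding tilings_close_def by blast
  have "1 / \<epsilon> \<le> 1 / \<delta>"
    using assms by (simp add: frac_le)
  hence sub: "{-(1/\<epsilon>)<..<1/\<epsilon>} \<subseteq> {-(1/\<delta>)<..<1/\<delta>}" by auto
  have restrict: "patch \<omega> (1 / \<epsilon>) S = patch \<omega> (1 / \<epsilon>) (patch \<omega> (1 / \<delta>) S)" for S
    using sub unfolding patch_def by blast
  have "patch \<omega> (1 / \<epsilon>) T = patch \<omega> (1 / \<epsilon>) (translate T' s)"
    using restrict[of T] restrict[of "translate T' s"] s(2) by simp
  thus ?thesis
    using s(1) assms(3) unfolding tilings_close_def by force
qed

lemma istopology_tiling_open: "istopology (tiling_open \<phi> \<omega>)"
  unfolding istopology_def
proof (intro conjI allI impI)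
  fix S U assume S: "tiling_open \<phi> \<omega> S" and U: "tiling_open \<phi> \<omega> U"
  show "tiling_open \<phi> \<omega> (S \<inter> U)"
    unfolding tiling_open_def
  proof (intro conjI ballI)
    show "S \<inter> U \<subseteq> tiling_space \<phi> \<omega>" using S unfolding tiling_open_def by blast
    fix T assume T: "T \<in> S \<inter> U"
    obtain d where d: "d > 0" "\<forall>T'\<in>tiling_space \<phi> \<omega>. tilings_close \<omega> d T T' \<longrightarrow> T' \<in> S"
      using S T unfolding tiling_open_def by blast
    obtain e where e: "e > 0" "\<forall>T'\<in>tiling_space \<phi> \<omega>. tilings_close \<omega> e T T' \<longrightarrow> T' \<in> U"
      using U T unfolding tiling_open_def by blast
    have "min d e > 0" using d e by simp
    moreover have "\<forall>T'\<in>tiling_space \<phi> \<omega>. tilings_close \<omega> (min d e) T T' \<longrightarrow> T' \<in> S \<inter> U"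
      using d e tilings_close_mono[of \<omega> "min d e" T _ d] tilings_close_mono[of \<omega> "min d e" T _ e]
        \<open>min d e > 0\<close> by auto
    ultimately show "\<exists>\<epsilon>>0. \<forall>T'\<in>tiling_space \<phi> \<omega>. tilings_close \<omega> \<epsilon> T T' \<longrightarrow> T' \<in> S \<inter> U"
      by blast
  qed
next
  fix K assume K: "\<forall>S\<in>K. tiling_open \<phi> \<omega> S"
  show "tiling_open \<phi> \<omega> (\<Union>K)"
    unfolding tiling_open_def
  proof (intro conjI ballI)
    show "\<Union>K \<subseteq> tiling_space \<phi> \<omega>" using K unfolding tiling_open_def by blast
    fix T assume "T \<in> \<Union>K"
    then obtain S where S: "S \<in> K" "T \<in> S" by blast
    then obtain e where "e > 0" "\<forall>T'\<in>tiling_space \<phi> \<omega>. tilings_close \<omega> e T T' \<longrightarrow> T' \<in> S"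
      using K unfolding tiling_open_def by blast
    thus "\<exists>\<epsilon>>0. \<forall>T'\<in>tiling_space \<phi> \<omega>. tilings_close \<omega> \<epsilon> T T' \<longrightarrow> T' \<in> \<Union>K"
      using S(1) by blast
  qed
qed

lemma openin_tiling_topology: "openin (tiling_topology \<phi> \<omega>) = tiling_open \<phi> \<omega>"
  by (simp add: tiling_topology_def topology_inverse' istopology_tiling_open)

lemma topspace_tiling_topology: "topspace (tiling_topology \<phi> \<omega>) = tiling_space \<phi> \<omega>"
proof -
  have "tiling_open \<phi> \<omega> (tiling_space \<phi> \<omega>)"
    unfolding tiling_open_def using zero_less_one by blast
  moreover have "U \<subseteq> tiling_space \<phi> \<omega>" if "tiling_open \<phi> \<omega> U" for U
    using that by (simp add: tiling_open_def)
  ultimately show ?thesis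
    unfolding topspace_def openin_tiling_topology by blast
qed

definition compatible_metric ::
    "('a::finite \<Rightarrow> 'a list) \<Rightarrow> real^'a \<Rightarrow> ('a tiling \<Rightarrow> 'a tiling \<Rightarrow> real) \<Rightarrow> bool" where
  "compatible_metric \<phi> \<omega> d \<longleftrightarrow>
     Metric_space (tiling_space \<phi> \<omega>) d \<and>
     Metric_space.mtopology (tiling_space \<phi> \<omega>) d = tiling_topology \<phi> \<omega>"

definition forward_proximal ::
    "('a tiling \<Rightarrow> 'a tiling \<Rightarrow> real) \<Rightarrow> 'a tiling \<Rightarrow> 'a tiling \<Rightarrow> bool" where
  "forward_proximal d T T' \<longleftrightarrow>
     (\<exists>t :: nat \<Rightarrow> real. filterlim t at_top sequentially \<and>
        (\<lambda>k. d (translate T (- t k)) (translate T' (- t k))) \<longlonglongrightarrow> 0)"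

definition backward_proximal ::
    "('a tiling \<Rightarrow> 'a tiling \<Rightarrow> real) \<Rightarrow> 'a tiling \<Rightarrow> 'a tiling \<Rightarrow> bool" where
  "backward_proximal d T T' \<longleftrightarrow>
     (\<exists>t :: nat \<Rightarrow> real. filterlim t at_bot sequentially \<and>
        (\<lambda>k. d (translate T (- t k)) (translate T' (- t k))) \<longlonglongrightarrow> 0)"

definition proximal ::
    "('a tiling \<Rightarrow> 'a tiling \<Rightarrow> real) \<Rightarrow> 'a tiling \<Rightarrow> 'a tiling \<Rightarrow> bool" where
  "proximal d T T' \<longleftrightarrow> forward_proximal d T T' \<or> backward_proximal d T T'"


section \<open>The no cycle condition\<close>

definition S_plus :: "('a::finite \<Rightarrow> 'a list) \<Rightarrow> 'a set" where
  "S_plus \<phi> = (\<Inter>n. ((\<lambda>a. hd (\<phi> a)) ^^ n) ` UNIV)"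

definition S_minus :: "('a::finite \<Rightarrow> 'a list) \<Rightarrow> 'a set" where
  "S_minus \<phi> = (\<Inter>n. ((\<lambda>a. last (\<phi> a)) ^^ n) ` UNIV)"

definition P_pairs :: "('a::finite \<Rightarrow> 'a list) \<Rightarrow> ('a \<times> 'a) set" where
  "P_pairs \<phi> = {(a, b). a \<in> S_minus \<phi> \<and> b \<in> S_plus \<phi> \<and> [a, b] \<in> language \<phi>}"

text \<open>In a cycle \<open>(a\<^sub>1,a\<^sub>2), (a\<^sub>3,a\<^sub>2), \<dots>, (a\<^sub>1,a\<^sub>2\<^sub>n)\<close> we write \<open>p k\<close> for
  \<open>a\<^sub>2\<^sub>k\<^sub>+\<^sub>1\<close> and \<open>q k\<close> for \<open>a\<^sub>2\<^sub>k\<^sub>+\<^sub>2\<close>, where \<open>k < n\<close>.  Only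
  consecutive letters of the chains \<open>a\<^sub>1 \<noteq> a\<^sub>3 \<noteq> \<dots>\<close> and \<open>a\<^sub>2 \<noteq> a\<^sub>4 \<noteq> \<dots>\<close> are
  required to differ.\<close>

definition is_cycle :: "('a::finite \<Rightarrow> 'a list) \<Rightarrow> nat \<Rightarrow> (nat \<Rightarrow> 'a) \<Rightarrow> (nat \<Rightarrow> 'a) \<Rightarrow> bool" where
  "is_cycle \<phi> n p q \<longleftrightarrow> n \<ge> 2 \<and>
     (\<forall>k<n. (p k, q k) \<in> P_pairs \<phi>) \<and>
     (\<forall>k. k + 1 < n \<longrightarrow> (p (k + 1), q k) \<in> P_pairs \<phi>) \<and>
     (p 0, q (n - 1)) \<in> P_pairs \<phi> \<and>
     (\<forall>k. k + 1 < n \<longrightarrow> p k \<noteq> p (k + 1) \<and> q k \<noteq> q (k + 1))"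

definition no_cycle_condition :: "('a::finite \<Rightarrow> 'a list) \<Rightarrow> bool" where
  "no_cycle_condition \<phi> \<longleftrightarrow> \<not> (\<exists>n p q. is_cycle \<phi> n p q)"


section \<open>The Geometric Coincidence Condition\<close>

text \<open>Below, \<open>r\<close> is a positive right eigenvector for the dominant eigenvalue.\<close>

definition stable_space :: "('a::finite \<Rightarrow> 'a list) \<Rightarrow> real^'a \<Rightarrow> (real^'a) set" where
  "stable_space \<phi> r =
     (THE E. subspace E \<and> dim E = CARD('a) - 1 \<and>
        (\<forall>x\<in>E. abelianization \<phi> *v x \<in> E) \<and> E \<inter> span {r} = {0})"

text \<open>The pair \<open>(i, v)\<close> stands for the segment \<open>I\<^sub>i + v\<close>, whose point set determines both the
  direction \<open>i\<close> and the initial vertex \<open>v\<close>.\<close>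

type_synonym 'a segment = "'a \<times> (real^'a)"

definition segment_points :: "'a::finite segment \<Rightarrow> (real^'a) set" where
  "segment_points I = {snd I + s *\<^sub>R axis (fst I) 1 | s. 0 \<le> s \<and> s < 1}"

definition segment_shift :: "'a::finite segment \<Rightarrow> real^'a \<Rightarrow> 'a segment" where
  "segment_shift I x = (fst I, snd I + x)"

definition segment_image :: "('a::finite \<Rightarrow> 'a list) \<Rightarrow> 'a segment \<Rightarrow> 'a segment set" where
  "segment_image \<phi> I =
     {(\<phi> (fst I) ! n, abelianization \<phi> *v snd I + (\<Sum>j<n. axis (\<phi> (fst I) ! j) 1)) | n.
        n < length (\<phi> (fst I))}"

definition is_state :: "('a::finite \<Rightarrow> 'a list) \<Rightarrow> real^'a \<Rightarrow> 'a segment \<Rightarrow> bool" where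
  "is_state \<phi> r I \<longleftrightarrow> segment_points I \<inter> stable_space \<phi> r \<noteq> {}"

definition state_map :: "('a::finite \<Rightarrow> 'a list) \<Rightarrow> real^'a \<Rightarrow> 'a segment \<Rightarrow> 'a segment" where
  "state_map \<phi> r I = (THE J. J \<in> segment_image \<phi> I \<and> is_state \<phi> r J)"

definition GCC :: "('a::finite \<Rightarrow> 'a list) \<Rightarrow> real^'a \<Rightarrow> bool" where
  "GCC \<phi> r \<longleftrightarrow>
     (\<forall>I J. is_state \<phi> r I \<and> is_state \<phi> r J \<and> (\<forall>i. (snd I - snd J) $ i \<in> \<int>) \<longrightarrow>
        (\<forall>\<epsilon>>0. \<exists>t. \<bar>t\<bar> < \<epsilon> \<and>
           is_state \<phi> r (segment_shift I (t *\<^sub>R r)) \<and>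
           is_state \<phi> r (segment_shift J (t *\<^sub>R r)) \<and>
           (\<exists>n. (state_map \<phi> r ^^ n) (segment_shift I (t *\<^sub>R r)) =
                (state_map \<phi> r ^^ n) (segment_shift J (t *\<^sub>R r)))))"

end

theory Submission
  imports Defs "HOL-Computational_Algebra.Fundamental_Theorem_Algebra"
begin

text \<open>A homeomorphism \<open>h\<close> maps orbits to orbits, say \<open>h (T - t) = h T - \<tau>\<^sub>T(t)\<close>.  The point is that
  \<open>\<tau>\<^sub>T(t) = \<kappa> t + O(1)\<close> with one slope \<open>\<kappa>\<close> and one bound for all \<open>T\<close>.  If \<open>T - t\<^sub>k\<close> and \<open>T' - t\<^sub>k\<close>
  become close, then so do \<open>h T - \<tau>\<^sub>T(t\<^sub>k)\<close> and \<open>h T' - \<tau>\<^sub>T\<^sub>'(t\<^sub>k)\<close>, the two shifts differ by a bounded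
  amount, and a limit point of the differences is the required \<open>t\<^sub>0\<close>.

  For the estimate, cut \<open>T\<close> into supertiles of a high level.  Up to a bounded error, \<open>\<tau>\<^sub>T\<close> is a sum
  of a function \<open>D(a, b)\<close> over consecutive supertile types.  At the junctions of supertiles of a
  still higher level only pairs from \<open>P\<^sub>\<phi>\<close> occur; by the no cycle condition these form
  the edges of a forest, so that \<open>D(a, b) = f(a) + g(b)\<close> on them, and the sum becomes a sum of a
  function of single letters.  By the Pisot property such sums are proportional to length up to a
  bounded error.\<close>

section \<open>Linear algebra\<close>

text \<open>The obstacle is the accumulation of errors. A stretch of length t has about t junctions,
  and knowing the image at each of them only up to a small shift would leave an error proportional
  to t, so D(a, b) has to be exact. It can be: tilings with the same local pattern have images that
  match after a small shift, that shift is unique while it stays below half the shortest tile, and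
  so it can be followed along the orbit without loss. Aperiodicity, itself a consequence of the
  Pisot property, makes the shift along an orbit single-valued.

  The no cycle condition speaks only of pairs whose entries survive all iterates of the last-letter
  and first-letter maps. Hence two levels: one dictated by the modulus of continuity of
  \<open>h\<close>, and more substitutions on top that push every junction into this set.

  Two points remain for the end. The shifts along which the images become close must be unbounded;
  this comes from a linear bound for the inverse of \<open>h\<close>. And nothing fixes the sign of
  the slope, so forward proximality may turn into backward proximality.\<close>

definition poly_apply :: "complex^'n^'n \<Rightarrow> complex poly \<Rightarrow> complex^'n \<Rightarrow> complex^'n" where
  "poly_apply M p v = fold_coeffs (\<lambda>a x. a *s v + M *v x) p 0"

lemma poly_apply_0 [simp]: "poly_apply M 0 v = 0"
  by (simp add: poly_apply_def)

lemma poly_apply_pCons [simp]: "poly_apply M (pCons a p) v = a *s v + M *v poly_apply M p v"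
  by (cases "a = 0 \<and> p = 0") (auto simp: poly_apply_def)

lemma poly_apply_add: "poly_apply M (p + q) v = poly_apply M p v + poly_apply M q v"
  by (induction p q rule: poly_induct2) (simp_all add: matrix_vector_right_distrib vec.scale_left_distrib)

lemma poly_apply_smult: "poly_apply M (smult c p) v = c *s poly_apply M p v"
  by (induction p) (simp_all add: vector_scalar_commute vec.scale_right_distrib)

lemma poly_apply_sum: "poly_apply M (sum p I) v = (\<Sum>i\<in>I. poly_apply M (p i) v)"
  by (induction I rule: infinite_finite_induct) (simp_all add: poly_apply_add)

lemma poly_apply_monom: "poly_apply M (monom c n) v = c *s (((*v) M ^^ n) v)"
  by (induction n) (simp_all add: monom_0 monom_Suc vector_scalar_commute)

lemma poly_apply_linear_factor:
  "poly_apply M ([:-\<mu>, 1:] * q) v = M *v poly_apply M q v - \<mu> *s poly_apply M q v"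
proof -
  have "[:-\<mu>, 1:] * q = pCons 0 q + smult (-\<mu>) q" by simp
  thus ?thesis by (simp only: poly_apply_add poly_apply_smult poly_apply_pCons) (simp add: vec.scale_minus_left)
qed

lemma poly_apply_shifted:
  "poly_apply M q (M *v v - \<mu> *s v) = M *v poly_apply M q v - \<mu> *s poly_apply M q v"
  by (induction q)
    (simp_all add: matrix_vector_right_distrib matrix_vector_mult_diff_distrib vector_scalar_commute
      vec.scale_right_distrib vec.scale_right_diff_distrib mult.commute)

lemma poly_apply_mem:
  assumes "vec.subspace V" "\<And>w. w \<in> V \<Longrightarrow> M *v w \<in> V" "v \<in> V"
  shows "poly_apply M p v \<in> V"
  by (induction p) (use assms in \<open>simp_all add: vec.subspace_0 vec.subspace_add vec.subspace_scale\<close>)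

text \<open>The iterates \<open>v\<close>, \<open>M v\<close>, ... up to exponent
  \<open>CARD('n)\<close> are one too many to be independent. Coincidences among them are a separate
  case, since dependence of a set does not see repetitions.\<close>

lemma annihilating_poly_exists:
  fixes M :: "complex^'n^'n"
  shows "\<exists>p. p \<noteq> 0 \<and> poly_apply M p v = 0"
proof (cases "inj_on (\<lambda>i. ((*v) M ^^ i) v) {..CARD('n)}")
  case True
  let ?f = "\<lambda>i. ((*v) M ^^ i) v"
  let ?B = "?f ` {..CARD('n)}"
  have "card ?B = Suc (CARD('n))" using True by (simp add: card_image)
  hence "vec.dependent ?B"
    using vec.independent_card_le_dim[of ?B UNIV] vec_dim_card[where 'a=complex and 'n='n] by fastforce
  then obtain u where u: "\<exists>w\<in>?B. u w \<noteq> 0" "(\<Sum>w\<in>?B. u w *s w) = 0"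
    using vec.dependent_finite[of ?B] by blast
  let ?p = "\<Sum>i\<le>CARD('n). monom (u (?f i)) i"
  have "poly_apply M ?p v = (\<Sum>w\<in>?B. u w *s w)"
    using True by (simp add: poly_apply_sum poly_apply_monom sum.reindex)
  moreover have "?p \<noteq> 0"
  proof -
    obtain i where i: "i \<le> CARD('n)" "u (?f i) \<noteq> 0" using u(1) by blast
    have "coeff ?p i = u (?f i)"
      using i(1) by (simp add: coeff_sum coeff_monom sum.delta' )
    thus ?thesis using i(2) by auto
  qed
  ultimately show ?thesis using u(2) by metis
next
  case False
  then obtain i j where ij: "i \<noteq> j" "((*v) M ^^ i) v = ((*v) M ^^ j) v"
    by (auto simp: inj_on_def)
  let ?p = "monom 1 i + monom (-1) j :: complex poly"
  have "coeff ?p i = 1" using ij(1) by simp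
  hence "?p \<noteq> 0" by (metis coeff_0 zero_neq_one)
  moreover have "poly_apply M ?p v = 0"
    using ij(2) by (simp add: poly_apply_add poly_apply_monom)
  ultimately show ?thesis by blast
qed

text \<open>If \<open>p\<close> has least degree and p = (x - \<mu>) q, then q(M) v is nonzero and
  an eigenvector for \<mu>. Working with the annihilator of one vector, instead of the
  characteristic polynomial, keeps this eigenvector inside \<open>V\<close>.\<close>

lemma minimal_annihilating_poly_roots:
  fixes M :: "complex^'n^'n"
  assumes "vec.subspace V" "\<And>w. w \<in> V \<Longrightarrow> M *v w \<in> V" "v \<in> V"
  obtains p where "p \<noteq> 0" "poly_apply M p v = 0"
    "\<And>\<mu>. poly p \<mu> = 0 \<Longrightarrow> \<exists>w\<in>V. w \<noteq> 0 \<and> M *v w = \<mu> *s w"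
proof -
  obtain p where p: "p \<noteq> 0" "poly_apply M p v = 0"
    and least: "\<And>q. q \<noteq> 0 \<Longrightarrow> poly_apply M q v = 0 \<Longrightarrow> degree p \<le> degree q"
    using exists_least_iff[of "\<lambda>n. \<exists>p. p \<noteq> 0 \<and> poly_apply M p v = 0 \<and> degree p = n"]
      annihilating_poly_exists[of M v] by (metis not_le_imp_less)
  show thesis
  proof (rule that[OF p])
    fix \<mu> assume "poly p \<mu> = 0"
    then obtain q where q: "p = [:-\<mu>, 1:] * q" by (auto simp: poly_eq_0_iff_dvd)
    have "q \<noteq> 0" using p(1) q by auto
    hence "degree p = Suc (degree q)" unfolding q by (simp add: degree_mult_eq del: mult_pCons_left)
    hence "poly_apply M q v \<noteq> 0" using least[of q] \<open>q \<noteq> 0\<close> by force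
    moreover have "M *v poly_apply M q v = \<mu> *s poly_apply M q v"
      using p(2) poly_apply_linear_factor[of M \<mu> q v] unfolding q by simp
    ultimately show "\<exists>w\<in>V. w \<noteq> 0 \<and> M *v w = \<mu> *s w"
      using poly_apply_mem[of V M v q, OF assms] by blast
  qed
qed

lemma norm_smult_complex: "norm (c *s (x :: complex^'n)) = cmod c * norm x"
  by (simp add: norm_vec_def norm_mult L2_set_right_distrib)

text \<open>Summing the recursion bounds (1 - c) times every partial sum of \<open>a\<close> by
  \<open>a 0 + suminf b\<close>.\<close>

lemma summable_contraction:
  fixes a b :: "nat \<Rightarrow> real"
  assumes "summable b" "0 \<le> c" "c < 1" "\<And>k. 0 \<le> a k" "\<And>k. 0 \<le> b k"
    "\<And>k. a (Suc k) \<le> c * a k + b k"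
  shows "summable a"
proof (rule summableI_nonneg_bounded)
  let ?B = "(a 0 + suminf b) / (1 - c)"
  show "sum a {..<n} \<le> ?B" for n
  proof -
    have "sum a {..<Suc n} \<le> a 0 + c * sum a {..<n} + sum b {..<n}"
    proof (induction n)
      case (Suc n)
      have "c * sum a {..<Suc n} = c * sum a {..<n} + c * a n" by (simp add: distrib_left)
      thus ?case using Suc assms(6)[of n] by simp
    qed simp
    moreover have "sum a {..<n} \<le> sum a {..<Suc n}" using assms(4) by simp
    moreover have "sum b {..<n} \<le> suminf b" using assms(1,5) by (simp add: sum_le_suminf)
    ultimately have "(1 - c) * sum a {..<n} \<le> a 0 + suminf b"
      by (simp add: left_diff_distrib)
    thus ?thesis using assms(3) by (simp add: pos_le_divide_eq mult.commute)
  qed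
  show "0 \<le> a n" for n by (rule assms(4))
qed

text \<open>Induction on the degree: for a root \<mu>, the vector M v - \<mu> v is annihilated by a
  polynomial of smaller degree, and the powers applied to \<open>v\<close> obey a contraction of
  rate \<open>cmod \<mu>\<close> driven by a summable term. This covers nontrivial Jordan blocks as
  well.\<close>

lemma summable_powers_of_annihilated:
  fixes M :: "complex^'n^'n"
  assumes "p \<noteq> 0" "poly_apply M p v = 0" "\<And>\<mu>. poly p \<mu> = 0 \<Longrightarrow> cmod \<mu> < 1"
  shows "summable (\<lambda>k. norm (((*v) M ^^ k) v))"
  using assms
proof (induction "degree p" arbitrary: p v)
  case 0
  then obtain c where c: "p = [:c:]" using degree_eq_zeroE by metis
  have "v = 0" using 0 c by simp
  have "((*v) M ^^ k) (0 :: complex^'n) = 0" for k by (induction k) simp_all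
  thus ?case using \<open>v = 0\<close> by simp
next
  case (Suc n)
  have "\<not> constant (poly p)" using Suc(2) by (simp add: constant_degree)
  then obtain \<mu> where \<mu>: "poly p \<mu> = 0" using fundamental_theorem_of_algebra by blast
  then obtain q where q: "p = [:-\<mu>, 1:] * q" by (auto simp: poly_eq_0_iff_dvd)
  have "q \<noteq> 0" using Suc q by auto
  have deg: "n = degree q"
    using Suc(2) \<open>q \<noteq> 0\<close> unfolding q by (simp add: degree_mult_eq del: mult_pCons_left)
  let ?z = "M *v v - \<mu> *s v"
  have "poly_apply M q ?z = 0"
    using Suc(4) unfolding q poly_apply_linear_factor poly_apply_shifted .
  hence *: "summable (\<lambda>k. norm (((*v) M ^^ k) ?z))"
    using Suc(1)[OF deg \<open>q \<noteq> 0\<close>] Suc(5) unfolding q by simp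
  have pow: "((*v) M ^^ Suc k) v = \<mu> *s ((*v) M ^^ k) v + ((*v) M ^^ k) ?z" for k
    by (induction k) (simp_all add: matrix_vector_right_distrib vector_scalar_commute)
  show ?case
  proof (rule summable_contraction[OF *])
    show "0 \<le> cmod \<mu>" "cmod \<mu> < 1" using Suc(5) \<mu> by auto
    show "norm (((*v) M ^^ Suc k) v) \<le> cmod \<mu> * norm (((*v) M ^^ k) v) + norm (((*v) M ^^ k) ?z)" for k
      unfolding pow using norm_triangle_ineq norm_smult_complex by metis
  qed auto
qed

lemma summable_powers_on_subspace:
  fixes M :: "complex^'n^'n"
  assumes "vec.subspace V" "\<And>w. w \<in> V \<Longrightarrow> M *v w \<in> V" "v \<in> V"
    and "\<And>w \<mu>. w \<in> V \<Longrightarrow> w \<noteq> 0 \<Longrightarrow> M *v w = \<mu> *s w \<Longrightarrow> cmod \<mu> < 1"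
  shows "summable (\<lambda>k. norm (((*v) M ^^ k) v))"
  using minimal_annihilating_poly_roots[of V M v, OF assms(1-3)]
    summable_powers_of_annihilated[of _ M v] assms(4) by metis

text \<open>Two independent eigenvectors force a double root. \<open>P\<close> is the identity with
  columns \<open>i\<close> and \<open>j\<close> replaced by \<open>r\<close> and \<open>w\<close>;
  multiplying x - M by it makes both columns divisible by x - c, and determinants do the rest. The
  hypotheses on coordinate \<open>i\<close> are a normal form of independence that makes
  \<open>P\<close> visibly invertible.\<close>

lemma square_dvd_charpoly:
  fixes M :: "complex^'n^'n"
  assumes r: "M *v r = c *s r" and w: "M *v w = c *s w" and i: "r $ i \<noteq> 0" "w $ i = 0" "w \<noteq> 0"
  shows "[:-c, 1:]^2 dvd charpoly M"
proof -
  obtain j where j: "w $ j \<noteq> 0" using i(3) by (auto simp: vec_eq_iff)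
  have ij: "i \<noteq> j" using i j by auto
  define P :: "complex^'n^'n" where
    "P = (\<chi> a b. if b = i then r $ a else if b = j then w $ a else if a = b then 1 else 0)"
  define P' where "P' = map_matrix (\<lambda>x. [:x:]) P"
  define X where "X = mat [:0, 1:] - map_matrix (\<lambda>x. [:x:]) M"
  define Q where "Q = (\<chi> a b. if b = i then [:r $ a:] else if b = j then [:w $ a:] else (X ** P') $ a $ b)"
  define \<Delta> :: "complex poly^'n^'n" where
    "\<Delta> = (\<chi> a b. if a = b then (if b = i \<or> b = j then [:-c, 1:] else 1) else 0)"
  have Pker: "x = 0" if "P *v x = 0" for x
  proof -
    have *: "(\<Sum>b\<in>UNIV. P $ a $ b * x $ b) = 0" for a
      using that by (simp add: matrix_vector_mult_def vec_eq_iff)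
    have split: "(\<Sum>b\<in>UNIV. P $ a $ b * x $ b) = r $ a * x $ i + w $ a * x $ j
        + (if a = i \<or> a = j then 0 else x $ a)" for a
    proof -
      have "(\<Sum>b\<in>UNIV. P $ a $ b * x $ b) = P $ a $ i * x $ i + (P $ a $ j * x $ j + (\<Sum>b\<in>UNIV-{i}-{j}. P $ a $ b * x $ b))"
        using ij by (simp add: sum.remove[of UNIV i] sum.remove[of "UNIV - {i}" j])
      also have "(\<Sum>b\<in>UNIV-{i}-{j}. P $ a $ b * x $ b) = (\<Sum>b\<in>UNIV-{i}-{j}. if a = b then x $ b else 0)"
        by (intro sum.cong) (auto simp: P_def)
      finally show ?thesis using ij by (auto simp: P_def)
    qed
    have xi: "x $ i = 0" using *[of i] split[of i] i by simp
    have xj: "x $ j = 0" using *[of j] split[of j] xi j by simp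
    show ?thesis using * split xi xj by (auto simp: vec_eq_iff) (metis add_0 mult_zero_right)
  qed
  hence "invertible P"
    using matrix_left_invertible_ker[of P] by (metis invertible_left_inverse)
  hence "det P \<noteq> 0" by (simp add: invertible_det_nz)
  have "det P' = [:det P:]"
    unfolding det_def P'_def map_matrix_def
    by (simp add: sum_to_poly prod_to_poly of_int_poly mult.commute)
  have eig: "(\<Sum>b\<in>UNIV. X $ a $ b * [:y $ b:]) = [:y $ a:] * [:-c, 1:]" if "M *v y = c *s y" for y a
  proof -
    have "(\<Sum>b\<in>UNIV. X $ a $ b * [:y $ b:]) = (\<Sum>b\<in>UNIV. (if a = b then [:0, y $ b:] else 0) - [:M $ a $ b * y $ b:])"
      by (intro sum.cong) (auto simp: X_def mat_def map_matrix_def algebra_simps)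
    also have "\<dots> = [:0, y $ a:] - [:\<Sum>b\<in>UNIV. M $ a $ b * y $ b:]"
      by (simp add: sum_subtractf sum_to_poly)
    also have "(\<Sum>b\<in>UNIV. M $ a $ b * y $ b) = c * y $ a"
      using that by (simp add: matrix_vector_mult_def vec_eq_iff)
    finally show ?thesis by (simp add: mult.commute)
  qed
  have XP: "(X ** P') $ a $ i = [:r $ a:] * [:-c, 1:]" "(X ** P') $ a $ j = [:w $ a:] * [:-c, 1:]" for a
    using eig[OF r, of a] eig[OF w, of a] ij
    by (auto simp: matrix_matrix_mult_def P'_def P_def map_matrix_def)
  have "X ** P' = Q ** \<Delta>"
  proof -
    have "(Q ** \<Delta>) $ a $ b = (X ** P') $ a $ b" for a b
    proof -
      have "(Q ** \<Delta>) $ a $ b = (\<Sum>k\<in>UNIV. if k = b then Q $ a $ k * (if b = i \<or> b = j then [:-c, 1:] else 1) else 0)"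
        unfolding matrix_matrix_mult_def \<Delta>_def vec_lambda_beta by (intro sum.cong) auto
      also have "\<dots> = Q $ a $ b * (if b = i \<or> b = j then [:-c, 1:] else 1)" by simp
      also have "\<dots> = (X ** P') $ a $ b" using XP by (auto simp: Q_def)
      finally show ?thesis .
    qed
    thus ?thesis by (simp add: vec_eq_iff)
  qed
  hence "det X * det P' = det Q * det \<Delta>" by (metis det_mul)
  moreover have "det \<Delta> = [:-c, 1:]^2"
  proof -
    have "det \<Delta> = (\<Prod>b\<in>UNIV. \<Delta> $ b $ b)" by (rule det_diagonal) (auto simp: \<Delta>_def)
    also have "\<dots> = [:-c, 1:] * ([:-c, 1:] * (\<Prod>b\<in>UNIV-{i}-{j}. \<Delta> $ b $ b))"
      using ij by (simp add: prod.remove[of UNIV i] prod.remove[of "UNIV - {i}" j] \<Delta>_def del: mult_pCons_left mult_pCons_right)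
    also have "(\<Prod>b\<in>UNIV-{i}-{j}. \<Delta> $ b $ b) = 1" by (rule prod.neutral) (auto simp: \<Delta>_def)
    finally show ?thesis by (simp add: power2_eq_square)
  qed
  ultimately have "[:-c, 1:]^2 dvd det X * [:det P:]"
    using \<open>det P' = _\<close> by (metis dvd_triv_right)
  hence "[:-c, 1:]^2 dvd smult (det P) (det X)" by (simp add: mult.commute)
  thus ?thesis using \<open>det P \<noteq> 0\<close> by (simp add: dvd_smult_iff charpoly_def X_def)
qed

lemma poly_det: "poly (det X) c = det (map_matrix (\<lambda>p. poly p c) (X :: complex poly^'n^'n))"
  by (simp add: det_def poly_sum poly_prod map_matrix_def)

lemma eigenvalue_of_charpoly_root:
  assumes "poly (charpoly M) c = 0"
  shows "eigenvalue M c"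
proof -
  have "map_matrix (\<lambda>p. poly p c) (mat [:0, 1:] - map_matrix (\<lambda>x. [:x:]) M) = mat c - M"
    by (simp add: map_matrix_def vec_eq_iff mat_def)
  hence "det (mat c - M) = 0" using assms by (simp add: charpoly_def poly_det)
  hence "\<not> invertible (mat c - M)" by (simp add: invertible_det_nz)
  then obtain v where v: "v \<noteq> 0" "(mat c - M) *v v = 0"
    using matrix_left_invertible_ker[of "mat c - M"] by (metis invertible_left_inverse)
  have "mat c *v v = c *s v"
    by (simp add: matrix_vector_mult_def mat_def vec_eq_iff if_distrib [of "\<lambda>x. x * _"] cong: if_cong)
  hence "M *v v = c *s v" using v(2) by (simp add: matrix_vector_mult_diff_rdistrib)
  thus ?thesis using v(1) by (auto simp: eigenvalue_def)
qed

section \<open>Complexification of real vectors\<close>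

definition cvec :: "real^'n \<Rightarrow> complex^'n" where
  "cvec v = (\<chi> i. complex_of_real (v $ i))"

lemma cvec_nth [simp]: "cvec v $ i = complex_of_real (v $ i)"
  by (simp add: cvec_def)

lemma cvec_mult: "map_matrix complex_of_real A *v cvec v = cvec (A *v v)"
  by (simp add: vec_eq_iff matrix_vector_mult_def map_matrix_def)

lemma cvec_pow:
  fixes A :: "real^'n^'n"
  shows "((*v) (map_matrix complex_of_real A) ^^ k) (cvec v) = cvec (((*v) A ^^ k) v)"
  by (induction k) (simp_all add: cvec_mult)

lemma norm_cvec: "norm (cvec v) = norm v"
  by (simp add: norm_vec_def)

section \<open>Pisot substitutions\<close>

locale tile_lengths =
  fixes \<omega> :: "real^'a::finite"
  assumes omega_pos: "\<omega> $ i > 0"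
begin

definition len :: "'a list \<Rightarrow> real" where
  "len w = (\<Sum>a\<leftarrow>w. \<omega> $ a)"

lemma len_simps [simp]: "len [] = 0" "len (a # w) = \<omega> $ a + len w" "len (u @ w) = len u + len w"
  by (simp_all add: len_def)

lemma len_nonneg: "len w \<ge> 0"
  by (induction w) (simp_all add: omega_pos less_imp_le add_nonneg_nonneg)

definition wmin :: real where "wmin = Min (range (($) \<omega>))"
definition wmax :: real where "wmax = Max (range (($) \<omega>))"

lemma wmin_le: "wmin \<le> \<omega> $ i" and wmax_ge: "\<omega> $ i \<le> wmax"
  by (auto simp: wmin_def wmax_def)

lemma wmin_pos: "wmin > 0"
  by (auto simp: wmin_def omega_pos)

lemma wmax_pos: "wmax > 0"
  using wmax_ge omega_pos by (meson less_le_trans)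

lemma len_ge: "len w \<ge> wmin * real (length w)"
  by (induction w) (auto simp: algebra_simps intro: add_mono wmin_le)

lemma len_le: "len w \<le> wmax * real (length w)"
  by (induction w) (auto simp: algebra_simps intro: add_mono wmax_ge)

end

locale pisot =
  fixes \<phi> :: "'a::finite \<Rightarrow> 'a list" and \<omega> r :: "real^'a"
  assumes subst: "substitution \<phi>" and sp: "strong_pisot \<phi>"
    and left: "left_pf_vector \<phi> \<omega>" and right: "right_pf_vector \<phi> r"
begin

abbreviation "A \<equiv> abelianization \<phi>"
abbreviation "CA \<equiv> complex_abelianization \<phi>"
abbreviation "lam \<equiv> pf_eigenvalue \<phi>"

sublocale tile_lengths \<omega>
  using left by unfold_locales (simp add: left_pf_vector_def)

lemma r_pos: "r $ i > 0"
  using right by (simp add: right_pf_vector_def)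

lemma left_eigen: "\<omega> v* A = lam *s \<omega>" and right_eigen: "A *v r = lam *s r"
  using left right by (auto simp: left_pf_vector_def right_pf_vector_def)

lemma omega_A: "inner \<omega> (A *v x) = lam * inner \<omega> x"
proof -
  have "inner \<omega> (A *v x) = inner (\<omega> v* A) x"
    by (simp add: dot_lmul_matrix)
  thus ?thesis unfolding left_eigen by (simp add: inner_vec_def sum_distrib_left mult.assoc)
qed

lemma eigenvalue_modulus:
  assumes "CA *v w = c *s w" "w \<noteq> 0" "c \<noteq> complex_of_real lam"
  shows "0 < cmod c" "cmod c < 1"
  using sp assms unfolding strong_pisot_def eigenvalue_def by blast+

text \<open>If it were zero, every complex number would be an eigenvalue. The case must be excluded
  because \<open>order\<close> counts multiplicities only for nonzero polynomials.\<close>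

lemma charpoly_nz: "charpoly CA \<noteq> 0"
proof
  assume "charpoly CA = 0"
  hence ev: "eigenvalue CA c" for c by (intro eigenvalue_of_charpoly_root) simp
  \<comment> \<open>A number that differs from \<open>lam\<close> and has modulus at least
    1.\<close>
  define c where "c = complex_of_real (\<bar>lam\<bar> + 1)"
  have "c \<noteq> complex_of_real lam" unfolding c_def of_real_eq_iff by simp
  hence "cmod c < 1" using ev[of c] sp unfolding strong_pisot_def by blast
  thus False unfolding c_def norm_of_real by simp
qed

lemma CA_cvec: "CA *v cvec v = cvec (A *v v)"
  by (simp add: complex_abelianization_def cvec_mult)

text \<open>Since the inner product of \<omega> and \<open>r\<close> is positive, a nonzero
  \<open>w\<close> of this kind is not a multiple of \<open>r\<close>; \<open>lam\<close> would then
  have two independent eigenvectors and could not be a simple root.\<close>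

lemma pf_eigenvector_not_stable:
  assumes "CA *v w = complex_of_real lam *s w" "(\<Sum>i\<in>UNIV. complex_of_real (\<omega> $ i) * w $ i) = 0"
  shows "w = 0"
proof (rule ccontr)
  assume "w \<noteq> 0"
  let ?c = "complex_of_real lam" and ?r = "cvec r"
  have r: "CA *v ?r = ?c *s ?r" unfolding CA_cvec right_eigen by (simp add: vec_eq_iff)
  fix i :: 'a
  \<comment> \<open>The multiple of \<open>r\<close> is chosen to clear coordinate \<open>i\<close>,
    as \<open>square_dvd_charpoly\<close> requires.\<close>
  define w' where "w' = w - (w $ i / ?r $ i) *s ?r"
  have ri: "?r $ i \<noteq> 0" using r_pos[of i] by simp
  have "CA *v w' = ?c *s w'"
    unfolding w'_def matrix_vector_mult_diff_distrib vector_scalar_commute assms(1) r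
    by (simp add: vec_eq_iff algebra_simps)
  moreover have "w' $ i = 0" using ri by (simp add: w'_def)
  moreover have "w' \<noteq> 0"
  proof
    assume "w' = 0"
    define z where "z = w $ i / ?r $ i"
    have w: "w $ k = z * ?r $ k" for k using \<open>w' = 0\<close> unfolding w'_def z_def[symmetric] by (simp add: vec_eq_iff)
    have "0 = (\<Sum>k\<in>UNIV. complex_of_real (\<omega> $ k) * (z * ?r $ k))"
      using assms(2) unfolding w by simp
    also have "\<dots> = z * complex_of_real (\<Sum>k\<in>UNIV. \<omega> $ k * r $ k)"
      by (simp add: sum_distrib_left mult_ac)
    finally have "z = 0 \<or> (\<Sum>k\<in>UNIV. \<omega> $ k * r $ k) = 0"
      by (metis mult_eq_0_iff of_real_eq_0_iff)
    moreover have "(\<Sum>k\<in>UNIV. \<omega> $ k * r $ k) > 0"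
      by (intro sum_pos) (auto simp: omega_pos r_pos)
    ultimately have "w = 0" using w by (auto simp: vec_eq_iff)
    thus False using \<open>w \<noteq> 0\<close> by blast
  qed
  ultimately have "[:-?c, 1:]^2 dvd charpoly CA" using square_dvd_charpoly[OF r _ ri] by blast
  hence "2 \<le> order ?c (charpoly CA)" using charpoly_nz by (simp add: order_divides)
  thus False using sp by (simp add: strong_pisot_def)
qed

text \<open>The kernel of \<omega> is the stable space. It is invariant because \<omega> is a left
  eigenvector, and its complexification contains no eigenvector for \<open>lam\<close>, so only
  eigenvalues of modulus below 1 occur on it.\<close>

lemma summable_stable:
  assumes "inner \<omega> v = 0"
  shows "summable (\<lambda>k. norm (((*v) A ^^ k) v))"
proof -
  define V where "V = {w :: complex^'a. (\<Sum>i\<in>UNIV. complex_of_real (\<omega> $ i) * w $ i) = 0}"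
  have dot: "(\<Sum>i\<in>UNIV. complex_of_real (\<omega> $ i) * (CA *v w) $ i) =
      complex_of_real lam * (\<Sum>i\<in>UNIV. complex_of_real (\<omega> $ i) * w $ i)" for w
  proof -
    have l: "(\<Sum>i\<in>UNIV. \<omega> $ i * A $ i $ j) = lam * \<omega> $ j" for j
      using left_eigen by (simp add: vec_eq_iff vector_matrix_mult_def mult.commute)
    have "(\<Sum>i\<in>UNIV. complex_of_real (\<omega> $ i) * (CA *v w) $ i)
        = (\<Sum>i\<in>UNIV. \<Sum>j\<in>UNIV. complex_of_real (\<omega> $ i * A $ i $ j) * w $ j)"
      by (simp add: matrix_vector_mult_def complex_abelianization_def map_matrix_def sum_distrib_left mult.assoc)
    also have "\<dots> = (\<Sum>j\<in>UNIV. complex_of_real (\<Sum>i\<in>UNIV. \<omega> $ i * A $ i $ j) * w $ j)"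
      by (subst sum.swap) (simp add: sum_distrib_right)
    finally show ?thesis unfolding l by (simp add: sum_distrib_left mult.assoc)
  qed
  have "summable (\<lambda>k. norm (((*v) CA ^^ k) (cvec v)))"
  proof (rule summable_powers_on_subspace[of V])
    show "vec.subspace V"
      unfolding vec.subspace_def V_def
      by (auto simp: distrib_left sum.distrib mult.left_commute simp flip: sum_distrib_left)
    show "CA *v w \<in> V" if "w \<in> V" for w using that dot by (simp add: V_def)
    have "(\<Sum>i\<in>UNIV. complex_of_real (\<omega> $ i) * cvec v $ i) = complex_of_real (inner \<omega> v)"
      by (simp add: inner_vec_def)
    thus "cvec v \<in> V" using assms by (simp add: V_def)
    show "cmod \<mu> < 1" if "w \<in> V" "w \<noteq> 0" "CA *v w = \<mu> *s w" for w \<mu>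
      using that pf_eigenvector_not_stable[of w] eigenvalue_modulus[of w \<mu>] by (auto simp: V_def)
  qed
  thus ?thesis by (simp add: complex_abelianization_def cvec_pow norm_cvec)
qed

definition ab :: "'a list \<Rightarrow> real^'a" where
  "ab w = (\<chi> i. real (count_list w i))"

lemma ab_simps [simp]: "ab [] = 0" "ab (u @ v) = ab u + ab v"
  by (simp_all add: ab_def vec_eq_iff)

lemma ab_Cons: "ab (a # w) = axis a 1 + ab w"
  by (simp add: ab_def vec_eq_iff axis_def)

lemma ab_subst_word: "ab (subst_word \<phi> w) = A *v ab w"
proof (induction w)
  case (Cons a w)
  have "A *v axis a 1 = ab (\<phi> a)"
    by (simp add: matrix_vector_mult_def abelianization_def axis_def ab_def vec_eq_iff
        if_distrib[of "\<lambda>x. _ * x"] cong: if_cong)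
  thus ?case using Cons by (simp add: subst_word_def ab_Cons matrix_vector_right_distrib)
qed (simp add: subst_word_def)

lemma ab_subst_word_pow: "ab ((subst_word \<phi> ^^ n) w) = ((*v) A ^^ n) (ab w)"
  by (induction n) (simp_all add: ab_subst_word)

lemma ab_sum_list: "inner y (ab w) = (\<Sum>a\<leftarrow>w. y $ a)"
  by (induction w) (simp_all add: ab_Cons inner_add_right inner_axis)

lemma phi_nonempty: "\<phi> a \<noteq> []"
  using subst by (simp add: substitution_def)

lemma len_eq: "len w = inner \<omega> (ab w)"
  by (simp add: len_def ab_sum_list)

lemma len_subst_word: "len (subst_word \<phi> w) = lam * len w"
  by (simp add: len_eq ab_subst_word omega_A)

lemma len_subst_word_pow: "len ((subst_word \<phi> ^^ n) w) = lam ^ n * len w"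
  by (induction n) (simp_all add: len_subst_word)

text \<open>Measured on the shortest prototile: its image has at least one tile, and no tile is
  shorter.\<close>

lemma lambda_ge_1: "lam \<ge> 1"
proof -
  obtain i where i: "\<omega> $ i = wmin"
    using Min_in[of "range (($) \<omega>)"] unfolding wmin_def by fastforce
  have "lam * wmin = len (\<phi> i)" using len_subst_word[of "[i]"] i by (simp add: subst_word_def)
  also have "\<dots> \<ge> wmin * real (length (\<phi> i))" by (rule len_ge)
  also have "wmin * real (length (\<phi> i)) \<ge> wmin * 1"
    using phi_nonempty[of i] wmin_pos by (intro mult_left_mono) (auto simp: Suc_le_eq)
  finally show ?thesis using wmin_pos by (simp add: mult.commute)
qed

text \<open>The lower bound in the strong Pisot property is used here: 0 is not an
  eigenvalue.\<close>

lemma A_injective: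
  assumes "A *v v = 0"
  shows "v = 0"
proof (rule ccontr)
  assume "v \<noteq> 0"
  hence "cvec v \<noteq> 0" by (auto simp: vec_eq_iff)
  moreover have "CA *v cvec v = 0 *s cvec v" using assms by (simp add: CA_cvec vec_eq_iff)
  moreover have "0 \<noteq> complex_of_real lam" using lambda_ge_1 by simp
  ultimately show False using eigenvalue_modulus(1) by fastforce
qed

lemma A_pow_injective:
  assumes "((*v) A ^^ k) v = 0"
  shows "v = 0"
  using assms by (induction k) (auto dest: A_injective)

lemma A_pow_linear: "linear ((*v) A ^^ k)"
proof (induction k)
  case (Suc k)
  show ?case using linear_compose[OF Suc matrix_vector_mul_linear] by (simp only: funpow.simps)
qed (simp add: id_def linear_id[unfolded id_def])

text \<open>\<open>coef\<close> and \<open>stab\<close> are the two parts of a vector in the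
  splitting into the line of \<open>r\<close> and the kernel of \<omega>.\<close>

definition coef :: "real^'a \<Rightarrow> real" where "coef v = inner \<omega> v / inner \<omega> r"
definition stab :: "real^'a \<Rightarrow> real^'a" where "stab v = v - coef v *\<^sub>R r"

lemma omega_r_pos: "inner \<omega> r > 0"
  unfolding inner_vec_def by (intro sum_pos) (auto simp: omega_pos r_pos)

lemma stab_stable: "inner \<omega> (stab v) = 0"
  using omega_r_pos by (simp add: stab_def coef_def inner_diff_right)

lemma A_pow_r: "((*v) A ^^ k) r = lam ^ k *\<^sub>R r"
  by (induction k) (simp_all add: right_eigen matrix_vector_mult_scaleR scalar_mult_eq_scaleR)

lemma A_pow_split: "((*v) A ^^ k) v = (lam ^ k * coef v) *\<^sub>R r + ((*v) A ^^ k) (stab v)"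
proof -
  have "((*v) A ^^ k) v = ((*v) A ^^ k) (coef v *\<^sub>R r + stab v)" by (simp add: stab_def)
  also have "\<dots> = coef v *\<^sub>R ((*v) A ^^ k) r + ((*v) A ^^ k) (stab v)"
    using A_pow_linear[of k] by (simp add: linear_add linear_scale)
  finally show ?thesis by (simp add: A_pow_r mult.commute)
qed

lemma A_pow_stab_tendsto: "(\<lambda>k. (((*v) A ^^ k) (stab v)) $ a) \<longlonglongrightarrow> 0"
proof -
  have "(\<lambda>k. norm (((*v) A ^^ k) (stab v))) \<longlonglongrightarrow> 0"
    by (rule summable_LIMSEQ_zero[OF summable_stable[OF stab_stable]])
  thus ?thesis
    by (rule Lim_null_comparison[rotated]) (auto intro!: always_eventually component_le_norm_cart)
qed

end

section \<open>Words as concatenations of substituted blocks\<close>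

lemma subst_word_pow_concat:
  "(subst_word \<phi> ^^ n) w = concat (map (\<lambda>a. (subst_word \<phi> ^^ n) [a]) w)"
proof (induction n)
  case (Suc n)
  have *: "subst_word \<phi> (concat ws) = concat (map (subst_word \<phi>) ws)" for ws
    by (induction ws) (simp_all add: subst_word_def)
  show ?case using Suc by (simp add: * comp_def)
qed (induction w; simp)

lemma prefix_concat_map:
  assumes "prefix w (concat (map f v))"
  shows "\<exists>u s. w = concat (map f u) @ s \<and> prefix u v \<and> (s = [] \<or> (\<exists>b. prefix s (f b)))"
  using assms
proof (induction v arbitrary: w)
  case (Cons a v)
  from Cons.prems consider "prefix w (f a)" | w' where "w = f a @ w'" "prefix w' (concat (map f v))"
    by (auto simp: prefix_append)
  thus ?case
  proof cases
    case 1
    thus ?thesis by (intro exI[of _ "[]"] exI[of _ w]) auto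
  next
    case 2
    then obtain u s where "w' = concat (map f u) @ s" "prefix u v" "s = [] \<or> (\<exists>b. prefix s (f b))"
      using Cons.IH by blast
    thus ?thesis using 2(1) by (intro exI[of _ "a # u"] exI[of _ s]) auto
  qed
qed simp

lemma sublist_concat_map:
  assumes "sublist w (concat (map f v))" "\<And>a. length (f a) \<le> m"
  shows "\<exists>p u s. w = p @ concat (map f u) @ s \<and> length p \<le> m \<and> length s \<le> m \<and> sublist u v"
  using assms(1)
proof (induction v arbitrary: w)
  case Nil
  thus ?case by (intro exI[of _ "[]"]) auto
next
  case (Cons a v)
  from Cons.prems consider "sublist w (f a)" | "sublist w (concat (map f v))"
    | p q where "w = p @ q" "suffix p (f a)" "prefix q (concat (map f v))"
    unfolding list.map concat.simps sublist_append by blast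
  thus ?case
  proof cases
    \<comment> \<open>A factor lying inside a single block is booked entirely as \<open>p\<close>,
      with no whole block.\<close>
    case 1
    hence "length w \<le> m" using assms(2)[of a] sublist_length_le[of w "f a"] by linarith
    thus ?thesis by (intro exI[of _ w] exI[of _ "[]"] conjI) simp_all
  next
    case 2
    then obtain p u s where u: "w = p @ concat (map f u) @ s" "length p \<le> m" "length s \<le> m" "sublist u v"
      using Cons.IH by blast
    have "sublist u (a # v)" using u(4) by (simp add: sublist_Cons_right)
    with u(1-3) show ?thesis by (intro exI[of _ p] exI[of _ u] exI[of _ s] conjI)
  next
    case 3
    obtain u s where u: "q = concat (map f u) @ s" "prefix u v" "s = [] \<or> (\<exists>b. prefix s (f b))"
      using prefix_concat_map[OF 3(3)] by blast
    have "length p \<le> m" using suffix_length_le[OF 3(2)] assms(2)[of a] by linarith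
    moreover have "length s \<le> m"
    proof (cases "s = []")
      case False
      then obtain b where "prefix s (f b)" using u(3) by blast
      thus ?thesis using prefix_length_le[of s "f b"] assms(2)[of b] by linarith
    qed simp
    moreover have "sublist u (a # v)" using u(2) by (simp add: sublist_Cons_right prefix_imp_sublist)
    moreover have "w = p @ concat (map f u) @ s" using 3(1) u(1) by simp
    ultimately show ?thesis by (intro exI[of _ p] exI[of _ u] exI[of _ s] conjI)
  qed
qed

lemma factor_of_iterate_sublist: "factor_of_iterate \<phi> w \<Longrightarrow> sublist u w \<Longrightarrow> factor_of_iterate \<phi> u"
  unfolding factor_of_iterate_def by (meson sublist_order.order_trans)

lemma sublist_concat_map_mono:
  assumes "sublist u v"
  shows "sublist (concat (map f u)) (concat (map f v))"
  using assms unfolding sublist_def by (metis concat_append map_append)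

lemma factor_of_iterate_subst_word_pow:
  assumes "factor_of_iterate \<phi> w"
  shows "factor_of_iterate \<phi> ((subst_word \<phi> ^^ m) w)"
proof -
  obtain i n where "sublist w ((subst_word \<phi> ^^ n) [i])"
    using assms by (auto simp: factor_of_iterate_def)
  hence "sublist ((subst_word \<phi> ^^ m) w) ((subst_word \<phi> ^^ m) ((subst_word \<phi> ^^ n) [i]))"
    by (subst (1 2) subst_word_pow_concat) (rule sublist_concat_map_mono)
  thus ?thesis unfolding factor_of_iterate_def by (metis funpow_add comp_apply)
qed

section \<open>Irrationality, balance and desubstitution of allowed words\<close>

context pisot
begin

lemma ab_Ints: "ab w $ i \<in> \<int>"
  by (simp add: ab_def)

lemma ab_single: "ab [a] = axis a 1"
  by (simp add: ab_Cons)

lemma A_pow_axis: "((*v) A ^^ k) (axis a 1) = ab ((subst_word \<phi> ^^ k) [a])"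
  by (simp add: ab_subst_word_pow ab_single)

text \<open>If c r were integral, the 2 by 2 minors of A^k e_i against c r would be integers. The
  component along \<open>r\<close> cancels in them, so they tend to 0 and are eventually 0. Then A^k
  maps all basis vectors into one line, although it is injective and there are at least two
  letters.\<close>

lemma no_integer_multiple:
  assumes "c \<noteq> 0"
  shows "\<exists>i. c * r $ i \<notin> \<int>"
proof (rule ccontr)
  assume "\<not> ?thesis"
  hence z: "c * r $ i \<in> \<int>" for i by blast
  let ?m = "\<lambda>i a b k. (((*v) A ^^ k) (axis i 1)) $ a * (c * r $ b) - (((*v) A ^^ k) (axis i 1)) $ b * (c * r $ a)"
  have "eventually (\<lambda>k. ?m i a b k = 0) sequentially" for i a b
  proof -
    have "?m i a b k = (((*v) A ^^ k) (stab (axis i 1))) $ a * (c * r $ b)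
        - (((*v) A ^^ k) (stab (axis i 1))) $ b * (c * r $ a)" for k
      by (simp add: A_pow_split[of k "axis i 1"] algebra_simps)
    moreover have "(\<lambda>k. (((*v) A ^^ k) (stab (axis i 1))) $ a * (c * r $ b)
        - (((*v) A ^^ k) (stab (axis i 1))) $ b * (c * r $ a)) \<longlonglongrightarrow> 0 * (c * r $ b) - 0 * (c * r $ a)"
      by (intro tendsto_intros A_pow_stab_tendsto)
    ultimately have "?m i a b \<longlonglongrightarrow> 0" by simp
    hence "eventually (\<lambda>k. \<bar>?m i a b k\<bar> < 1) sequentially"
      using order_tendstoD(2)[OF tendsto_rabs_zero, of "?m i a b" sequentially 1] by simp
    moreover have "?m i a b k \<in> \<int>" for k
      using z by (auto simp: A_pow_axis ab_Ints intro!: Ints_diff Ints_mult)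
    ultimately show ?thesis
      by (elim eventually_mono) (use Ints_nonzero_abs_less1 in blast)
  qed
  hence "eventually (\<lambda>k. \<forall>i a b. ?m i a b k = 0) sequentially"
    by (intro eventually_all_finite)
  then obtain k where "\<forall>i a b. ?m i a b k = 0"
    using eventually_happens'[OF sequentially_bot] by blast
  hence k: "?m i a b k = 0" for i a b by blast
  have "CARD('a) \<ge> 2" using subst by (simp add: substitution_def)
  then obtain i j :: 'a where ij: "i \<noteq> j"
    by (metis (full_types) One_nat_def Suc_1 UNIV_I card_le_Suc0_iff_eq finite_class.finite_UNIV not_less_eq_eq)
  fix b :: 'a
  define x y where "x = ((*v) A ^^ k) (axis i 1)" and "y = ((*v) A ^^ k) (axis j 1)"
  have zb: "c * r $ b \<noteq> 0" using assms r_pos[of b] by simp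
  have x: "(c * r $ b) *\<^sub>R x = x $ b *\<^sub>R (c *\<^sub>R r)" and y: "(c * r $ b) *\<^sub>R y = y $ b *\<^sub>R (c *\<^sub>R r)"
    using k[of i _ b] k[of j _ b] by (auto simp: x_def y_def vec_eq_iff mult.commute)
  \<comment> \<open>Both images lie on the line of \<open>r\<close>, so this combination is sent to
    0 and is itself 0; comparing coordinate \<open>j\<close> gives x_b = 0, hence
    \<open>x = 0\<close>.\<close>
  have "((*v) A ^^ k) (y $ b *\<^sub>R axis i 1 - x $ b *\<^sub>R axis j 1) = y $ b *\<^sub>R x - x $ b *\<^sub>R y"
    using A_pow_linear[of k] by (simp add: linear_diff linear_scale x_def y_def)
  also have "(c * r $ b) *\<^sub>R \<dots> = y $ b *\<^sub>R ((c * r $ b) *\<^sub>R x) - x $ b *\<^sub>R ((c * r $ b) *\<^sub>R y)"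
    by (simp add: algebra_simps)
  hence "y $ b *\<^sub>R x - x $ b *\<^sub>R y = 0" unfolding x y using zb
    by (metis (no_types, opaque_lifting) diff_self mult.commute scaleR_eq_0_iff scaleR_left_commute)
  finally have "y $ b *\<^sub>R axis i 1 - x $ b *\<^sub>R axis j 1 = (0 :: real^'a)" by (rule A_pow_injective)
  hence "(y $ b *\<^sub>R axis i 1 - x $ b *\<^sub>R axis j 1) $ j = (0 :: real)" by simp
  hence "x $ b = 0" using ij by (simp add: axis_def)
  hence "x = 0" using x zb by simp
  hence "axis i (1 :: real) = (0 :: real^'a)" using A_pow_injective unfolding x_def by blast
  thus False by (metis axis_eq_0_iff zero_neq_one)
qed

lemma coef_axis_pos: "coef (axis i 1) > 0"
  using omega_pos omega_r_pos by (simp add: coef_def inner_axis)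

text \<open>For \<open>lam = 1\<close> the integer vectors A^k e_i would converge to a positive
  multiple of \<open>r\<close>, which would then be integral.\<close>

lemma lambda_gt_1: "lam > 1"
proof (rule ccontr)
  assume "\<not> lam > 1"
  hence lam1: "lam = 1" using lambda_ge_1 by simp
  fix i :: 'a
  have "coef (axis i 1) * r $ a \<in> \<int>" for a
  proof (rule closed_sequentially)
    show "closed (\<int> :: real set)" by simp
    show "(((*v) A ^^ k) (axis i 1)) $ a \<in> \<int>" for k by (simp add: A_pow_axis ab_Ints)
    have "(\<lambda>k. coef (axis i 1) * r $ a + (((*v) A ^^ k) (stab (axis i 1))) $ a) \<longlonglongrightarrow> coef (axis i 1) * r $ a + 0"
      by (intro tendsto_intros A_pow_stab_tendsto)
    thus "(\<lambda>k. (((*v) A ^^ k) (axis i 1)) $ a) \<longlonglongrightarrow> coef (axis i 1) * r $ a"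
      by (subst A_pow_split) (simp add: lam1)
  qed
  thus False using no_integer_multiple[of "coef (axis i 1)"] coef_axis_pos[of i] by auto
qed

text \<open>A prefix of a supertile splits, level by level, into at most \<open>m\<close> complete
  supertiles of each lower level (the Dumont-Thomas decomposition). Each one of level k contributes
  at most \<open>\<beta> k\<close>, and \<open>\<beta>\<close> is summable because \<open>y\<close>
  annihilates \<open>r\<close> and so sees only stable parts.\<close>

lemma balanced_stable:
  assumes "inner y r = 0"
  shows "\<exists>B. \<forall>w. factor_of_iterate \<phi> w \<longrightarrow> \<bar>inner y (ab w)\<bar> \<le> B"
proof -
  define \<beta> where "\<beta> k = (\<Sum>a\<in>UNIV. \<bar>inner y (((*v) A ^^ k) (axis a 1))\<bar>)" for k
  define m where "m = Max (range (\<lambda>a. length (\<phi> a)))"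
  have m: "length (\<phi> a) \<le> m" for a by (auto simp: m_def)
  have "summable \<beta>"
    unfolding \<beta>_def
  proof (rule summable_sum)
    fix a
    have "inner y (((*v) A ^^ k) (axis a 1)) = inner y (((*v) A ^^ k) (stab (axis a 1)))" for k
      using assms by (simp add: A_pow_split[of k "axis a 1"] inner_add_right)
    moreover have "summable (\<lambda>k. \<bar>inner y (((*v) A ^^ k) (stab (axis a 1)))\<bar>)"
      by (rule summable_comparison_test'[OF summable_mult[OF summable_stable[OF stab_stable, of "axis a 1"], of "norm y"], of 0])
        (simp add: Cauchy_Schwarz_ineq2)
    ultimately show "summable (\<lambda>k. \<bar>inner y (((*v) A ^^ k) (axis a 1))\<bar>)" by simp
  qed
  have \<beta>0: "\<beta> k \<ge> 0" for k by (simp add: \<beta>_def sum_nonneg)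
  have \<beta>: "\<bar>inner y (ab ((subst_word \<phi> ^^ k) [a]))\<bar> \<le> \<beta> k" for k a
    unfolding \<beta>_def A_pow_axis by (rule member_le_sum) auto
  have \<beta>w: "\<bar>inner y (ab (concat (map (\<lambda>a. (subst_word \<phi> ^^ k) [a]) u)))\<bar> \<le> real (length u) * \<beta> k" for k u
  proof (induction u)
    case (Cons a u)
    thus ?case using \<beta>[of k a] by (simp add: inner_add_right distrib_right)
  qed simp
  have pre: "\<bar>inner y (ab w)\<bar> \<le> \<beta> 0 + real m * sum \<beta> {..<k}" if "prefix w ((subst_word \<phi> ^^ k) [a])" for w k a
    using that
  proof (induction k arbitrary: w a)
    case 0
    hence "w = [] \<or> w = [a]" by (auto simp: prefix_Cons)
    thus ?case using \<beta>[of 0 a] \<beta>0[of 0] by auto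
  next
    case (Suc k)
    have "(subst_word \<phi> ^^ Suc k) [a] = (subst_word \<phi> ^^ k) (\<phi> a)"
      unfolding funpow_Suc_right comp_apply by (simp add: subst_word_def)
    hence "prefix w (concat (map (\<lambda>a. (subst_word \<phi> ^^ k) [a]) (\<phi> a)))"
      using Suc.prems by (metis subst_word_pow_concat)
    then obtain u s where u: "w = concat (map (\<lambda>a. (subst_word \<phi> ^^ k) [a]) u) @ s" "prefix u (\<phi> a)"
      "s = [] \<or> (\<exists>b. prefix s ((subst_word \<phi> ^^ k) [b]))"
      using prefix_concat_map by metis
    have "\<bar>inner y (ab s)\<bar> \<le> \<beta> 0 + real m * sum \<beta> {..<k}"
      using u(3) Suc.IH \<beta>0 by (auto simp: sum_nonneg)
    moreover have "length u \<le> m" using prefix_length_le[OF u(2)] m[of a] by linarith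
    hence "real (length u) * \<beta> k \<le> real m * \<beta> k" using \<beta>0 by (simp add: mult_right_mono)
    ultimately show ?case using \<beta>w[of k u] u(1) by (simp add: inner_add_right distrib_left)
  qed
  define B where "B = \<beta> 0 + real m * suminf \<beta>"
  have pre': "\<bar>inner y (ab w)\<bar> \<le> B" if "prefix w ((subst_word \<phi> ^^ k) [a])" for w k a
  proof -
    have "sum \<beta> {..<k} \<le> suminf \<beta>" using \<open>summable \<beta>\<close> \<beta>0 by (intro sum_le_suminf) auto
    hence "real m * sum \<beta> {..<k} \<le> real m * suminf \<beta>" by (rule mult_left_mono) simp
    thus ?thesis using pre[OF that] unfolding B_def by linarith
  qed
  \<comment> \<open>A factor is the difference of two prefixes, whence the 2.\<close>
  have "\<bar>inner y (ab w)\<bar> \<le> 2 * B" if w: "factor_of_iterate \<phi> w" for w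
  proof -
    obtain i n p s where "(subst_word \<phi> ^^ n) [i] = p @ w @ s"
      using w unfolding factor_of_iterate_def sublist_def by blast
    hence "prefix p ((subst_word \<phi> ^^ n) [i])" "prefix (p @ w) ((subst_word \<phi> ^^ n) [i])" by auto
    hence "\<bar>inner y (ab p)\<bar> \<le> B" "\<bar>inner y (ab (p @ w))\<bar> \<le> B" by (blast intro: pre')+
    thus ?thesis by (simp add: inner_add_right)
  qed
  thus ?thesis by blast
qed

text \<open>\<open>\<kappa>\<close> is the average weight per unit length: with it, the weights
  minus \<open>\<kappa>\<close> times the lengths annihilate \<open>r\<close>, and
  \<open>balanced_stable\<close> applies.\<close>

lemma balanced:
  fixes C :: "'a \<Rightarrow> real"
  shows "\<exists>\<kappa> B. \<forall>w. factor_of_iterate \<phi> w \<longrightarrow> \<bar>(\<Sum>a\<leftarrow>w. C a) - \<kappa> * len w\<bar> \<le> B"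
proof -
  define c :: "real^'a" where "c = (\<chi> i. C i)"
  define \<kappa> where "\<kappa> = inner c r / inner \<omega> r"
  have "inner (c - \<kappa> *\<^sub>R \<omega>) r = 0" using omega_r_pos by (simp add: \<kappa>_def inner_diff_left)
  then obtain B where B: "\<forall>w. factor_of_iterate \<phi> w \<longrightarrow> \<bar>inner (c - \<kappa> *\<^sub>R \<omega>) (ab w)\<bar> \<le> B"
    using balanced_stable by blast
  have "inner (c - \<kappa> *\<^sub>R \<omega>) (ab w) = (\<Sum>a\<leftarrow>w. C a) - \<kappa> * len w" for w
    using ab_sum_list[of c w] by (simp add: inner_diff_left len_eq c_def)
  thus ?thesis using B by auto
qed

text \<open>Let \<open>y\<close> be the part of \<open>ab v\<close> orthogonal to \<open>r\<close>.
  On the n-th power of \<open>v\<close> it sums to n times its squared norm, so balance forces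
  \<open>y = 0\<close>. Then the integer vector \<open>ab v\<close> is a multiple of
  \<open>r\<close>, which \<open>no_integer_multiple\<close> forbids.\<close>

lemma no_periodic_word:
  assumes "v \<noteq> []"
  shows "\<exists>n. \<not> factor_of_iterate \<phi> (concat (replicate n v))"
proof (rule ccontr)
  assume "\<not> ?thesis"
  hence f: "factor_of_iterate \<phi> (concat (replicate n v))" for n by blast
  have ab: "ab (concat (replicate n v)) = real n *\<^sub>R ab v" for n
    by (induction n) (simp_all add: algebra_simps)
  define y where "y = ab v - (inner (ab v) r / inner r r) *\<^sub>R r"
  have rr: "inner r r > 0" unfolding inner_gt_zero_iff using r_pos by (metis less_irrefl zero_index)
  have y: "inner y r = 0" using rr by (simp add: y_def inner_diff_left)
  then obtain B where B: "\<And>w. factor_of_iterate \<phi> w \<Longrightarrow> \<bar>inner y (ab w)\<bar> \<le> B"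
    using balanced_stable by blast
  have "inner y (ab v) = 0"
  proof (rule ccontr)
    assume "inner y (ab v) \<noteq> 0"
    then obtain n where "real n * \<bar>inner y (ab v)\<bar> > B"
      using ex_less_of_nat_mult[of "\<bar>inner y (ab v)\<bar>" B] by auto
    moreover have "\<bar>inner y (ab (concat (replicate n v)))\<bar> \<le> B" by (rule B[OF f])
    ultimately show False by (simp add: ab abs_mult)
  qed
  hence "inner y y = 0" using y by (simp add: y_def inner_diff_right)
  hence v: "ab v = (inner (ab v) r / inner r r) *\<^sub>R r" by (simp add: y_def)
  have "inner (ab v) r \<noteq> 0"
  proof
    assume "inner (ab v) r = 0"
    hence "ab v = 0" using v by simp
    hence "len v = 0" by (simp add: len_eq)
    moreover have "len v > 0" using len_ge[of v] wmin_pos assms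
      by (smt (verit) length_greater_0_conv mult_pos_pos of_nat_0_less_iff)
    ultimately show False by simp
  qed
  then obtain i where "inner (ab v) r / inner r r * r $ i \<notin> \<int>"
    using no_integer_multiple rr by (metis divide_eq_0_iff less_irrefl)
  moreover have "ab v $ i = inner (ab v) r / inner r r * r $ i" using arg_cong[OF v, of "\<lambda>x. x $ i"] by simp
  ultimately show False using ab_Ints by metis
qed

text \<open>The maximum includes all levels below \<open>n\<close>, so that a longer word cannot
  come from an iterate too short to be desubstituted \<open>n\<close> times.\<close>

definition max_len :: "nat \<Rightarrow> nat" where
  "max_len n = Max ((\<lambda>(k, a). length ((subst_word \<phi> ^^ k) [a])) ` ({..n} \<times> UNIV))"

lemma max_len: "k \<le> n \<Longrightarrow> length ((subst_word \<phi> ^^ k) [a]) \<le> max_len n"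
  unfolding max_len_def by (rule Max_ge) auto

lemma desubstitution:
  assumes "factor_of_iterate \<phi> w" "length w > 2 * max_len n"
  obtains p u s where "w = p @ (subst_word \<phi> ^^ n) u @ s" "factor_of_iterate \<phi> u" "u \<noteq> []"
    "length p \<le> max_len n" "length s \<le> max_len n"
proof -
  obtain i k where k: "sublist w ((subst_word \<phi> ^^ k) [i])"
    using assms(1) by (auto simp: factor_of_iterate_def)
  have "n < k" using max_len[of k n i] sublist_length_le[OF k] assms(2) by linarith
  define V where "V = (subst_word \<phi> ^^ (k - n)) [i]"
  have "(subst_word \<phi> ^^ k) [i] = (subst_word \<phi> ^^ n) V"
    using \<open>n < k\<close> unfolding V_def by (metis comp_apply funpow_add le_add_diff_inverse less_imp_le)
  hence "sublist w (concat (map (\<lambda>a. (subst_word \<phi> ^^ n) [a]) V))"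
    using k by (metis subst_word_pow_concat)
  then obtain p u s where u: "w = p @ concat (map (\<lambda>a. (subst_word \<phi> ^^ n) [a]) u) @ s"
    "length p \<le> max_len n" "length s \<le> max_len n" "sublist u V"
    using sublist_concat_map[of w _ V "max_len n"] max_len by blast
  have "u \<noteq> []" using u(1-3) assms(2) by auto
  moreover have "factor_of_iterate \<phi> u" using u(4) unfolding factor_of_iterate_def V_def by blast
  ultimately show thesis using that u(1-3) by (metis subst_word_pow_concat)
qed

end

section \<open>Tilings\<close>

lemma translate_0 [simp]: "translate T 0 = T"
  by (simp add: translate_def)

lemma translate_translate [simp]: "translate (translate T s) t = translate T (s + t)"
  by (force simp: translate_def image_image add.assoc)

lemma mem_translate: "(a, x) \<in> translate T t \<longleftrightarrow> (a, x - t) \<in> T"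
  by (force simp: translate_def)

section \<open>Local agreement and closeness of tilings\<close>

context tile_lengths
begin

text \<open>Equality of patches, without any shift: for \<open>R > 0\<close> the two inequalities
  say that the closed tile meets the open window of radius \<open>R\<close>.\<close>

definition agree :: "real \<Rightarrow> 'a tiling \<Rightarrow> 'a tiling \<Rightarrow> bool" where
  "agree R S S' \<longleftrightarrow> (\<forall>a x. x < R \<longrightarrow> -R < x + \<omega> $ a \<longrightarrow> ((a, x) \<in> S \<longleftrightarrow> (a, x) \<in> S'))"

lemma meets_iff: "R > 0 \<Longrightarrow> {x..x + \<omega> $ a} \<inter> {-R<..<R} \<noteq> {} \<longleftrightarrow> x < R \<and> -R < x + \<omega> $ a"
  using omega_pos[of a]
  by (auto simp: disjoint_iff intro!: exI[of _ "max x ((max x (-R) + min (x + \<omega> $ a) R) / 2)"])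

lemma patch_eq_iff_agree:
  assumes "R > 0"
  shows "patch \<omega> R S = patch \<omega> R S' \<longleftrightarrow> agree R S S'"
proof -
  have "supp \<omega> (a, x) \<inter> {-R<..<R} \<noteq> {} \<longleftrightarrow> x < R \<and> -R < x + \<omega> $ a" for a x
    by (simp only: supp_def fst_conv snd_conv meets_iff[OF assms])
  hence mem: "(a, x) \<in> patch \<omega> R S \<longleftrightarrow> (a, x) \<in> S \<and> x < R \<and> -R < x + \<omega> $ a" for a x S
    by (simp only: patch_def mem_Collect_eq)
  have "patch \<omega> R S = patch \<omega> R S' \<longleftrightarrow> (\<forall>a x. (a, x) \<in> patch \<omega> R S \<longleftrightarrow> (a, x) \<in> patch \<omega> R S')"
    by (simp only: set_eq_iff split_paired_All)
  thus ?thesis unfolding mem agree_def by blast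
qed

lemma tilings_close_iff:
  "\<epsilon> > 0 \<Longrightarrow> tilings_close \<omega> \<epsilon> S S' \<longleftrightarrow> (\<exists>s. \<bar>s\<bar> < \<epsilon> \<and> agree (1/\<epsilon>) S (translate S' s))"
  unfolding tilings_close_def by (simp add: patch_eq_iff_agree)

lemma agree_refl [simp]: "agree R S S"
  by (simp add: agree_def)

lemma agree_sym: "agree R S S' \<Longrightarrow> agree R S' S"
  by (simp add: agree_def)

lemma agree_trans: "agree R S S' \<Longrightarrow> agree R S' S'' \<Longrightarrow> agree R S S''"
  by (simp add: agree_def)

lemma agree_mono: "agree R S S' \<Longrightarrow> R' \<le> R \<Longrightarrow> agree R' S S'"
  by (auto simp: agree_def)

lemma agree_translate:
  assumes "agree R S S'" "R' + \<bar>u\<bar> \<le> R"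
  shows "agree R' (translate S u) (translate S' u)"
  unfolding agree_def mem_translate
proof (intro allI impI)
  fix a x assume "x < R'" "-R' < x + \<omega> $ a"
  hence "x - u < R" "-R < x - u + \<omega> $ a" using assms(2) by auto
  thus "((a, x - u) \<in> S) = ((a, x - u) \<in> S')" using assms(1) unfolding agree_def by blast
qed

lemma agree_all_eq:
  assumes "\<And>R. R > 0 \<Longrightarrow> agree R S S'"
  shows "S = S'"
proof -
  have "(a, x) \<in> S \<longleftrightarrow> (a, x) \<in> S'" for a x
    using assms[of "\<bar>x\<bar> + 1"] omega_pos[of a] unfolding agree_def by (smt (verit))
  thus ?thesis by auto
qed

lemma close_refl: "\<epsilon> > 0 \<Longrightarrow> tilings_close \<omega> \<epsilon> S S"
  unfolding tilings_close_def by (intro exI[of _ 0]) simp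

lemma close_translate: "\<bar>s\<bar> < \<epsilon> \<Longrightarrow> tilings_close \<omega> \<epsilon> S (translate S s)"
  unfolding tilings_close_def by (intro exI[of _ "-s"]) simp

text \<open>A shift smaller than \<delta> costs at most \<delta> of the radius on which two tilings
  agree. What is left of the radius 1/\<delta> still suffices for closeness \<epsilon>.\<close>

lemma window_shrink:
  fixes \<delta> :: real
  assumes "0 < \<delta>" "\<delta> \<le> 1/2" "2 * \<delta> \<le> \<epsilon>"
  shows "1/\<epsilon> + \<delta> \<le> 1/\<delta>"
proof -
  have "1/\<epsilon> \<le> 1/(2*\<delta>)" using assms by (intro divide_left_mono) auto
  moreover have "\<delta> * \<delta> \<le> (1/2) * (1/2)" using assms by (intro mult_mono) auto
  hence "\<delta> \<le> 1/(2*\<delta>)" using assms by (simp add: field_simps)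
  ultimately show ?thesis by simp
qed

text \<open>The two shifts add up, and one window is moved by the other shift, which
  \<open>window_shrink\<close> pays for. Closeness is thus transitive, and by
  \<open>close_sym\<close> symmetric, only at the price of a factor 2.\<close>

lemma close_triangle:
  assumes "tilings_close \<omega> \<delta> S S'" "tilings_close \<omega> \<delta> S' S''" "0 < \<delta>" "\<delta> \<le> 1/2" "2 * \<delta> \<le> \<epsilon>"
  shows "tilings_close \<omega> \<epsilon> S S''"
proof -
  obtain s where s: "\<bar>s\<bar> < \<delta>" "agree (1/\<delta>) S (translate S' s)"
    using assms(1,3) by (auto simp: tilings_close_iff)
  obtain t where t: "\<bar>t\<bar> < \<delta>" "agree (1/\<delta>) S' (translate S'' t)"
    using assms(2,3) by (auto simp: tilings_close_iff)
  note w = window_shrink[OF assms(3-5)]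
  have "agree (1/\<epsilon>) (translate S' s) (translate S'' (t + s))"
    using agree_translate[OF t(2), of "1/\<epsilon>" s] w s(1) by simp
  moreover have "agree (1/\<epsilon>) S (translate S' s)" using agree_mono[OF s(2)] w assms(3) by simp
  ultimately have "agree (1/\<epsilon>) S (translate S'' (t + s))" using agree_trans by blast
  moreover have "\<bar>t + s\<bar> < \<epsilon>" using s(1) t(1) assms(5) by linarith
  ultimately show ?thesis using assms(3,5) by (auto simp: tilings_close_iff)
qed

lemma close_sym:
  assumes "tilings_close \<omega> \<delta> S S'" "0 < \<delta>" "\<delta> \<le> 1/2" "2 * \<delta> \<le> \<epsilon>"
  shows "tilings_close \<omega> \<epsilon> S' S"
proof -
  obtain s where s: "\<bar>s\<bar> < \<delta>" "agree (1/\<delta>) S (translate S' s)"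
    using assms(1,2) by (auto simp: tilings_close_iff)
  have "agree (1/\<epsilon>) (translate S (-s)) (translate S' 0)"
    using agree_translate[OF s(2), of "1/\<epsilon>" "-s"] window_shrink[OF assms(2-4)] s(1) by simp
  hence "agree (1/\<epsilon>) S' (translate S (-s))" using agree_sym by simp
  moreover have "\<bar>-s\<bar> < \<epsilon>" using s(1) assms(2,4) by simp
  ultimately show ?thesis using assms(2,4) unfolding tilings_close_iff[OF order_less_le_trans[OF _ assms(4)], OF mult_pos_pos[OF _ assms(2)], simplified] by blast
qed

section \<open>Enumerations of tiles by the integers\<close>

definition enumerates :: "('a \<Rightarrow> 'a list) \<Rightarrow> (int \<Rightarrow> 'a tile) \<Rightarrow> bool" where
  "enumerates \<phi> \<tau> \<longleftrightarrow> (\<Union>k. supp \<omega> (\<tau> k)) = UNIV \<and>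
     (\<forall>k. snd (\<tau> (k + 1)) = snd (\<tau> k) + \<omega> $ fst (\<tau> k)) \<and> allowed_biinfinite \<phi> (\<lambda>k. fst (\<tau> k))"

lemma tiling_space_iff: "T \<in> tiling_space \<phi> \<omega> \<longleftrightarrow> (\<exists>\<tau>. T = range \<tau> \<and> enumerates \<phi> \<tau>)"
  unfolding tiling_space_def enumerates_def by blast

lemma allowed_biinfinite_shift:
  assumes "allowed_biinfinite \<phi> w"
  shows "allowed_biinfinite \<phi> (\<lambda>k. w (k + c))"
proof -
  have "map (\<lambda>k. w (k + c)) [m..n] = map w [m + c..n + c]" for m n
    by (rule nth_equalityI) (auto simp: add.commute add.left_commute)
  thus ?thesis using assms by (simp add: allowed_biinfinite_def)
qed

lemma enumerates_shift:
  assumes "enumerates \<phi> \<tau>"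
  shows "enumerates \<phi> (\<lambda>k. \<tau> (k + c))" "range (\<lambda>k. \<tau> (k + c)) = range \<tau>"
proof -
  have surj: "range (\<lambda>k. f (k + c)) = range f" for f :: "int \<Rightarrow> 'z"
  proof -
    have "f k \<in> range (\<lambda>k. f (k + c))" for k by (rule range_eqI[of _ _ "k - c"]) simp
    thus ?thesis by auto
  qed
  have "(\<Union>k. supp \<omega> (\<tau> (k + c))) = (\<Union>k. supp \<omega> (\<tau> k))"
    using surj[of "\<lambda>k. supp \<omega> (\<tau> k)"] by simp
  moreover have "snd (\<tau> (k + 1 + c)) = snd (\<tau> (k + c)) + \<omega> $ fst (\<tau> (k + c))" for k
    using assms unfolding enumerates_def by (metis add.commute add.left_commute)
  ultimately show "enumerates \<phi> (\<lambda>k. \<tau> (k + c))"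
    using assms allowed_biinfinite_shift[of \<phi> "\<lambda>k. fst (\<tau> k)" c] by (simp add: enumerates_def)
  show "range (\<lambda>k. \<tau> (k + c)) = range \<tau>" by (rule surj)
qed

lemma enumerates_step: "enumerates \<phi> \<tau> \<Longrightarrow> snd (\<tau> (k + 1)) = snd (\<tau> k) + \<omega> $ fst (\<tau> k)"
  by (simp add: enumerates_def)

lemma enumerates_ge:
  assumes "enumerates \<phi> \<tau>" "j \<le> k"
  shows "snd (\<tau> j) + wmin * real_of_int (k - j) \<le> snd (\<tau> k)"
  using assms(2)
proof (induction k rule: int_ge_induct)
  case (step k)
  thus ?case using enumerates_step[OF assms(1), of k] wmin_le[of "fst (\<tau> k)"] by (simp add: algebra_simps)
qed simp

lemma enumerates_le:
  assumes "enumerates \<phi> \<tau>" "j \<le> k"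
  shows "snd (\<tau> k) \<le> snd (\<tau> j) + wmax * real_of_int (k - j)"
  using assms(2)
proof (induction k rule: int_ge_induct)
  case (step k)
  thus ?case using enumerates_step[OF assms(1), of k] wmax_ge[of "fst (\<tau> k)"] by (simp add: algebra_simps)
qed simp

lemma enumerates_next:
  assumes "enumerates \<phi> \<tau>" "j < k"
  shows "snd (\<tau> j) + \<omega> $ fst (\<tau> j) \<le> snd (\<tau> k)"
proof -
  have "0 \<le> wmin * real_of_int (k - (j + 1))" using wmin_pos assms(2) by (intro mult_nonneg_nonneg) auto
  thus ?thesis
    using enumerates_ge[OF assms(1), of "j + 1" k] enumerates_step[OF assms(1), of j] assms(2) by linarith
qed

lemma enumerates_gap:
  assumes "enumerates \<phi> \<tau>" "j < k"
  shows "snd (\<tau> j) + wmin \<le> snd (\<tau> k)"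
  using enumerates_next[OF assms] wmin_le[of "fst (\<tau> j)"] by linarith

lemma enumerates_locate:
  assumes "enumerates \<phi> \<tau>"
  obtains k where "snd (\<tau> k) \<le> y" "y < snd (\<tau> k) + \<omega> $ fst (\<tau> k)"
proof -
  have "y \<in> (\<Union>k. supp \<omega> (\<tau> k))" using assms by (simp add: enumerates_def)
  then obtain k where k: "snd (\<tau> k) \<le> y" "y \<le> snd (\<tau> k) + \<omega> $ fst (\<tau> k)" by (auto simp: supp_def)
  show thesis
  proof (cases "y = snd (\<tau> k) + \<omega> $ fst (\<tau> k)")
    case True
    thus thesis using that[of "k + 1"] enumerates_step[OF assms, of k] omega_pos by simp
  next
    case False
    thus thesis using that[of k] k by simp
  qed
qed

lemma tiles_separated:
  assumes "T \<in> tiling_space \<phi> \<omega>" "(a, x) \<in> T" "(b, y) \<in> T" "\<bar>x - y\<bar> < wmin"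
  shows "a = b" "x = y"
proof -
  obtain \<tau> where \<tau>: "T = range \<tau>" "enumerates \<phi> \<tau>" using assms(1) tiling_space_iff by blast
  obtain j k where jk: "(a, x) = \<tau> j" "(b, y) = \<tau> k" using assms(2,3) \<tau>(1) by blast
  have "j = k"
    using enumerates_gap[OF \<tau>(2), of j k] enumerates_gap[OF \<tau>(2), of k j] assms(4)
      arg_cong[OF jk(1), of snd] arg_cong[OF jk(2), of snd] by (cases j k rule: linorder_cases) auto
  thus "a = b" "x = y" using jk by (metis prod.inject)+
qed

lemma tile_at:
  assumes "T \<in> tiling_space \<phi> \<omega>"
  obtains a x where "(a, x) \<in> T" "x \<le> y" "y < x + \<omega> $ a"
proof -
  obtain \<tau> where \<tau>: "T = range \<tau>" "enumerates \<phi> \<tau>" using assms tiling_space_iff by blast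
  show thesis using enumerates_locate[OF \<tau>(2), of y] that \<tau>(1) by (metis prod.collapse rangeI)
qed

lemma translate_in_space:
  assumes "T \<in> tiling_space \<phi> \<omega>"
  shows "translate T t \<in> tiling_space \<phi> \<omega>"
proof -
  obtain \<tau> where \<tau>: "T = range \<tau>" "enumerates \<phi> \<tau>" using assms tiling_space_iff by blast
  let ?\<tau> = "\<lambda>k. (fst (\<tau> k), snd (\<tau> k) + t)"
  have "translate T t = range ?\<tau>" by (auto simp: translate_def \<tau>(1) case_prod_beta)
  moreover have "enumerates \<phi> ?\<tau>"
  proof -
    have "y \<in> (\<Union>k. supp \<omega> (?\<tau> k))" for y
    proof -
      obtain k where "snd (\<tau> k) \<le> y - t" "y - t < snd (\<tau> k) + \<omega> $ fst (\<tau> k)"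
        using enumerates_locate[OF \<tau>(2)] by metis
      thus ?thesis by (intro UN_I[of k]) (auto simp: supp_def)
    qed
    thus ?thesis using \<tau>(2) by (auto simp: enumerates_def)
  qed
  ultimately show ?thesis using tiling_space_iff by blast
qed

text \<open>The tile over the origin lies in both translates. Moved back, it gives two tiles of
  \<open>T\<close> whose left ends are less than \<open>wmin\<close> apart, so they
  coincide.\<close>

lemma shift_unique:
  assumes "T \<in> tiling_space \<phi> \<omega>" "agree R (translate T s) (translate T s')" "R > 0" "\<bar>s - s'\<bar> < wmin"
  shows "s = s'"
proof -
  obtain a x where x: "(a, x) \<in> translate T s" "x \<le> 0" "0 < x + \<omega> $ a"
    using tile_at[OF translate_in_space[OF assms(1)], of s 0] by blast
  hence "(a, x) \<in> translate T s'" using assms(2,3) unfolding agree_def by auto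
  hence "(a, x - s) \<in> T" "(a, x - s') \<in> T" using x by (auto simp: mem_translate)
  thus ?thesis using tiles_separated(2)[OF assms(1), of a "x - s" a "x - s'"] assms(4) by auto
qed

lemma agree_shift_unique:
  assumes "T \<in> tiling_space \<phi> \<omega>" "agree R S (translate T s)" "agree R S (translate T s')" "R > 0" "\<bar>s - s'\<bar> < wmin"
  shows "s = s'"
  using shift_unique[OF assms(1) agree_trans[OF agree_sym[OF assms(2)] assms(3)] assms(4,5)] .

end

section \<open>Aperiodicity of tilings\<close>

context pisot
begin

text \<open>The period sends tile 0 to some tile \<open>p > 0\<close>. From there on tiles
  correspond one after another, since a position determines the tile; so the types repeat with
  period \<open>p\<close>, and all powers of the word \<open>v\<close> of the first \<open>p\<close>
  types are allowed.\<close>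

lemma no_positive_period:
  assumes "T \<in> tiling_space \<phi> \<omega>" "translate T P = T" "P > 0"
  shows False
proof -
  obtain \<tau> where \<tau>: "T = range \<tau>" "enumerates \<phi> \<tau>" using assms(1) tiling_space_iff by blast
  have mem: "(fst (\<tau> k), snd (\<tau> k) + P) \<in> T" for k
  proof -
    have "(fst (\<tau> k), snd (\<tau> k) + P) \<in> translate T P"
      using \<tau>(1) by (simp add: mem_translate)
    thus ?thesis using assms(2) by simp
  qed
  obtain p where p: "\<tau> p = (fst (\<tau> 0), snd (\<tau> 0) + P)" using mem[of 0] \<tau>(1) by (metis rangeE)
  have "p > 0"
    using enumerates_ge[OF \<tau>(2), of p 0] p assms(3) wmin_pos
    by (smt (verit) mult_nonneg_nonneg of_int_0_le_iff snd_conv)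
  have per: "\<tau> (int n + p) = (fst (\<tau> (int n)), snd (\<tau> (int n)) + P)" for n
  proof (induction n)
    case (Suc n)
    have "snd (\<tau> (int n + p + 1)) = snd (\<tau> (int n + 1)) + P"
      using Suc enumerates_step[OF \<tau>(2), of "int n + p"] enumerates_step[OF \<tau>(2), of "int n"] by simp
    hence \<sigma>: "\<tau> (int n + p + 1) = (fst (\<tau> (int n + p + 1)), snd (\<tau> (int n + 1)) + P)"
      by (simp add: prod_eq_iff)
    moreover have "\<tau> (int n + p + 1) \<in> T" by (simp add: \<tau>(1))
    ultimately have "(fst (\<tau> (int n + p + 1)), snd (\<tau> (int n + 1)) + P) \<in> T" by simp
    hence "fst (\<tau> (int n + p + 1)) = fst (\<tau> (int n + 1))"
      using tiles_separated(1)[OF assms(1) _ mem[of "int n + 1"]] wmin_pos by simp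
    with \<sigma> have "\<tau> (int n + p + 1) = (fst (\<tau> (int n + 1)), snd (\<tau> (int n + 1)) + P)" by simp
    thus ?case by (simp add: algebra_simps)
  qed (simp add: p)
  define w where "w n = fst (\<tau> (int n))" for n
  have wper: "w (n + nat p) = w n" for n
    using per[of n] \<open>p > 0\<close> by (simp add: w_def)
  define v where "v = map w [0..<nat p]"
  have "concat (replicate n v) = map w [0..<n * nat p]" for n
  proof (induction n)
    case (Suc n)
    have "map w [nat p..<nat p + n * nat p] = map w [0..<n * nat p]"
      by (rule nth_equalityI) (auto simp: wper add.commute)
    hence "map w [0..<nat p + n * nat p] = v @ map w [0..<n * nat p]"
      by (simp add: upt_add_eq_append[of 0] v_def)
    thus ?case using Suc by simp
  qed simp
  moreover have "factor_of_iterate \<phi> (map w [0..<n])" for n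
  proof -
    have "map (\<lambda>k. fst (\<tau> k)) [0..int n - 1] = map w [0..<n]"
      by (rule nth_equalityI) (auto simp: w_def)
    thus ?thesis using \<tau>(2) unfolding enumerates_def allowed_biinfinite_def by metis
  qed
  ultimately have "factor_of_iterate \<phi> (concat (replicate n v))" for n by simp
  moreover have "v \<noteq> []" using \<open>p > 0\<close> by (simp add: v_def)
  ultimately show False using no_periodic_word by blast
qed

lemma aperiodic:
  assumes "T \<in> tiling_space \<phi> \<omega>" "translate T s = translate T t"
  shows "s = t"
proof (rule ccontr)
  assume "s \<noteq> t"
  have "translate (translate T s) (-t) = T" "translate (translate T t) (-s) = T"
    unfolding assms(2) by (simp, simp add: assms(2)[symmetric])
  hence "translate T (s - t) = T" "translate T (t - s) = T" by simp_all
  thus False using no_positive_period[OF assms(1)] \<open>s \<noteq> t\<close> by (metis diff_gt_0_iff_gt linorder_neqE_linordered_idom)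
qed

end

section \<open>Sequential compactness of the tiling space\<close>

lemma pointwise_convergent_subsequence:
  fixes f :: "nat \<Rightarrow> 'i::countable \<Rightarrow> 'b::metric_space"
  assumes "\<And>i. compact (K i)" "\<And>n i. f n i \<in> K i"
  obtains s l where "strict_mono (s :: nat \<Rightarrow> nat)" "\<And>i. (\<lambda>n. f (s n) i) \<longlonglongrightarrow> l i"
proof -
  have "compactin (product_topology (\<lambda>i. euclidean) UNIV) (PiE UNIV K)"
    using assms(1) by (simp add: compactin_PiE)
  hence "seq_compact (PiE UNIV K)"
    by (simp add: euclidean_product_topology compact_imp_seq_compact)
  moreover have "\<forall>n. f n \<in> PiE UNIV K" using assms(2) by auto
  ultimately obtain l s where "strict_mono (s :: nat \<Rightarrow> nat)" "(f \<circ> s) \<longlonglongrightarrow> l"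
    unfolding seq_compact_def by metis
  moreover from this(2) have "(\<lambda>n. f (s n) i) \<longlonglongrightarrow> l i" for i
    using continuous_on_tendsto_compose[OF continuous_on_product_coordinates] by fastforce
  ultimately show thesis by (intro that[of s l])
qed

text \<open>Letters will be coded by real numbers; this reads off the limiting letter.\<close>

lemma nat_sequence_eventually_constant:
  fixes g :: "nat \<Rightarrow> nat"
  assumes "(\<lambda>n. real (g n)) \<longlonglongrightarrow> c"
  shows "\<exists>N. \<forall>n\<ge>N. g n = g N"
proof -
  obtain N where N: "\<forall>n\<ge>N. dist (real (g n)) c < 1/2"
    using metric_LIMSEQ_D[OF assms, of "1/2"] by auto
  have "g n = g N" if "n \<ge> N" for n
  proof -
    have "dist (real (g n)) c < 1/2" "dist (real (g N)) c < 1/2" using N that by auto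
    hence "\<bar>real (g n) - real (g N)\<bar> < 1" unfolding dist_real_def by linarith
    thus ?thesis by linarith
  qed
  thus ?thesis by blast
qed

lemma int_crossing:
  fixes f :: "int \<Rightarrow> real"
  assumes "a \<le> b" "f a \<le> y" "y < f b"
  shows "\<exists>k. f k \<le> y \<and> y < f (k + 1)"
  using assms
proof (induction b rule: int_ge_induct)
  case (step b)
  show ?case
  proof (cases "y < f b")
    case False
    thus ?thesis using step.prems by (intro exI[of _ b]) auto
  qed (use step in blast)
qed simp

context tile_lengths
begin

lemma enumeration_at_0:
  assumes "T \<in> tiling_space \<phi> \<omega>"
  obtains \<tau> where "T = range \<tau>" "enumerates \<phi> \<tau>" "snd (\<tau> 0) \<le> 0" "0 < snd (\<tau> 0) + \<omega> $ fst (\<tau> 0)"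
proof -
  obtain \<tau> where \<tau>: "T = range \<tau>" "enumerates \<phi> \<tau>" using assms tiling_space_iff by blast
  obtain k where "snd (\<tau> k) \<le> 0" "0 < snd (\<tau> k) + \<omega> $ fst (\<tau> k)"
    using enumerates_locate[OF \<tau>(2)] by metis
  thus thesis using that[of "\<lambda>j. \<tau> (j + k)"] enumerates_shift[OF \<tau>(2), of k] \<tau>(1) by simp
qed

text \<open>Each index step moves the position by at least \<open>wmin\<close>. The inequality at
  the right end of tile 0 is weak because only that survives in a limit of tilings.\<close>

lemma index_bound:
  assumes "enumerates \<phi> \<tau>" "snd (\<tau> 0) \<le> 0" "0 \<le> snd (\<tau> 0) + \<omega> $ fst (\<tau> 0)"
    and "wmin * real_of_int K \<ge> R + wmax" "snd (\<tau> k) < R" "-R < snd (\<tau> k) + \<omega> $ fst (\<tau> k)"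
  shows "\<bar>k\<bar> \<le> K"
proof (rule ccontr)
  assume "\<not> ?thesis"
  then consider "k > K" "k \<ge> 0" | "k < -K" "k < 0" by linarith
  thus False
  proof cases
    case 1
    have "wmin * real_of_int K \<le> wmin * real_of_int k" using 1 wmin_pos by simp
    thus False using enumerates_ge[OF assms(1), of 0 k] 1 assms wmax_ge[of "fst (\<tau> 0)"] by simp
  next
    case 2
    have "wmin * real_of_int K \<le> wmin * real_of_int (0 - (k + 1))" using 2 wmin_pos by simp
    thus False
      using enumerates_ge[OF assms(1), of "k + 1" 0] enumerates_step[OF assms(1), of k] 2 assms wmax_pos by simp
  qed
qed

lemma enumerates_limit:
  assumes en: "\<And>n. enumerates \<phi> (\<tau> n)"
    and w: "\<And>k. eventually (\<lambda>n. fst (\<tau> n k) = fst (\<sigma> k)) sequentially"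
    and pos: "\<And>k. (\<lambda>n. snd (\<tau> n k)) \<longlonglongrightarrow> snd (\<sigma> k)"
  shows "enumerates \<phi> \<sigma>"
proof -
  have step: "snd (\<sigma> (k + 1)) = snd (\<sigma> k) + \<omega> $ fst (\<sigma> k)" for k
  proof (rule LIMSEQ_unique[OF pos])
    have "(\<lambda>n. snd (\<tau> n k) + \<omega> $ fst (\<sigma> k)) \<longlonglongrightarrow> snd (\<sigma> k) + \<omega> $ fst (\<sigma> k)"
      by (intro tendsto_intros pos)
    moreover have "eventually (\<lambda>n. snd (\<tau> n k) + \<omega> $ fst (\<sigma> k) = snd (\<tau> n (k + 1))) sequentially"
      using w[of k] by eventually_elim (use enumerates_step[OF en] in simp)
    ultimately show "(\<lambda>n. snd (\<tau> n (k + 1))) \<longlonglongrightarrow> snd (\<sigma> k) + \<omega> $ fst (\<sigma> k)"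
      by (rule Lim_transform_eventually)
  qed
  have ge: "snd (\<sigma> j) + wmin * real_of_int (k - j) \<le> snd (\<sigma> k)" if "j \<le> k" for j k
  proof (rule LIMSEQ_le[OF _ pos[of k]])
    show "(\<lambda>n. snd (\<tau> n j) + wmin * real_of_int (k - j)) \<longlonglongrightarrow> snd (\<sigma> j) + wmin * real_of_int (k - j)"
      by (intro tendsto_intros pos)
    show "\<exists>N. \<forall>n\<ge>N. snd (\<tau> n j) + wmin * real_of_int (k - j) \<le> snd (\<tau> n k)"
      using enumerates_ge[OF en that] by blast
  qed
  have "y \<in> (\<Union>k. supp \<omega> (\<sigma> k))" for y
  proof -
    obtain K :: nat where K: "real K * wmin > \<bar>y - snd (\<sigma> 0)\<bar>"
      using ex_less_of_nat_mult[OF wmin_pos] by blast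
    have "snd (\<sigma> (- int K)) \<le> y" "y < snd (\<sigma> (int K))"
      using ge[of "- int K" 0] ge[of 0 "int K"] K by (simp_all add: mult.commute)
    then obtain k where "snd (\<sigma> k) \<le> y" "y < snd (\<sigma> (k + 1))"
      using int_crossing[of "- int K" "int K" "\<lambda>k. snd (\<sigma> k)" y] by auto
    thus ?thesis using step[of k] by (intro UN_I[of k]) (auto simp: supp_def)
  qed
  moreover have "allowed_biinfinite \<phi> (\<lambda>k. fst (\<sigma> k))"
    unfolding allowed_biinfinite_def
  proof (intro allI)
    fix m n
    have "eventually (\<lambda>i. \<forall>k\<in>{m..n}. fst (\<tau> i k) = fst (\<sigma> k)) sequentially"
      using w by (intro eventually_ball_finite) auto
    then obtain i where "\<forall>k\<in>{m..n}. fst (\<tau> i k) = fst (\<sigma> k)"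
      using eventually_happens'[OF sequentially_bot] by blast
    hence "map (\<lambda>k. fst (\<sigma> k)) [m..n] = map (\<lambda>k. fst (\<tau> i k)) [m..n]" by simp
    moreover have "factor_of_iterate \<phi> (map (\<lambda>k. fst (\<tau> i k)) [m..n])"
      using en[of i] by (simp add: enumerates_def allowed_biinfinite_def)
    ultimately show "factor_of_iterate \<phi> (map (\<lambda>k. fst (\<sigma> k)) [m..n])" by (simp only:)
  qed
  ultimately show ?thesis using step by (auto simp: enumerates_def)
qed

text \<open>Equal types up to index \<open>K\<close> make all position differences there equal to
  the one at index 0, which serves as the shift. The bound on \<open>K\<close> contains an
  additional \<epsilon> because the window is seen from the shifted tiling too.\<close>

lemma close_of_enumerations:
  assumes "enumerates \<phi> \<tau>" "snd (\<tau> 0) \<le> 0" "0 \<le> snd (\<tau> 0) + \<omega> $ fst (\<tau> 0)"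
    and "enumerates \<phi> \<sigma>" "snd (\<sigma> 0) \<le> 0" "0 \<le> snd (\<sigma> 0) + \<omega> $ fst (\<sigma> 0)"
    and "\<epsilon> > 0" "wmin * real K \<ge> 1/\<epsilon> + \<epsilon> + wmax"
    and eq: "\<And>k. \<bar>k\<bar> \<le> int K \<Longrightarrow> fst (\<tau> k) = fst (\<sigma> k)"
    and "\<bar>snd (\<sigma> 0) - snd (\<tau> 0)\<bar> < \<epsilon>"
  shows "tilings_close \<omega> \<epsilon> (range \<sigma>) (range \<tau>)"
proof -
  define s where "s = snd (\<sigma> 0) - snd (\<tau> 0)"
  have up: "snd (\<sigma> (int j)) = snd (\<tau> (int j)) + s" if "j \<le> K" for j
    using that
  proof (induction j)
    case (Suc j)
    thus ?case using enumerates_step[OF assms(1), of "int j"] enumerates_step[OF assms(4), of "int j"] eq[of "int j"]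
      by (simp add: add.commute)
  qed (simp add: s_def)
  have down: "snd (\<sigma> (- int j)) = snd (\<tau> (- int j)) + s" if "j \<le> K" for j
    using that
  proof (induction j)
    case (Suc j)
    thus ?case using enumerates_step[OF assms(1), of "- int (Suc j)"] enumerates_step[OF assms(4), of "- int (Suc j)"]
        eq[of "- int (Suc j)"] by simp
  qed (simp add: s_def)
  have pos: "snd (\<sigma> k) = snd (\<tau> k) + s" if "\<bar>k\<bar> \<le> int K" for k
    using up[of "nat k"] down[of "nat (-k)"] that by (cases "k \<ge> 0") auto
  have "agree (1/\<epsilon>) (range \<sigma>) (translate (range \<tau>) s)"
    unfolding agree_def mem_translate
  proof (intro allI impI iffI)
    fix a x assume x: "x < 1/\<epsilon>" "-(1/\<epsilon>) < x + \<omega> $ a"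
    {
      assume "(a, x) \<in> range \<sigma>"
      then obtain k where k: "(a, x) = \<sigma> k" by blast
      hence fs: "fst (\<sigma> k) = a" "snd (\<sigma> k) = x" by (metis fst_conv, metis snd_conv)
      have "\<bar>k\<bar> \<le> int K"
        using x assms fs by (intro index_bound[of \<phi> \<sigma> "1/\<epsilon>" "int K"]) auto
      hence "\<tau> k = (a, x - s)" using pos[of k] eq[of k] fs by (simp add: prod_eq_iff)
      thus "(a, x - s) \<in> range \<tau>" by (metis rangeI)
    }
    {
      assume "(a, x - s) \<in> range \<tau>"
      then obtain k where k: "(a, x - s) = \<tau> k" by blast
      hence fs: "fst (\<tau> k) = a" "snd (\<tau> k) = x - s" by (metis fst_conv, metis snd_conv)
      have "\<bar>k\<bar> \<le> int K"
        using x assms fs unfolding s_def by (intro index_bound[of \<phi> \<tau> "1/\<epsilon> + \<epsilon>" "int K"]) auto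
      hence "\<sigma> k = (a, x)" using pos[of k] eq[of k] fs by (simp add: prod_eq_iff)
      thus "(a, x) \<in> range \<sigma>" by (metis rangeI)
    }
  qed
  thus ?thesis using assms(7,10) unfolding tilings_close_iff[OF assms(7)] s_def by blast
qed

lemma tiling_space_seq_compact:
  assumes "\<And>n. T n \<in> tiling_space \<phi> \<omega>"
  obtains s S where "strict_mono (s :: nat \<Rightarrow> nat)" "S \<in> tiling_space \<phi> \<omega>"
    "\<And>\<epsilon>. \<epsilon> > 0 \<Longrightarrow> eventually (\<lambda>n. tilings_close \<omega> \<epsilon> S (T (s n))) sequentially"
proof -
  have "\<exists>\<tau>. T n = range \<tau> \<and> enumerates \<phi> \<tau> \<and> snd (\<tau> 0) \<le> 0 \<and> 0 < snd (\<tau> 0) + \<omega> $ fst (\<tau> 0)" for n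
    using enumeration_at_0[OF assms[of n]] by metis
  then obtain \<tau> where \<tau>: "\<And>n. T n = range (\<tau> n)" "\<And>n. enumerates \<phi> (\<tau> n)" "\<And>n. snd (\<tau> n 0) \<le> 0"
    "\<And>n. 0 < snd (\<tau> n 0) + \<omega> $ fst (\<tau> n 0)" by metis
  \<comment> \<open>Position and coded type of every tile as a point of one metric space, so that a
    single product argument treats all indices.\<close>
  define f where "f n k = (snd (\<tau> n k), real (to_nat (fst (\<tau> n k))))" for n k
  define K where "K k = {-(wmax * (\<bar>real_of_int k\<bar> + 1))..wmax * (\<bar>real_of_int k\<bar> + 1)} \<times> range (\<lambda>a::'a. real (to_nat a))" for k
  have "f n k \<in> K k" for n k
  proof -
    \<comment> \<open>Tile 0 covers the origin and no tile is longer than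
      \<open>wmax\<close>.\<close>
    have "\<bar>snd (\<tau> n k)\<bar> \<le> wmax * (\<bar>real_of_int k\<bar> + 1)"
    proof (cases "k \<ge> 0")
      case True
      have "wmin * real_of_int (k - 0) \<ge> 0" using True wmin_pos by simp
      thus ?thesis using enumerates_ge[OF \<tau>(2)[of n] True] enumerates_le[OF \<tau>(2)[of n] True] \<tau>(3)[of n] \<tau>(4)[of n]
          wmax_ge[of "fst (\<tau> n 0)"] True wmax_pos mult_nonneg_nonneg[of wmax "real_of_int k"]
        unfolding abs_le_iff distrib_left by simp
    next
      case False
      hence le: "k \<le> 0" by simp
      have "wmin * real_of_int (0 - k) \<ge> 0" using le wmin_pos by (intro mult_nonneg_nonneg) auto
      moreover have "wmax * real_of_int (0 - k) \<ge> 0" using le wmax_pos by (intro mult_nonneg_nonneg) auto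
      moreover have abs: "\<bar>real_of_int k\<bar> = real_of_int (0 - k)" using le by simp
      ultimately show ?thesis using enumerates_ge[OF \<tau>(2)[of n] le] enumerates_le[OF \<tau>(2)[of n] le] \<tau>(3)[of n] \<tau>(4)[of n]
          wmax_ge[of "fst (\<tau> n 0)"] wmax_pos
        unfolding abs_le_iff distrib_left abs by (intro conjI; linarith)
    qed
    thus ?thesis by (auto simp: f_def K_def abs_le_iff)
  qed
  moreover have "compact (K k)" for k
    unfolding K_def by (intro compact_Times compact_Icc finite_imp_compact) auto
  ultimately obtain s l where s: "strict_mono (s :: nat \<Rightarrow> nat)" and l: "\<And>k. (\<lambda>n. f (s n) k) \<longlonglongrightarrow> l k"
    using pointwise_convergent_subsequence[of K f] by metis
  have pos: "(\<lambda>n. snd (\<tau> (s n) k)) \<longlonglongrightarrow> fst (l k)" for k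
    using tendsto_fst[OF l[of k]] by (simp add: f_def)
  have code: "(\<lambda>n. real (to_nat (fst (\<tau> (s n) k)))) \<longlonglongrightarrow> snd (l k)" for k
    using tendsto_snd[OF l[of k]] by (simp add: f_def)
  have "\<exists>a. eventually (\<lambda>n. fst (\<tau> (s n) k) = a) sequentially" for k
    using nat_sequence_eventually_constant[OF code[of k]] 
    unfolding eventually_sequentially by (auto simp: inj_eq[OF inj_to_nat])
  then obtain w where w: "\<And>k. eventually (\<lambda>n. fst (\<tau> (s n) k) = w k) sequentially" by metis
  define \<sigma> where "\<sigma> k = (w k, fst (l k))" for k
  have \<sigma>: "enumerates \<phi> \<sigma>"
    by (rule enumerates_limit[of \<phi> "\<lambda>n. \<tau> (s n)"]) (use \<tau>(2) w pos in \<open>auto simp: \<sigma>_def\<close>)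
  have \<sigma>0: "snd (\<sigma> 0) \<le> 0"
    using LIMSEQ_le_const2[OF pos[of 0]] \<tau>(3) unfolding \<sigma>_def by auto
  have \<sigma>1: "0 \<le> snd (\<sigma> 0) + \<omega> $ fst (\<sigma> 0)"
  proof -
    have "snd (\<sigma> (0 + 1)) \<ge> 0"
      using LIMSEQ_le_const[OF pos[of "0 + 1"], of 0] enumerates_step[OF \<tau>(2), of _ 0] \<tau>(4)
      unfolding \<sigma>_def by (auto intro: less_imp_le)
    thus ?thesis using enumerates_step[OF \<sigma>, of 0] by simp
  qed
  show thesis
  proof (rule that[OF s])
    show "range \<sigma> \<in> tiling_space \<phi> \<omega>" using \<sigma> tiling_space_iff by blast
    fix \<epsilon> :: real assume "\<epsilon> > 0"
    obtain N where N: "wmin * real N \<ge> 1/\<epsilon> + \<epsilon> + wmax"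
      using ex_less_of_nat_mult[OF wmin_pos, of "1/\<epsilon> + \<epsilon> + wmax"] by (auto simp: mult.commute intro: less_imp_le)
    have "eventually (\<lambda>n. \<forall>k\<in>{-int N..int N}. fst (\<tau> (s n) k) = w k) sequentially"
      using w by (intro eventually_ball_finite) auto
    moreover have "eventually (\<lambda>n. dist (snd (\<tau> (s n) 0)) (fst (l 0)) < \<epsilon>) sequentially"
      using tendstoD[OF pos \<open>\<epsilon> > 0\<close>] .
    ultimately show "eventually (\<lambda>n. tilings_close \<omega> \<epsilon> (range \<sigma>) (T (s n))) sequentially"
    proof eventually_elim
      case (elim n)
      show ?case unfolding \<tau>(1)
      proof (rule close_of_enumerations[OF \<tau>(2) \<tau>(3) less_imp_le[OF \<tau>(4)] \<sigma> \<sigma>0 \<sigma>1 \<open>\<epsilon> > 0\<close> N])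
        show "fst (\<tau> (s n) k) = fst (\<sigma> k)" if "\<bar>k\<bar> \<le> int N" for k
          using elim(1) that by (auto simp: \<sigma>_def abs_le_iff)
        show "\<bar>snd (\<sigma> 0) - snd (\<tau> (s n) 0)\<bar> < \<epsilon>"
          using elim(2) by (simp add: \<sigma>_def dist_real_def abs_minus_commute)
      qed
    qed
  qed
qed

text \<open>The set of tilings \<epsilon>-close to \<open>S\<close> need not be open.
  \<open>U\<close> is its interior, and \<open>close_triangle\<close> shows that \<open>U\<close> is
  open.\<close>

lemma open_neighbourhood:
  assumes "S \<in> tiling_space \<phi> \<omega>" "\<epsilon> > 0"
  obtains U where "openin (tiling_topology \<phi> \<omega>) U" "S \<in> U" "\<And>S'. S' \<in> U \<Longrightarrow> tilings_close \<omega> \<epsilon> S S'"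
proof -
  define U where "U = {S'\<in>tiling_space \<phi> \<omega>. \<exists>\<eta>>0. \<forall>S''\<in>tiling_space \<phi> \<omega>.
    tilings_close \<omega> \<eta> S' S'' \<longrightarrow> tilings_close \<omega> \<epsilon> S S''}"
  have "tiling_open \<phi> \<omega> U"
    unfolding tiling_open_def
  proof (intro conjI ballI)
    show "U \<subseteq> tiling_space \<phi> \<omega>" by (auto simp: U_def)
    fix S' assume "S' \<in> U"
    then obtain \<eta> where \<eta>: "\<eta> > 0" "\<forall>S''\<in>tiling_space \<phi> \<omega>. tilings_close \<omega> \<eta> S' S'' \<longrightarrow> tilings_close \<omega> \<epsilon> S S''"
      by (auto simp: U_def)
    define \<delta> where "\<delta> = min (1/2) (\<eta>/2)"
    have \<delta>: "0 < \<delta>" "\<delta> \<le> 1/2" "2 * \<delta> \<le> \<eta>" using \<eta>(1) by (auto simp: \<delta>_def)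
    have "S'' \<in> U" if "S'' \<in> tiling_space \<phi> \<omega>" "tilings_close \<omega> \<delta> S' S''" for S''
      using that \<eta>(2) close_triangle[OF that(2) _ \<delta>] \<delta>(1) unfolding U_def by blast
    thus "\<exists>\<epsilon>>0. \<forall>S''\<in>tiling_space \<phi> \<omega>. tilings_close \<omega> \<epsilon> S' S'' \<longrightarrow> S'' \<in> U" using \<delta>(1) by blast
  qed
  moreover have "S \<in> U" using assms by (auto simp: U_def)
  moreover have "tilings_close \<omega> \<epsilon> S S'" if "S' \<in> U" for S'
    using that close_refl unfolding U_def by blast
  ultimately show thesis using that openin_tiling_topology by metis
qed

lemma open_contains_close:
  assumes "openin (tiling_topology \<phi> \<omega>) U" "S \<in> U"
  obtains \<epsilon> where "\<epsilon> > 0" "\<And>S'. S' \<in> tiling_space \<phi> \<omega> \<Longrightarrow> tilings_close \<omega> \<epsilon> S S' \<Longrightarrow> S' \<in> U"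
  using assms unfolding openin_tiling_topology tiling_open_def by blast

lemma eventually_close_each_other:
  assumes "\<And>\<epsilon>. \<epsilon> > 0 \<Longrightarrow> eventually (\<lambda>n. tilings_close \<omega> \<epsilon> S (X n)) F"
    and "\<And>\<epsilon>. \<epsilon> > 0 \<Longrightarrow> eventually (\<lambda>n. tilings_close \<omega> \<epsilon> S (Y n)) F" and "\<epsilon> > 0"
  shows "eventually (\<lambda>n. tilings_close \<omega> \<epsilon> (X n) (Y n)) F"
proof -
  \<comment> \<open>One factor 2 is lost by reversing the first closeness and another by the
    triangle inequality.\<close>
  define \<delta> where "\<delta> = min (1/4) (\<epsilon>/4)"
  have \<delta>: "0 < \<delta>" "\<delta> \<le> 1/2" "2 * \<delta> \<le> 2 * \<delta>" "0 < 2 * \<delta>" "2 * \<delta> \<le> 1/2" "2 * (2 * \<delta>) \<le> \<epsilon>"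
    using assms(3) by (auto simp: \<delta>_def)
  have "eventually (\<lambda>n. tilings_close \<omega> \<delta> S (X n)) F" "eventually (\<lambda>n. tilings_close \<omega> (2 * \<delta>) S (Y n)) F"
    using assms \<delta> by auto
  thus ?thesis
  proof eventually_elim
    case (elim n)
    show ?case using close_triangle[OF close_sym[OF elim(1) \<delta>(1-3)] elim(2) \<delta>(4-6)] .
  qed
qed

lemma eventually_close_trans:
  assumes "\<And>\<epsilon>. \<epsilon> > 0 \<Longrightarrow> eventually (\<lambda>n. tilings_close \<omega> \<epsilon> (X n) (Y n)) F"
    and "\<And>\<epsilon>. \<epsilon> > 0 \<Longrightarrow> eventually (\<lambda>n. tilings_close \<omega> \<epsilon> (Y n) (Z n)) F" and "\<epsilon> > 0"
  shows "eventually (\<lambda>n. tilings_close \<omega> \<epsilon> (X n) (Z n)) F"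
proof -
  define \<delta> where "\<delta> = min (1/2) (\<epsilon>/2)"
  have \<delta>: "0 < \<delta>" "\<delta> \<le> 1/2" "2 * \<delta> \<le> \<epsilon>" using assms(3) by (auto simp: \<delta>_def)
  show ?thesis using assms(1)[OF \<delta>(1)] assms(2)[OF \<delta>(1)]
    by eventually_elim (rule close_triangle[OF _ _ \<delta>])
qed

lemma limit_iff_close:
  assumes "S \<in> tiling_space \<phi> \<omega>" "\<And>n. X n \<in> tiling_space \<phi> \<omega>"
  shows "limitin (tiling_topology \<phi> \<omega>) X S F \<longleftrightarrow> (\<forall>\<epsilon>>0. eventually (\<lambda>n. tilings_close \<omega> \<epsilon> S (X n)) F)"
proof
  assume L: "limitin (tiling_topology \<phi> \<omega>) X S F"
  show "\<forall>\<epsilon>>0. eventually (\<lambda>n. tilings_close \<omega> \<epsilon> S (X n)) F"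
  proof (intro allI impI)
    fix \<epsilon> :: real assume "\<epsilon> > 0"
    then obtain U where U: "openin (tiling_topology \<phi> \<omega>) U" "S \<in> U" "\<And>S'. S' \<in> U \<Longrightarrow> tilings_close \<omega> \<epsilon> S S'"
      using open_neighbourhood[OF assms(1)] by metis
    have "eventually (\<lambda>n. X n \<in> U) F" using L U(1,2) by (simp add: limitin_def)
    thus "eventually (\<lambda>n. tilings_close \<omega> \<epsilon> S (X n)) F" by (rule eventually_mono) (rule U(3))
  qed
next
  assume R: "\<forall>\<epsilon>>0. eventually (\<lambda>n. tilings_close \<omega> \<epsilon> S (X n)) F"
  show "limitin (tiling_topology \<phi> \<omega>) X S F"
    unfolding limitin_def topspace_tiling_topology
  proof (intro conjI allI impI assms(1))
    fix U assume "openin (tiling_topology \<phi> \<omega>) U \<and> S \<in> U"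
    then obtain \<epsilon> where "\<epsilon> > 0" "\<And>S'. S' \<in> tiling_space \<phi> \<omega> \<Longrightarrow> tilings_close \<omega> \<epsilon> S S' \<Longrightarrow> S' \<in> U"
      using open_contains_close by metis
    thus "eventually (\<lambda>n. X n \<in> U) F" using R assms(2) by (metis (mono_tags, lifting) eventually_mono)
  qed
qed

text \<open>The metric is known only through its topology, and compactness supplies the uniformity.
  If one side failed along a subsequence, a further subsequence of \<open>X\<close> would converge
  to some \<open>S\<close>; the other side makes \<open>Y\<close> converge to \<open>S\<close> as
  well, and this contradicts the failure.\<close>

lemma dist_tendsto_0_iff:
  assumes m: "compatible_metric \<phi> \<omega> d"
    and X: "\<And>n. X n \<in> tiling_space \<phi> \<omega>" and Y: "\<And>n. Y n \<in> tiling_space \<phi> \<omega>"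
  shows "(\<lambda>n::nat. d (X n) (Y n)) \<longlonglongrightarrow> 0 \<longleftrightarrow>
    (\<forall>\<epsilon>>0. eventually (\<lambda>n. tilings_close \<omega> \<epsilon> (X n) (Y n)) sequentially)"
proof -
  interpret Metric_space "tiling_space \<phi> \<omega>" d
    using m by (simp add: compatible_metric_def)
  have top: "mtopology = tiling_topology \<phi> \<omega>" using m by (simp add: compatible_metric_def)
  have lim: "(\<forall>\<epsilon>>0. eventually (\<lambda>n. tilings_close \<omega> \<epsilon> S (Z n)) sequentially) \<longleftrightarrow> (\<lambda>n. d (Z n) S) \<longlonglongrightarrow> 0"
    if "S \<in> tiling_space \<phi> \<omega>" "\<And>n. Z n \<in> tiling_space \<phi> \<omega>" for S and Z :: "nat \<Rightarrow> 'a tiling"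
    using limit_iff_close[OF that, where F = sequentially, folded top] that limitin_metric_dist_null[of Z S sequentially] by simp
  show ?thesis
  proof
    assume D: "(\<lambda>n. d (X n) (Y n)) \<longlonglongrightarrow> 0"
    show "\<forall>\<epsilon>>0. eventually (\<lambda>n. tilings_close \<omega> \<epsilon> (X n) (Y n)) sequentially"
    proof (intro allI impI, rule ccontr)
      fix \<epsilon> :: real assume \<epsilon>: "\<epsilon> > 0" "\<not> eventually (\<lambda>n. tilings_close \<omega> \<epsilon> (X n) (Y n)) sequentially"
      then obtain g :: "nat \<Rightarrow> nat" where g: "strict_mono g" "\<And>n. \<not> tilings_close \<omega> \<epsilon> (X (g n)) (Y (g n))"
        using not_eventually_sequentiallyD by blast
      obtain s S where s: "strict_mono (s :: nat \<Rightarrow> nat)" "S \<in> tiling_space \<phi> \<omega>"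
        "\<And>\<epsilon>. \<epsilon> > 0 \<Longrightarrow> eventually (\<lambda>n. tilings_close \<omega> \<epsilon> S (X (g (s n)))) sequentially"
        by (rule tiling_space_seq_compact[of "\<lambda>n. X (g n)", OF X]) (rule that, assumption, assumption, blast)
      have "strict_mono (\<lambda>n. g (s n))" using g(1) s(1) by (simp add: strict_mono_def)
      hence D': "(\<lambda>n. d (X (g (s n))) (Y (g (s n)))) \<longlonglongrightarrow> 0"
        using LIMSEQ_subseq_LIMSEQ[OF D] by (simp add: comp_def)
      have "(\<lambda>n. d (X (g (s n))) S) \<longlonglongrightarrow> 0" using lim[OF s(2), of "\<lambda>n. X (g (s n))"] s(3) X by blast
      hence "(\<lambda>n. d (X (g (s n))) (Y (g (s n))) + d (X (g (s n))) S) \<longlonglongrightarrow> 0 + 0" using D' by (intro tendsto_add)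
      hence "(\<lambda>n. d (Y (g (s n))) S) \<longlonglongrightarrow> 0"
      proof (rule Lim_null_comparison[rotated, OF tendsto_eq_rhs])
        have "d (Y m) S \<le> d (X m) (Y m) + d (X m) S" for m
          using triangle[OF Y[of m] X[of m] s(2)] commute[of "X m" "Y m"] by simp
        thus "eventually (\<lambda>n. norm (d (Y (g (s n))) S) \<le> d (X (g (s n))) (Y (g (s n))) + d (X (g (s n))) S) sequentially"
          by simp
      qed simp
      hence "\<forall>\<epsilon>>0. eventually (\<lambda>n. tilings_close \<omega> \<epsilon> S (Y (g (s n)))) sequentially"
        using lim[OF s(2), of "\<lambda>n. Y (g (s n))"] Y by blast
      hence "eventually (\<lambda>n. tilings_close \<omega> \<epsilon> (X (g (s n))) (Y (g (s n)))) sequentially"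
        by (intro eventually_close_each_other[OF s(3)] \<epsilon>(1)) auto
      thus False using g(2) by simp
    qed
  next
    assume C: "\<forall>\<epsilon>>0. eventually (\<lambda>n. tilings_close \<omega> \<epsilon> (X n) (Y n)) sequentially"
    show "(\<lambda>n. d (X n) (Y n)) \<longlonglongrightarrow> 0"
    proof (rule ccontr)
      assume "\<not> ?thesis"
      then obtain e where e: "e > 0" "\<not> eventually (\<lambda>n. d (X n) (Y n) < e) sequentially"
        unfolding tendsto_iff by auto
      then obtain g :: "nat \<Rightarrow> nat" where g: "strict_mono g" "\<And>n. \<not> d (X (g n)) (Y (g n)) < e"
        using not_eventually_sequentiallyD by blast
      obtain s S where s: "strict_mono (s :: nat \<Rightarrow> nat)" "S \<in> tiling_space \<phi> \<omega>"
        "\<And>\<epsilon>. \<epsilon> > 0 \<Longrightarrow> eventually (\<lambda>n. tilings_close \<omega> \<epsilon> S (X (g (s n)))) sequentially"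
        by (rule tiling_space_seq_compact[of "\<lambda>n. X (g n)", OF X]) (rule that, assumption, assumption, blast)
      have sm: "strict_mono (\<lambda>n. g (s n))" using g(1) s(1) by (simp add: strict_mono_def)
      have C': "eventually (\<lambda>n. tilings_close \<omega> \<epsilon> (X (g (s n))) (Y (g (s n)))) sequentially" if "\<epsilon> > 0" for \<epsilon>
        using eventually_subseq[OF sm] C that by blast
      have X': "(\<lambda>n. d (X (g (s n))) S) \<longlonglongrightarrow> 0" using lim[OF s(2), of "\<lambda>n. X (g (s n))"] s(3) X by blast
      have "\<forall>\<epsilon>>0. eventually (\<lambda>n. tilings_close \<omega> \<epsilon> S (Y (g (s n)))) sequentially"
        by (intro allI impI eventually_close_trans[OF s(3) C'])
      hence Y': "(\<lambda>n. d (Y (g (s n))) S) \<longlonglongrightarrow> 0"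
        using lim[OF s(2), of "\<lambda>n. Y (g (s n))"] Y by blast
      have "(\<lambda>n. d (X (g (s n))) S + d (Y (g (s n))) S) \<longlonglongrightarrow> 0 + 0" using X' Y' by (intro tendsto_add)
      hence "eventually (\<lambda>n. d (X (g (s n))) S + d (Y (g (s n))) S < e) sequentially"
        using e(1) order_tendstoD(2) by fastforce
      then obtain n where "d (X (g (s n))) S + d (Y (g (s n))) S < e"
        using eventually_happens'[OF sequentially_bot] by blast
      moreover have "d (X (g (s n))) (Y (g (s n))) \<le> d (X (g (s n))) S + d S (Y (g (s n)))"
        using triangle X Y s(2) by blast
      ultimately show False using g(2)[of "s n"] commute[of S "Y (g (s n))"] by simp
    qed
  qed
qed

end

section \<open>Lifting a continuous map along orbits\<close>

context tile_lengths
begin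

definition tiling_path :: "('a \<Rightarrow> 'a list) \<Rightarrow> (real \<Rightarrow> 'a tiling) \<Rightarrow> bool" where
  "tiling_path \<phi> \<gamma> \<longleftrightarrow> (\<forall>t. \<gamma> t \<in> tiling_space \<phi> \<omega>) \<and>
     (\<forall>t. \<forall>\<epsilon>>0. eventually (\<lambda>u. tilings_close \<omega> \<epsilon> (\<gamma> t) (\<gamma> u)) (nhds t))"

text \<open>Transversals are totally disconnected: the small shift matching \<open>\<gamma> t\<^sub>0\<close> with \<open>\<gamma> t\<close> near the
  origin is unique, so matching on any larger window is a locally constant property of \<open>t\<close>.\<close>

lemma path_locally_in_orbit:
  assumes \<gamma>: "tiling_path \<phi> \<gamma>" and I: "connected I" "t0 \<in> I"
    and \<delta>: "0 < \<delta>" "2 * \<delta> \<le> wmin" and close: "\<And>t. t \<in> I \<Longrightarrow> tilings_close \<omega> \<delta> (\<gamma> t0) (\<gamma> t)"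
    and t: "t \<in> I"
  shows "\<exists>s. \<bar>s\<bar> < \<delta> \<and> \<gamma> t0 = translate (\<gamma> t) s"
proof -
  have space: "\<gamma> t \<in> tiling_space \<phi> \<omega>" for t using \<gamma> by (simp add: tiling_path_def)
  have "\<forall>t\<in>I. \<exists>s. \<bar>s\<bar> < \<delta> \<and> agree (1/\<delta>) (\<gamma> t0) (translate (\<gamma> t) s)"
    using close by (simp add: tilings_close_iff[OF \<delta>(1)])
  then obtain s where s: "\<And>t. t \<in> I \<Longrightarrow> \<bar>s t\<bar> < \<delta>" "\<And>t. t \<in> I \<Longrightarrow> agree (1/\<delta>) (\<gamma> t0) (translate (\<gamma> t) (s t))"
    by metis
  have uniq: "s t = v" if "t \<in> I" "\<bar>v\<bar> < \<delta>" "agree (1/\<delta>) (\<gamma> t0) (translate (\<gamma> t) v)" for t v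
  proof (rule agree_shift_unique[OF space s(2)[OF that(1)] that(3)])
    show "\<bar>s t - v\<bar> < wmin" using s(1)[OF that(1)] that(2) \<delta> by linarith
  qed (use \<delta> in simp)
  have all: "agree R (\<gamma> t0) (translate (\<gamma> t) (s t))" if R: "R \<ge> 1/\<delta>" for R
  proof -
    define f where "f t = agree R (\<gamma> t0) (translate (\<gamma> t) (s t))" for t
    have "\<forall>t1\<in>I. eventually (\<lambda>t. f t1 = f t) (at t1 within I)"
    proof
      fix t1 assume t1: "t1 \<in> I"
      \<comment> \<open>The first term keeps the new shift \<open>u + s t1\<close> below \<delta>,
        where shifts are unique. The second leaves a window of radius \<open>R\<close> after
        translating by \<open>s t1\<close>.\<close>
      define \<eta> where "\<eta> = min (\<delta> - \<bar>s t1\<bar>) (1 / (R + \<delta>))"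
      have Rpos: "R > 0" using R \<delta>(1) by (meson less_le_trans zero_less_divide_1_iff)
      have \<eta>: "\<eta> > 0" "\<eta> \<le> \<delta> - \<bar>s t1\<bar>" using s(1)[OF t1] Rpos \<delta>(1) by (auto simp: \<eta>_def)
      have "\<eta> \<le> 1 / (R + \<delta>)" by (simp add: \<eta>_def)
      hence win: "R + \<delta> \<le> 1/\<eta>" using \<eta>(1) Rpos \<delta>(1) by (simp add: field_simps)
      have "eventually (\<lambda>t. tilings_close \<omega> \<eta> (\<gamma> t1) (\<gamma> t)) (nhds t1)"
        using \<gamma> \<eta>(1) by (simp add: tiling_path_def)
      hence "eventually (\<lambda>t. t \<in> I \<longrightarrow> tilings_close \<omega> \<eta> (\<gamma> t1) (\<gamma> t)) (nhds t1)"
        by (rule eventually_mono) simp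
      hence "eventually (\<lambda>t. t \<noteq> t1 \<longrightarrow> t \<in> I \<longrightarrow> tilings_close \<omega> \<eta> (\<gamma> t1) (\<gamma> t)) (nhds t1)"
        by (rule eventually_mono) simp
      hence "eventually (\<lambda>t. t \<in> I \<and> tilings_close \<omega> \<eta> (\<gamma> t1) (\<gamma> t)) (at t1 within I)"
        unfolding eventually_at_filter by (rule eventually_mono) simp
      thus "eventually (\<lambda>t. f t1 = f t) (at t1 within I)"
      proof (rule eventually_mono)
        fix t assume tI: "t \<in> I \<and> tilings_close \<omega> \<eta> (\<gamma> t1) (\<gamma> t)"
        then obtain u where u: "\<bar>u\<bar> < \<eta>" "agree (1/\<eta>) (\<gamma> t1) (translate (\<gamma> t) u)"
          by (auto simp: tilings_close_iff[OF \<eta>(1)])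
        have ag: "agree R (translate (\<gamma> t1) (s t1)) (translate (\<gamma> t) (u + s t1))"
          using agree_translate[OF u(2), of R "s t1"] win s(1)[OF t1] by simp
        have "agree (1/\<delta>) (\<gamma> t0) (translate (\<gamma> t) (u + s t1))"
          using agree_trans[OF s(2)[OF t1] agree_mono[OF ag R]] .
        hence "s t = u + s t1" using uniq tI u(1) \<eta>(2) by auto
        thus "f t1 = f t" using ag unfolding f_def by (metis agree_sym agree_trans)
      qed
    qed
    hence "f t = f t0" using connected_local_const[OF I t, of f] by blast
    moreover have "s t0 = 0" using uniq[OF I(2), of 0] \<delta>(1) by simp
    ultimately show ?thesis by (simp add: f_def)
  qed
  have "agree R (\<gamma> t0) (translate (\<gamma> t) (s t))" for R
    using all[of "max R (1/\<delta>)"] agree_mono by (meson max.cobounded1 max.cobounded2)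
  hence "\<gamma> t0 = translate (\<gamma> t) (s t)" by (intro agree_all_eq)
  thus ?thesis using s(1)[OF t] by blast
qed

text \<open>By \<open>path_locally_in_orbit\<close>, belonging to the orbit of
  \<open>\<gamma> 0\<close> is a locally constant property, and the line is connected.\<close>

lemma path_in_orbit:
  assumes \<gamma>: "tiling_path \<phi> \<gamma>"
  shows "\<exists>s. \<gamma> t = translate (\<gamma> 0) s"
proof -
  define f where "f t \<longleftrightarrow> (\<exists>s. \<gamma> t = translate (\<gamma> 0) s)" for t
  have "\<forall>t1\<in>UNIV. eventually (\<lambda>t. f t1 = f t) (at t1 within UNIV)"
  proof
    fix t1 :: real
    define \<delta> where "\<delta> = wmin / 2"
    have \<delta>: "0 < \<delta>" "2 * \<delta> \<le> wmin" using wmin_pos by (auto simp: \<delta>_def)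
    have "eventually (\<lambda>u. tilings_close \<omega> \<delta> (\<gamma> t1) (\<gamma> u)) (nhds t1)"
      using \<gamma> \<delta>(1) by (simp add: tiling_path_def)
    then obtain e where e: "e > 0" "\<And>u. dist u t1 < e \<Longrightarrow> tilings_close \<omega> \<delta> (\<gamma> t1) (\<gamma> u)"
      unfolding eventually_nhds_metric by blast
    have "f t1 = f u" if "dist u t1 < e" for u
    proof -
      have "\<exists>s. \<bar>s\<bar> < \<delta> \<and> \<gamma> t1 = translate (\<gamma> u) s"
        by (rule path_locally_in_orbit[OF \<gamma> _ _ \<delta>, of "ball t1 e"]) (use e that in \<open>auto simp: dist_commute\<close>)
      then obtain s where s: "\<gamma> t1 = translate (\<gamma> u) s" by blast
      hence "\<gamma> u = translate (\<gamma> t1) (-s)" by simp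
      thus ?thesis unfolding f_def using s by (metis translate_translate)
    qed
    thus "eventually (\<lambda>t. f t1 = f t) (at t1 within UNIV)"
      unfolding eventually_at using e(1) by blast
  qed
  hence "f t = f 0" using connected_local_const[of UNIV t 0 f] by auto
  moreover have "f 0" unfolding f_def by (metis translate_0)
  ultimately show ?thesis by (simp add: f_def)
qed

end

text \<open>Only continuity is assumed, so that the locale can be instantiated both for a
  homeomorphism and for its inverse.\<close>

locale tiling_map = src: pisot \<phi> \<omega>\<phi> r\<phi> + tgt: pisot \<psi> \<omega>\<psi> r\<psi>
  for \<phi> :: "'a::finite \<Rightarrow> 'a list" and \<omega>\<phi> r\<phi> :: "real^'a"
    and \<psi> :: "'b::finite \<Rightarrow> 'b list" and \<omega>\<psi> r\<psi> :: "real^'b" +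
  fixes h :: "'a tiling \<Rightarrow> 'b tiling"
  assumes cont: "continuous_map (tiling_topology \<phi> \<omega>\<phi>) (tiling_topology \<psi> \<omega>\<psi>) h"
begin

abbreviation "X \<equiv> tiling_space \<phi> \<omega>\<phi>"
abbreviation "Y \<equiv> tiling_space \<psi> \<omega>\<psi>"

lemma h_space: "T \<in> X \<Longrightarrow> h T \<in> Y"
  using continuous_map_image_subset_topspace[OF cont] by (auto simp: topspace_tiling_topology)

text \<open>Counterexamples with closeness 1/(n+1) would have subsequences with a common limit
  \<open>S\<close>, and both sequences of images would converge to \<open>h S\<close>.\<close>

lemma uniformly_continuous:
  assumes "\<epsilon> > 0"
  obtains \<delta> where "\<delta> > 0"
    "\<And>T T'. T \<in> X \<Longrightarrow> T' \<in> X \<Longrightarrow> tilings_close \<omega>\<phi> \<delta> T T' \<Longrightarrow> tilings_close \<omega>\<psi> \<epsilon> (h T) (h T')"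
proof (rule ccontr)
  assume "\<not> thesis"
  hence "\<exists>T T'. T \<in> X \<and> T' \<in> X \<and> tilings_close \<omega>\<phi> (1 / real (Suc n)) T T' \<and> \<not> tilings_close \<omega>\<psi> \<epsilon> (h T) (h T')" for n
    using that[of "1 / real (Suc n)"] by auto
  then obtain T T' where T: "\<And>n. T n \<in> X" "\<And>n. T' n \<in> X" "\<And>n. tilings_close \<omega>\<phi> (1 / real (Suc n)) (T n) (T' n)"
    "\<And>n. \<not> tilings_close \<omega>\<psi> \<epsilon> (h (T n)) (h (T' n))" by metis
  obtain s S where s: "strict_mono (s :: nat \<Rightarrow> nat)" "S \<in> X"
    "\<And>\<epsilon>. \<epsilon> > 0 \<Longrightarrow> eventually (\<lambda>n. tilings_close \<omega>\<phi> \<epsilon> S (T (s n))) sequentially"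
    by (rule src.tiling_space_seq_compact[of T, OF T(1)]) (rule that, assumption, assumption, blast)
  have "eventually (\<lambda>n. tilings_close \<omega>\<phi> \<epsilon> (T n) (T' n)) sequentially" if "\<epsilon> > 0" for \<epsilon>
  proof -
    have "eventually (\<lambda>n. 1 / real (Suc n) < \<epsilon>) sequentially"
      using order_tendstoD(2)[OF LIMSEQ_inverse_real_of_nat that] by (simp add: inverse_eq_divide)
    thus ?thesis
    proof (rule eventually_mono)
      show "tilings_close \<omega>\<phi> \<epsilon> (T n) (T' n)" if "1 / real (Suc n) < \<epsilon>" for n
        using tilings_close_mono[OF T(3)[of n]] that by simp
    qed
  qed
  hence TT: "eventually (\<lambda>n. tilings_close \<omega>\<phi> \<epsilon> (T (s n)) (T' (s n))) sequentially" if "\<epsilon> > 0" for \<epsilon>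
    using eventually_subseq[OF s(1)] that by blast
  have s': "eventually (\<lambda>n. tilings_close \<omega>\<phi> \<epsilon> S (T' (s n))) sequentially" if "\<epsilon> > 0" for \<epsilon>
    using src.eventually_close_trans[OF s(3) TT that] .
  have lim: "eventually (\<lambda>n. tilings_close \<omega>\<psi> \<epsilon> (h S) (h (Z n))) sequentially"
    if "\<And>\<epsilon>. \<epsilon> > 0 \<Longrightarrow> eventually (\<lambda>n. tilings_close \<omega>\<phi> \<epsilon> S (Z n)) sequentially" "\<And>n. Z n \<in> X" "\<epsilon> > 0"
    for Z :: "nat \<Rightarrow> 'a tiling" and \<epsilon>
  proof -
    have "limitin (tiling_topology \<phi> \<omega>\<phi>) Z S sequentially"
      using src.limit_iff_close[of S \<phi> Z, OF s(2) that(2)] that(1) by blast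
    hence "limitin (tiling_topology \<psi> \<omega>\<psi>) (h \<circ> Z) (h S) sequentially"
      by (rule continuous_map_limit[OF cont])
    thus ?thesis
      using tgt.limit_iff_close[OF h_space[OF s(2)], of "h \<circ> Z"] h_space[OF that(2)] that(3) by simp
  qed
  have "eventually (\<lambda>n. tilings_close \<omega>\<psi> \<epsilon> (h (T (s n))) (h (T' (s n)))) sequentially"
    by (rule tgt.eventually_close_each_other[OF lim lim]) (use s(3) s' T assms in auto)
  thus False using T(4) by simp
qed

lemma path_image:
  assumes "T \<in> X"
  shows "tgt.tiling_path \<psi> (\<lambda>t. h (translate T (-t)))"
  unfolding tgt.tiling_path_def
proof (intro conjI allI impI)
  show "h (translate T (-t)) \<in> Y" for t using h_space src.translate_in_space[OF assms] by blast
  fix t \<epsilon> :: real assume "\<epsilon> > 0"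
  then obtain \<delta> where \<delta>: "\<delta> > 0"
    "\<And>T T'. T \<in> X \<Longrightarrow> T' \<in> X \<Longrightarrow> tilings_close \<omega>\<phi> \<delta> T T' \<Longrightarrow> tilings_close \<omega>\<psi> \<epsilon> (h T) (h T')"
    using uniformly_continuous by metis
  have "tilings_close \<omega>\<psi> \<epsilon> (h (translate T (-t))) (h (translate T (-u)))" if "dist u t < \<delta>" for u
  proof (rule \<delta>(2))
    show "tilings_close \<omega>\<phi> \<delta> (translate T (-t)) (translate T (-u))"
      using src.close_translate[of "t - u" \<delta> "translate T (-t)"] that by (simp add: dist_real_def abs_minus_commute)
  qed (use src.translate_in_space[OF assms] in auto)
  thus "eventually (\<lambda>u. tilings_close \<omega>\<psi> \<epsilon> (h (translate T (-t))) (h (translate T (-u)))) (nhds t)"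
    unfolding eventually_nhds_metric using \<delta>(1) by blast
qed

text \<open>The function \<tau> of the overview. \<open>path_in_orbit\<close> provides a value, and
  aperiodicity of the target makes it unique.\<close>

definition lift :: "'a tiling \<Rightarrow> real \<Rightarrow> real" where
  "lift T t = (SOME u. h (translate T (-t)) = translate (h T) (-u))"

lemma lift: "T \<in> X \<Longrightarrow> h (translate T (-t)) = translate (h T) (- lift T t)"
proof -
  assume "T \<in> X"
  then obtain s where "h (translate T (-t)) = translate (h T) s"
    using tgt.path_in_orbit[OF path_image, of T t] by auto
  hence "h (translate T (-t)) = translate (h T) (- (-s))" by simp
  thus ?thesis unfolding lift_def by (rule someI)
qed

lemma lift_unique:
  assumes "T \<in> X" "h (translate T (-t)) = translate (h T) (-u)"
  shows "lift T t = u"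
proof -
  have "translate (h T) (- lift T t) = translate (h T) (-u)"
    using lift[OF assms(1), of t] assms(2) by simp
  from tgt.aperiodic[OF h_space[OF assms(1)] this] show ?thesis by simp
qed

lemma lift_cocycle:
  assumes "T \<in> X"
  shows "lift T (s + t) = lift T s + lift (translate T (-s)) t"
proof (rule lift_unique[OF assms])
  have "h (translate T (- (s + t))) = h (translate (translate T (-s)) (-t))" by simp
  also have "\<dots> = translate (h (translate T (-s))) (- lift (translate T (-s)) t)"
    by (rule lift[OF src.translate_in_space[OF assms]])
  finally show "h (translate T (- (s + t))) = translate (h T) (- (lift T s + lift (translate T (-s)) t))"
    by (simp add: lift[OF assms])
qed

lemma lift_diff:
  assumes "T \<in> X"
  shows "lift T t - lift T s = lift (translate T (-s)) (t - s)"
  using lift_cocycle[OF assms, of s "t - s"] by simp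

lemma lift_0 [simp]: "T \<in> X \<Longrightarrow> lift T 0 = 0"
  by (rule lift_unique) simp_all

text \<open>The image of the whole interval of radius \<eta> stays close to \<open>h T\<close>, so
  \<open>path_locally_in_orbit\<close> realizes it by small shifts. The bound is uniform in
  \<open>T\<close> because the modulus of continuity of \<open>h\<close> is.\<close>

lemma lift_small:
  assumes "\<epsilon> > 0"
  obtains \<eta> where "\<eta> > 0" "\<And>T t. T \<in> X \<Longrightarrow> \<bar>t\<bar> < \<eta> \<Longrightarrow> \<bar>lift T t\<bar> < \<epsilon>"
proof -
  define \<delta> where "\<delta> = min \<epsilon> (tgt.wmin / 2)"
  have \<delta>: "0 < \<delta>" "2 * \<delta> \<le> tgt.wmin" "\<delta> \<le> \<epsilon>" using assms tgt.wmin_pos by (auto simp: \<delta>_def)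
  obtain \<eta> where \<eta>: "\<eta> > 0"
    "\<And>T T'. T \<in> X \<Longrightarrow> T' \<in> X \<Longrightarrow> tilings_close \<omega>\<phi> \<eta> T T' \<Longrightarrow> tilings_close \<omega>\<psi> \<delta> (h T) (h T')"
    using uniformly_continuous[OF \<delta>(1)] by metis
  have "\<bar>lift T t\<bar> < \<epsilon>" if T: "T \<in> X" and t: "\<bar>t\<bar> < \<eta>" for T t
  proof -
    have "\<exists>s. \<bar>s\<bar> < \<delta> \<and> h (translate T (-0)) = translate (h (translate T (-t))) s"
    proof (rule tgt.path_locally_in_orbit[OF path_image[OF T] _ _ \<delta>(1,2), of "{-\<eta><..<\<eta>}"])
      fix u assume "u \<in> {-\<eta><..<\<eta>}"
      hence "tilings_close \<omega>\<phi> \<eta> T (translate T (-u))" by (intro src.close_translate) auto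
      thus "tilings_close \<omega>\<psi> \<delta> (h (translate T (-0))) (h (translate T (-u)))"
        using \<eta>(2) T src.translate_in_space[OF T] by simp
    qed (use \<eta>(1) t in auto)
    then obtain s where s: "\<bar>s\<bar> < \<delta>" "h T = translate (h (translate T (-t))) s" by auto
    hence "h (translate T (-t)) = translate (h T) (-s)" by simp
    thus ?thesis using lift_unique[OF T] s(1) \<delta>(3) by auto
  qed
  thus thesis using that \<eta>(1) by blast
qed

text \<open>The cocycle identity cuts \<open>t\<close> into steps of length at most \<eta>/2, each
  changing the lift by less than 1.\<close>

lemma lift_bound:
  obtains K where "K > 0" "\<And>T t. T \<in> X \<Longrightarrow> \<bar>lift T t\<bar> \<le> K * (\<bar>t\<bar> + 1)"
proof -
  obtain \<eta> where \<eta>: "\<eta> > 0" "\<And>T t. T \<in> X \<Longrightarrow> \<bar>t\<bar> < \<eta> \<Longrightarrow> \<bar>lift T t\<bar> < 1"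
    using lift_small[of 1] by auto
  have steps: "\<bar>lift T t\<bar> \<le> real n" if "T \<in> X" "\<bar>t\<bar> \<le> real n * (\<eta>/2)" for n T t
    using that
  proof (induction n arbitrary: T t)
    case (Suc n)
    \<comment> \<open>The first step: \<open>t\<close> clamped to the interval from -\<eta>/2 to
      \<eta>/2.\<close>
    define u where "u = max (-(\<eta>/2)) (min t (\<eta>/2))"
    have u: "\<bar>u\<bar> < \<eta>" "\<bar>t - u\<bar> \<le> real n * (\<eta>/2)"
      using Suc.prems(2) \<eta>(1) mult_nonneg_nonneg[of "real n" "\<eta>/2"] by (auto simp: u_def algebra_simps abs_le_iff max_def min_def)
    have "\<bar>lift T u\<bar> < 1" using \<eta>(2) u(1) Suc.prems(1) by blast
    moreover have "\<bar>lift (translate T (-u)) (t - u)\<bar> \<le> real n"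
      by (rule Suc.IH[OF src.translate_in_space[OF Suc.prems(1)] u(2)])
    ultimately show ?case using lift_diff[OF Suc.prems(1), of t u] by simp
  qed simp
  define K where "K = 2/\<eta> + 1"
  have "\<bar>lift T t\<bar> \<le> K * (\<bar>t\<bar> + 1)" if "T \<in> X" for T t
  proof -
    define n where "n = nat \<lceil>\<bar>t\<bar> / (\<eta>/2)\<rceil>"
    have "\<bar>t\<bar> / (\<eta>/2) \<le> real n" by (simp add: n_def real_nat_ceiling_ge)
    hence "\<bar>t\<bar> \<le> real n * (\<eta>/2)" using \<eta>(1) by (simp add: pos_divide_le_eq)
    hence "\<bar>lift T t\<bar> \<le> real n" using steps that by blast
    also have "real n \<le> \<bar>t\<bar> / (\<eta>/2) + 1"
      using \<eta>(1) by (simp add: n_def of_nat_nat)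
    also have "\<dots> \<le> K * (\<bar>t\<bar> + 1)"
    proof -
      have "K * (\<bar>t\<bar> + 1) = \<bar>t\<bar> / (\<eta>/2) + 2/\<eta> + \<bar>t\<bar> + 1" by (simp add: K_def distrib_left distrib_right)
      thus ?thesis using \<eta>(1) by simp
    qed
    finally show ?thesis .
  qed
  moreover have "K > 0" using \<eta>(1) by (simp add: K_def add_pos_pos)
  ultimately show thesis using that by blast
qed

text \<open>Let s(t) be the unique small shift matching the images of T - t and T' - t. When
  \<open>t\<close> moves, s(t) changes by exactly the difference of the changes of the two lifts, so
  s(t) + lift T t - lift T' t is locally constant. An equation results, not an estimate.\<close>

lemma lift_comparison:
  assumes T: "T \<in> X" "T' \<in> X" and ab: "a \<le> b" and \<epsilon>: "0 < \<epsilon>" "2 * \<epsilon> \<le> tgt.wmin"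
    and close: "\<And>t. a \<le> t \<Longrightarrow> t \<le> b \<Longrightarrow> tilings_close \<omega>\<psi> \<epsilon> (h (translate T (-t))) (h (translate T' (-t)))"
    and sa: "\<bar>sa\<bar> < \<epsilon>" "tgt.agree (1/\<epsilon>) (h (translate T (-a))) (translate (h (translate T' (-a))) sa)"
    and sb: "\<bar>sb\<bar> < \<epsilon>" "tgt.agree (1/\<epsilon>) (h (translate T (-b))) (translate (h (translate T' (-b))) sb)"
  shows "lift T b - lift T a + sb = lift T' b - lift T' a + sa"
proof -
  have "\<forall>t\<in>{a..b}. \<exists>s. \<bar>s\<bar> < \<epsilon> \<and> tgt.agree (1/\<epsilon>) (h (translate T (-t))) (translate (h (translate T' (-t))) s)"
    using close by (simp add: tgt.tilings_close_iff[OF \<epsilon>(1)])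
  then obtain s where s: "\<And>t. t \<in> {a..b} \<Longrightarrow> \<bar>s t\<bar> < \<epsilon>"
    "\<And>t. t \<in> {a..b} \<Longrightarrow> tgt.agree (1/\<epsilon>) (h (translate T (-t))) (translate (h (translate T' (-t))) (s t))" by metis
  have sp: "h (translate T' (-t)) \<in> Y" for t using h_space src.translate_in_space T(2) by blast
  have uniq: "s t = v" if "t \<in> {a..b}" "\<bar>v\<bar> < \<epsilon>" "0 < R" "R \<le> 1/\<epsilon>"
    "tgt.agree R (h (translate T (-t))) (translate (h (translate T' (-t))) v)" for t v R
  proof (rule tgt.agree_shift_unique[OF sp tgt.agree_mono[OF s(2)[OF that(1)] that(4)] that(5,3)])
    show "\<bar>s t - v\<bar> < tgt.wmin" using s(1)[OF that(1)] that(2) \<epsilon> by linarith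
  qed
  define f where "f t = s t + lift T t - lift T' t" for t
  have "\<forall>t1\<in>{a..b}. eventually (\<lambda>t. f t1 = f t) (at t1 within {a..b})"
  proof
    fix t1 assume t1: "t1 \<in> {a..b}"
    \<comment> \<open>Both lifts move by less than \<rho>: twice \<rho> still keeps the predicted
      shift below \<epsilon>, and a window of positive radius remains.\<close>
    define \<rho> where "\<rho> = min (\<epsilon> - \<bar>s t1\<bar>) (1/\<epsilon>) / 2"
    have \<rho>: "\<rho> > 0" "2 * \<rho> \<le> \<epsilon> - \<bar>s t1\<bar>" "\<rho> < 1/\<epsilon>" using s(1)[OF t1] \<epsilon>(1) by (auto simp: \<rho>_def min_def field_simps)
    obtain \<eta> where \<eta>: "\<eta> > 0" "\<And>T t. T \<in> X \<Longrightarrow> \<bar>t\<bar> < \<eta> \<Longrightarrow> \<bar>lift T t\<bar> < \<rho>"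
      using lift_small[OF \<rho>(1)] by metis
    have "f t1 = f t" if t: "t \<in> {a..b}" "dist t t1 < \<eta>" for t
    proof -
      define \<Delta> where "\<Delta> = lift T t - lift T t1"
      define \<Delta>' where "\<Delta>' = lift T' t - lift T' t1"
      have small: "\<bar>\<Delta>\<bar> < \<rho>" "\<bar>\<Delta>'\<bar> < \<rho>"
        using \<eta>(2) src.translate_in_space T t(2) unfolding \<Delta>_def \<Delta>'_def
        by (simp_all add: lift_diff dist_real_def)
      have "tgt.agree (1/\<epsilon> - \<bar>\<Delta>\<bar>) (translate (h (translate T (-t1))) (-\<Delta>)) (translate (translate (h (translate T' (-t1))) (s t1)) (-\<Delta>))"
        by (rule tgt.agree_translate[OF s(2)[OF t1]]) simp
      moreover have "translate (h (translate T (-t1))) (-\<Delta>) = h (translate T (-t))"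
        by (simp add: lift[OF T(1)] \<Delta>_def)
      moreover have "translate (translate (h (translate T' (-t1))) (s t1)) (-\<Delta>) = translate (h (translate T' (-t))) (s t1 + \<Delta>' - \<Delta>)"
        by (simp add: lift[OF T(2)] \<Delta>'_def algebra_simps)
      ultimately have ag: "tgt.agree (1/\<epsilon> - \<bar>\<Delta>\<bar>) (h (translate T (-t))) (translate (h (translate T' (-t))) (s t1 + \<Delta>' - \<Delta>))"
        by simp
      have "s t = s t1 + \<Delta>' - \<Delta>"
        by (rule uniq[OF t(1) _ _ _ ag]) (use small \<rho> in linarith)+
      thus ?thesis by (simp add: f_def \<Delta>_def \<Delta>'_def)
    qed
    thus "eventually (\<lambda>t. f t1 = f t) (at t1 within {a..b})"
      unfolding eventually_at using \<eta>(1) by blast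
  qed
  hence "f a = f b" using connected_local_const[of "{a..b}" a b f] ab by auto
  moreover have "s a = sa" using uniq[of a sa "1/\<epsilon>"] sa ab \<epsilon>(1) by auto
  moreover have "s b = sb" using uniq[of b sb "1/\<epsilon>"] sb ab \<epsilon>(1) by auto
  ultimately show ?thesis by (simp add: f_def)
qed

end

section \<open>Words and the no cycle condition\<close>

text \<open>A chain as in \<open>is_cycle\<close> without its closing pair: a walk without
  backtracking in the bipartite graph \<open>E\<close> from the left vertex \<open>p 0\<close> to
  the right vertex \<open>q (n - 1)\<close>. For \<open>n = 1\<close> it is a single edge.\<close>

definition alternating_path :: "('a \<times> 'b) set \<Rightarrow> nat \<Rightarrow> (nat \<Rightarrow> 'a) \<Rightarrow> (nat \<Rightarrow> 'b) \<Rightarrow> bool" where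
  "alternating_path E n p q \<longleftrightarrow> n \<ge> 1 \<and> (\<forall>k<n. (p k, q k) \<in> E) \<and>
     (\<forall>k. k + 1 < n \<longrightarrow> (p (k + 1), q k) \<in> E \<and> p k \<noteq> p (k + 1) \<and> q k \<noteq> q (k + 1))"

text \<open>Appending the two edges at \<open>a\<close> may backtrack. The cases are: nothing new, a
  proper extension, replacing the last edge, and cancelling the last two edges.\<close>

lemma alternating_path_extend:
  assumes path: "alternating_path E n p q" and a: "(a, q (n - 1)) \<in> E" "(a, b) \<in> E"
  shows "\<exists>n' p' q'. alternating_path E n' p' q' \<and> p' 0 = p 0 \<and> q' (n' - 1) = b"
proof -
  have n: "n \<ge> 1" and E: "\<And>k. k < n \<Longrightarrow> (p k, q k) \<in> E"
    and E': "\<And>k. k + 1 < n \<Longrightarrow> (p (k + 1), q k) \<in> E \<and> p k \<noteq> p (k + 1) \<and> q k \<noteq> q (k + 1)"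
    using path by (auto simp: alternating_path_def)
  consider "b = q (n - 1)" | "b \<noteq> q (n - 1)" "a \<noteq> p (n - 1)"
    | "b \<noteq> q (n - 1)" "a = p (n - 1)" "n = 1 \<or> b \<noteq> q (n - 2)" | "n \<ge> 2" "b = q (n - 2)"
    using n by linarith
  thus ?thesis
  proof cases
    case 1
    thus ?thesis using path by blast
  next
    case 2
    have "alternating_path E (n + 1) (p(n := a)) (q(n := b))"
      unfolding alternating_path_def
    proof (intro conjI allI impI)
      fix k assume k: "k + 1 < n + 1"
      show "((p(n := a)) (k + 1), (q(n := b)) k) \<in> E" "(p(n := a)) k \<noteq> (p(n := a)) (k + 1)"
        "(q(n := b)) k \<noteq> (q(n := b)) (k + 1)"
        using k E'[of k] 2 a(1) by (cases "k + 1 = n"; auto)+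
    qed (use E a(2) in auto)
    thus ?thesis using n by (intro exI[of _ "n + 1"] exI[of _ "p(n := a)"] exI[of _ "q(n := b)"]) auto
  next
    case 3
    have "alternating_path E n p (q(n - 1 := b))"
      unfolding alternating_path_def
    proof (intro conjI allI impI)
      fix k assume k: "k + 1 < n"
      show "(p (k + 1), (q(n - 1 := b)) k) \<in> E" "p k \<noteq> p (k + 1)" using k E'[of k] by auto
      show "(q(n - 1 := b)) k \<noteq> (q(n - 1 := b)) (k + 1)"
        using k E'[of k] 3 by (cases "k + 2 = n") auto
    qed (use E a(2) 3 n in auto)
    thus ?thesis by (intro exI[of _ n] exI[of _ p] exI[of _ "q(n - 1 := b)"]) auto
  next
    case 4
    have "alternating_path E (n - 1) p q" using path 4(1) by (auto simp: alternating_path_def)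
    thus ?thesis using 4 by (intro exI[of _ "n - 1"] exI[of _ p] exI[of _ q]) (auto simp: numeral_2_eq_2)
  qed
qed

text \<open>Removing an edge of a forest separates its ends, so the potentials of the component of one
  end can be shifted until the equation also holds along that edge.\<close>

lemma forest_potentials:
  fixes D :: "'a \<Rightarrow> 'b \<Rightarrow> real"
  assumes "finite E" "\<And>n p q. n \<ge> 2 \<Longrightarrow> alternating_path E n p q \<Longrightarrow> (p 0, q (n - 1)) \<notin> E"
  shows "\<exists>f g. \<forall>(a, b)\<in>E. D a b = f a + g b"
  using assms
proof (induction E rule: finite_induct)
  case (insert e E)
  obtain a0 b0 where e: "e = (a0, b0)" by fastforce
  have mono: "alternating_path (insert e E) n p q" if "alternating_path E n p q" for n p q
    using that by (auto simp: alternating_path_def)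
  have "\<exists>f g. \<forall>(a, b)\<in>E. D a b = f a + g b"
  proof (rule insert.IH)
    fix n p q assume "n \<ge> 2" "alternating_path E n p q"
    thus "(p 0, q (n - 1)) \<notin> E" using insert.prems[OF _ mono] by blast
  qed
  then obtain f g where fg: "\<forall>(a, b)\<in>E. D a b = f a + g b" by blast
  \<comment> \<open>\<open>rb\<close> and \<open>ra\<close> are the right and left vertices of the
    component of \<open>a0\<close> in the graph without the new edge.\<close>
  define rb where "rb b \<longleftrightarrow> (\<exists>n p q. alternating_path E n p q \<and> p 0 = a0 \<and> q (n - 1) = b)" for b
  define ra where "ra a \<longleftrightarrow> a = a0 \<or> (\<exists>b. rb b \<and> (a, b) \<in> E)" for a
  have start: "rb b" if "(a0, b) \<in> E" for b
    unfolding rb_def using that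
    by (intro exI[of _ "1::nat"] exI[of _ "\<lambda>_. a0"] exI[of _ "\<lambda>_. b"]) (simp add: alternating_path_def)
  have step: "rb b'" if b: "rb b" "(a, b) \<in> E" "(a, b') \<in> E" for a b b'
  proof -
    obtain n p q where p: "alternating_path E n p q" "p 0 = a0" "q (n - 1) = b"
      using b(1) unfolding rb_def by blast
    show ?thesis
      using alternating_path_extend[OF p(1), of a b'] b(2,3) p(2,3) unfolding rb_def by simp
  qed
  have iff: "ra a \<longleftrightarrow> rb b" if "(a, b) \<in> E" for a b
    using that start step unfolding ra_def by blast
  \<comment> \<open>A walk from \<open>a0\<close> to \<open>b0\<close> in \<open>E\<close> would be
    closed to a cycle by the new edge, or would be that edge itself.\<close>
  have "\<not> rb b0"
  proof
    assume "rb b0"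
    then obtain n p q where p: "alternating_path E n p q" "p 0 = a0" "q (n - 1) = b0"
      unfolding rb_def by blast
    show False
    proof (cases "n \<ge> 2")
      case True
      thus False using insert.prems[OF True mono[OF p(1)]] p e by simp
    next
      case False
      hence "n = 1" using p(1) by (simp add: alternating_path_def)
      thus False using p insert.hyps(2) e by (auto simp: alternating_path_def)
    qed
  qed
  define c where "c = D a0 b0 - f a0 - g b0"
  define f' where "f' a = (if ra a then f a + c else f a)" for a
  define g' where "g' b = (if rb b then g b - c else g b)" for b
  have "D a b = f' a + g' b" if "(a, b) \<in> insert e E" for a b
  proof (cases "(a, b) \<in> E")
    case True
    thus ?thesis using iff[OF True] fg by (auto simp: f'_def g'_def)
  next
    case False
    hence "a = a0" "b = b0" using that e by auto
    thus ?thesis using \<open>\<not> rb b0\<close> by (simp add: f'_def g'_def ra_def c_def)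
  qed
  thus ?case by blast
qed simp

section \<open>Sums over consecutive letters\<close>

fun pairsum :: "('a \<Rightarrow> 'a \<Rightarrow> real) \<Rightarrow> 'a list \<Rightarrow> real" where
  "pairsum D (x # y # w) = D x y + pairsum D (y # w)"
| "pairsum D _ = 0"

lemma pairsum_append:
  "u \<noteq> [] \<Longrightarrow> w \<noteq> [] \<Longrightarrow> pairsum D (u @ w) = pairsum D u + D (last u) (hd w) + pairsum D w"
proof (induction u rule: induct_list012)
  case (2 x)
  thus ?case by (cases w) auto
qed auto

text \<open>Each junction term gives its f part to the block on the left and its g part to the block
  on the right. The g part of the first block and the f part of the last belong to no junction and
  are taken off again.\<close>

lemma pairsum_concat_map:
  assumes "v \<noteq> []" "\<And>a. G a \<noteq> []"
    and "\<And>a b. sublist [a, b] v \<Longrightarrow> D (last (G a)) (hd (G b)) = f (last (G a)) + g (hd (G b))"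
  shows "pairsum D (concat (map G v)) =
    (\<Sum>a\<leftarrow>v. pairsum D (G a) + f (last (G a)) + g (hd (G a))) - g (hd (G (hd v))) - f (last (G (last v)))"
  using assms(1,3)
proof (induction v rule: list_nonempty_induct)
  case (cons x xs)
  obtain y ys where xs: "xs = y # ys" using cons.hyps by (cases xs) auto
  have IH: "pairsum D (concat (map G xs)) = (\<Sum>a\<leftarrow>xs. pairsum D (G a) + f (last (G a)) + g (hd (G a)))
      - g (hd (G (hd xs))) - f (last (G (last xs)))"
    using cons.IH cons.prems by (meson sublist_Cons_right)
  have "sublist [x, y] (x # xs)" unfolding xs by (simp add: sublist_Cons_right)
  hence D: "D (last (G x)) (hd (G y)) = f (last (G x)) + g (hd (G y))" using cons.prems by blast
  have "concat (map G xs) \<noteq> []" "hd (concat (map G xs)) = hd (G y)" using assms(2)[of y] by (simp_all add: xs)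
  hence "pairsum D (concat (map G (x # xs))) = pairsum D (G x) + D (last (G x)) (hd (G y)) + pairsum D (concat (map G xs))"
    using pairsum_append[OF assms(2)[of x], of "concat (map G xs)" D] by simp
  thus ?case unfolding IH D using xs by simp
qed simp

text \<open>The ranges decrease and are finite. Hence the sets \<open>S_plus\<close> and
  \<open>S_minus\<close> are reached at a finite level.\<close>

lemma funpow_range_eventually:
  fixes f :: "'a::finite \<Rightarrow> 'a"
  shows "\<exists>N. \<forall>n\<ge>N. range (f ^^ n) = (\<Inter>m. range (f ^^ m))"
proof -
  have anti: "range (f ^^ n) \<subseteq> range (f ^^ m)" if "m \<le> n" for m n
  proof -
    have "f ^^ n = f ^^ m \<circ> f ^^ (n - m)" using that by (metis funpow_add le_add_diff_inverse)
    thus ?thesis by auto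
  qed
  obtain N where N: "\<And>n. card (range (f ^^ N)) \<le> card (range (f ^^ n))"
    using ex_has_least_nat[of "\<lambda>_. True" 0 "\<lambda>n. card (range (f ^^ n))"] by auto
  have eq: "range (f ^^ n) = range (f ^^ N)" if "n \<ge> N" for n
    using card_seteq[OF _ anti[OF that] N] by simp
  have "range (f ^^ N) \<subseteq> range (f ^^ m)" for m
    using anti[of m N] eq[of m] by (cases "m \<le> N") auto
  hence "range (f ^^ N) = (\<Inter>m. range (f ^^ m))" by blast
  thus ?thesis using eq by metis
qed

context pisot
begin

lemma subst_word_pow_nonempty: "w \<noteq> [] \<Longrightarrow> (subst_word \<phi> ^^ n) w \<noteq> []"
proof (induction n)
  case (Suc n)
  thus ?case using phi_nonempty by (cases "(subst_word \<phi> ^^ n) w") (auto simp: subst_word_def)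
qed simp

lemma hd_subst_word_pow: "hd ((subst_word \<phi> ^^ n) [a]) = ((\<lambda>a. hd (\<phi> a)) ^^ n) a"
proof (induction n)
  case (Suc n)
  have "hd (subst_word \<phi> w) = hd (\<phi> (hd w))" if "w \<noteq> []" for w
    using that phi_nonempty by (cases w) (auto simp: subst_word_def)
  thus ?case using Suc subst_word_pow_nonempty[of "[a]" n] by simp
qed simp

lemma last_subst_word_pow: "last ((subst_word \<phi> ^^ n) [a]) = ((\<lambda>a. last (\<phi> a)) ^^ n) a"
proof (induction n)
  case (Suc n)
  have "last (subst_word \<phi> w) = last (\<phi> (last w))" if "w \<noteq> []" for w
    using that phi_nonempty by (cases w rule: rev_cases) (auto simp: subst_word_def)
  thus ?case using Suc subst_word_pow_nonempty[of "[a]" n] by simp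
qed simp

text \<open>The outer letters of a level-n supertile are n-fold iterates of the first-letter and
  last-letter maps, so they lie in the stable ranges once \<open>n\<close> is large. The pair stays
  allowed because the language is invariant under the substitution.\<close>

lemma junctions_in_P_pairs:
  "\<exists>n. \<forall>a b. factor_of_iterate \<phi> [a, b] \<longrightarrow>
     (last ((subst_word \<phi> ^^ n) [a]), hd ((subst_word \<phi> ^^ n) [b])) \<in> P_pairs \<phi>"
proof -
  obtain N1 where N1: "\<forall>n\<ge>N1. range ((\<lambda>a. last (\<phi> a)) ^^ n) = S_minus \<phi>"
    using funpow_range_eventually[of "\<lambda>a. last (\<phi> a)"] unfolding S_minus_def by blast
  obtain N2 where N2: "\<forall>n\<ge>N2. range ((\<lambda>a. hd (\<phi> a)) ^^ n) = S_plus \<phi>"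
    using funpow_range_eventually[of "\<lambda>a. hd (\<phi> a)"] unfolding S_plus_def by blast
  define n where "n = max N1 N2"
  have "(last ((subst_word \<phi> ^^ n) [a]), hd ((subst_word \<phi> ^^ n) [b])) \<in> P_pairs \<phi>"
    if ab: "factor_of_iterate \<phi> [a, b]" for a b
  proof -
    let ?u = "(subst_word \<phi> ^^ n) [a]" and ?v = "(subst_word \<phi> ^^ n) [b]"
    have ne: "?u \<noteq> []" "?v \<noteq> []" by (simp_all add: subst_word_pow_nonempty)
    have "(subst_word \<phi> ^^ n) [a, b] = ?u @ ?v"
      using subst_word_pow_concat[of n \<phi> "[a, b]"] by simp
    also have "\<dots> = butlast ?u @ [last ?u, hd ?v] @ tl ?v" using ne by simp
    finally have "sublist [last ?u, hd ?v] ((subst_word \<phi> ^^ n) [a, b])" unfolding sublist_def by blast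
    hence "factor_of_iterate \<phi> [last ?u, hd ?v]"
      using factor_of_iterate_sublist[OF factor_of_iterate_subst_word_pow[OF ab]] by blast
    hence "[last ?u, hd ?v] \<in> language \<phi>"
      using factor_of_iterate_sublist unfolding language_def by blast
    moreover have "last ?u \<in> S_minus \<phi>" using N1 unfolding last_subst_word_pow n_def by (metis max.cobounded1 rangeI)
    moreover have "hd ?v \<in> S_plus \<phi>" using N2 unfolding hd_subst_word_pow n_def by (metis max.cobounded2 rangeI)
    ultimately show ?thesis by (simp add: P_pairs_def)
  qed
  thus ?thesis by blast
qed

lemma pairsum_balanced:
  assumes "no_cycle_condition \<phi>"
  shows "\<exists>n \<kappa> B. \<forall>u. factor_of_iterate \<phi> u \<longrightarrow> u \<noteq> [] \<longrightarrow> \<bar>pairsum D ((subst_word \<phi> ^^ n) u) - \<kappa> * len u\<bar> \<le> B"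
proof -
  have "(p 0, q (n - 1)) \<notin> P_pairs \<phi>" if "n \<ge> 2" "alternating_path (P_pairs \<phi>) n p q" for n p q
    using assms that unfolding no_cycle_condition_def is_cycle_def alternating_path_def by blast
  then obtain f g where fg: "\<forall>(a, b)\<in>P_pairs \<phi>. D a b = f a + g b"
    using forest_potentials[of "P_pairs \<phi>" D] by auto
  obtain n where n: "\<And>a b. factor_of_iterate \<phi> [a, b] \<Longrightarrow>
     (last ((subst_word \<phi> ^^ n) [a]), hd ((subst_word \<phi> ^^ n) [b])) \<in> P_pairs \<phi>"
    using junctions_in_P_pairs by blast
  let ?G = "\<lambda>a. (subst_word \<phi> ^^ n) [a]"
  \<comment> \<open>The pairs inside one supertile, together with its share of the junctions on both
    sides.\<close>
  define C where "C a = pairsum D (?G a) + f (last (?G a)) + g (hd (?G a))" for a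
  obtain \<kappa> B where B: "\<And>w. factor_of_iterate \<phi> w \<Longrightarrow> \<bar>(\<Sum>a\<leftarrow>w. C a) - \<kappa> * len w\<bar> \<le> B"
    using balanced[of C] by blast
  define B' where "B' = (\<Sum>a\<in>UNIV. \<bar>f a\<bar> + \<bar>g a\<bar>)"
  have B': "\<bar>g a\<bar> + \<bar>f b\<bar> \<le> 2 * B'" for a b
  proof -
    have "\<bar>f c\<bar> + \<bar>g c\<bar> \<le> B'" for c unfolding B'_def by (rule member_le_sum) auto
    from this[of a] this[of b] show ?thesis by linarith
  qed
  have "\<bar>pairsum D ((subst_word \<phi> ^^ n) u) - \<kappa> * len u\<bar> \<le> B + 2 * B'"
    if u: "factor_of_iterate \<phi> u" "u \<noteq> []" for u
  proof -
    have "pairsum D (concat (map ?G u)) = (\<Sum>a\<leftarrow>u. C a) - g (hd (?G (hd u))) - f (last (?G (last u)))"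
      unfolding C_def
    proof (rule pairsum_concat_map[OF u(2)])
      show "D (last (?G a)) (hd (?G b)) = f (last (?G a)) + g (hd (?G b))" if "sublist [a, b] u" for a b
        using n[OF factor_of_iterate_sublist[OF u(1) that]] fg by blast
    qed (simp add: subst_word_pow_nonempty)
    thus ?thesis
      using B[OF u(1)] B'[of "hd (?G (hd u))" "last (?G (last u))"] unfolding subst_word_pow_concat[of n \<phi> u] by linarith
  qed
  thus ?thesis by blast
qed

end

section \<open>Linear growth of the lift\<close>

context tile_lengths
begin

fun occurs :: "'a tiling \<Rightarrow> real \<Rightarrow> 'a list \<Rightarrow> bool" where
  "occurs T x [] \<longleftrightarrow> True"
| "occurs T x (a # w) \<longleftrightarrow> (a, x) \<in> T \<and> occurs T (x + \<omega> $ a) w"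

lemma occurs_append: "occurs T x (u @ v) \<longleftrightarrow> occurs T x u \<and> occurs T (x + len u) v"
  by (induction u arbitrary: x) (auto simp: add.assoc)

lemma occurs_translate: "occurs (translate T t) x w \<longleftrightarrow> occurs T (x - t) w"
  by (induction w arbitrary: x) (auto simp: mem_translate algebra_simps)

lemma overlapping_tiles_eq:
  assumes "T \<in> tiling_space \<phi> \<omega>" "(a, x) \<in> T" "(b, y) \<in> T" "x < y + \<omega> $ b" "y < x + \<omega> $ a"
  shows "(a, x) = (b, y)"
proof -
  obtain \<tau> where \<tau>: "T = range \<tau>" "enumerates \<phi> \<tau>" using assms(1) tiling_space_iff by blast
  obtain j k where jk: "(a, x) = \<tau> j" "(b, y) = \<tau> k" using assms(2,3) \<tau>(1) by blast
  have "fst (\<tau> j) = a" "snd (\<tau> j) = x" "fst (\<tau> k) = b" "snd (\<tau> k) = y"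
    by (simp_all flip: jk)
  hence "j = k"
    using enumerates_next[OF \<tau>(2), of j k] enumerates_next[OF \<tau>(2), of k j] assms(4,5)
    by (cases j k rule: linorder_cases) auto
  thus ?thesis using jk by simp
qed

text \<open>Such a tile overlaps one of the tiles spelled by \<open>w\<close>, hence is that tile,
  and \<open>T'\<close> contains it too.\<close>

lemma occurs_tile_transfer:
  assumes "w \<noteq> []" "T \<in> tiling_space \<phi> \<omega>" "occurs T x w" "occurs T' x w"
    "(a, y) \<in> T" "x < y + \<omega> $ a" "y < x + len w"
  shows "(a, y) \<in> T'"
  using assms(1,3-7)
proof (induction w arbitrary: x rule: list_nonempty_induct)
  case (single b)
  thus ?case using overlapping_tiles_eq[OF assms(2), of a y b x] by simp
next
  case (cons b w)
  show ?case
  proof (cases "y < x + \<omega> $ b")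
    case True
    thus ?thesis using cons.prems overlapping_tiles_eq[OF assms(2), of a y b x] by simp
  next
    case False
    show ?thesis by (rule cons.IH[of "x + \<omega> $ b"]) (use cons.prems False omega_pos[of a] in auto)
  qed
qed

lemma agree_of_occurs:
  assumes "T \<in> tiling_space \<phi> \<omega>" "T' \<in> tiling_space \<phi> \<omega>" "occurs T x w" "occurs T' x w"
    and "x \<le> t - R" "t + R \<le> x + len w" "w \<noteq> []"
  shows "agree R (translate T (-t)) (translate T' (-t))"
  unfolding agree_def mem_translate
proof (intro allI impI iffI)
  fix a y assume y: "y < R" "-R < y + \<omega> $ a"
  have y': "x < y - - t + \<omega> $ a" "y - - t < x + len w" using y assms(5,6) by auto
  show "(a, y - - t) \<in> T'" if "(a, y - - t) \<in> T"
    using occurs_tile_transfer[OF assms(7,1,3,4) that] y' by simp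
  show "(a, y - - t) \<in> T" if "(a, y - - t) \<in> T'"
    using occurs_tile_transfer[OF assms(7,2,4,3) that] y' by simp
qed

lemma occurs_enumeration:
  assumes "enumerates \<phi> \<tau>"
  shows "occurs (range \<tau>) (snd (\<tau> m)) (map (\<lambda>k. fst (\<tau> k)) [m..m + int n]) \<and>
    snd (\<tau> m) + len (map (\<lambda>k. fst (\<tau> k)) [m..m + int n]) = snd (\<tau> (m + int n + 1))"
proof (induction n arbitrary: m)
  case 0
  show ?case using enumerates_step[OF assms, of m] by (simp add: upto.simps)
next
  case (Suc n)
  have eq: "[m..m + int (Suc n)] = m # [m + 1..m + 1 + int n]"
    by (subst upto.simps) (simp add: algebra_simps)
  have "m + int (Suc n) + 1 = m + 1 + int n + 1" by simp
  thus ?case using Suc[of "m + 1"] enumerates_step[OF assms, of m] unfolding eq by simp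
qed

lemma occurs_covering:
  assumes "T \<in> tiling_space \<phi> \<omega>" "c \<le> d"
  obtains x w where "occurs T x w" "factor_of_iterate \<phi> w" "x \<le> c" "c \<le> x + wmax" "d \<le> x + len w" "x + len w \<le> d + wmax"
proof -
  obtain \<tau> where \<tau>: "T = range \<tau>" "enumerates \<phi> \<tau>" using assms(1) tiling_space_iff by blast
  obtain j where j: "snd (\<tau> j) \<le> c" "c < snd (\<tau> j) + \<omega> $ fst (\<tau> j)" using enumerates_locate[OF \<tau>(2)] by metis
  obtain k where k: "snd (\<tau> k) \<le> d" "d < snd (\<tau> k) + \<omega> $ fst (\<tau> k)" using enumerates_locate[OF \<tau>(2)] by metis
  have "j \<le> k"
  proof (rule ccontr)
    assume "\<not> ?thesis"
    hence "snd (\<tau> k) + \<omega> $ fst (\<tau> k) \<le> snd (\<tau> j)" using enumerates_next[OF \<tau>(2)] by simp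
    thus False using j k assms(2) by linarith
  qed
  define n where "n = nat (k - j)"
  have kn: "k = j + int n" using \<open>j \<le> k\<close> by (simp add: n_def)
  define w where "w = map (\<lambda>k. fst (\<tau> k)) [j..j + int n]"
  have "snd (\<tau> j) + len w = snd (\<tau> k) + \<omega> $ fst (\<tau> k)"
    using occurs_enumeration[OF \<tau>(2), of j n] enumerates_step[OF \<tau>(2), of k] by (simp add: w_def kn)
  moreover have "occurs T (snd (\<tau> j)) w" using occurs_enumeration[OF \<tau>(2), of j n] \<tau>(1) by (simp add: w_def)
  moreover have "factor_of_iterate \<phi> w" using \<tau>(2) by (simp add: enumerates_def allowed_biinfinite_def w_def)
  ultimately show thesis
    using that[of "snd (\<tau> j)" w] j k wmax_ge[of "fst (\<tau> j)"] wmax_ge[of "fst (\<tau> k)"] by simp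
qed

end

text \<open>The supertiles of a fixed level \<open>n\<close> are so long that \<open>T\<close> determines \<open>h T\<close> near the origin up to
  a shift smaller than \<open>\<epsilon>\<close> when the origin is the midpoint of a known supertile.  Measuring the lift
  between such midpoints relative to a reference tiling for each supertile type removes the error
  \<open>\<epsilon>\<close>: the result depends exactly on the pair of consecutive supertile types.\<close>

locale supertile_markers = tiling_map +
  fixes \<epsilon> :: real and R :: real and n :: nat
  assumes eps: "0 < \<epsilon>" "\<epsilon> \<le> 1/2" "3 * \<epsilon> \<le> tgt.wmin"
    and R_pos: "0 < R"
    and close_image: "\<And>T T'. T \<in> X \<Longrightarrow> T' \<in> X \<Longrightarrow> src.agree R T T' \<Longrightarrow> tilings_close \<omega>\<psi> \<epsilon> (h T) (h T')"
    and long: "\<And>a. 2 * R \<le> src.len ((subst_word \<phi> ^^ n) [a])"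
begin

definition W :: "'a \<Rightarrow> 'a list" where "W a = (subst_word \<phi> ^^ n) [a]"
definition L :: "'a \<Rightarrow> real" where "L a = src.len (W a)"

lemma W_nonempty [simp]: "W a \<noteq> []"
  by (simp add: W_def src.subst_word_pow_nonempty)

lemma L_ge: "2 * R \<le> L a"
  using long by (simp add: L_def W_def)

text \<open>One tiling per type with its supertile centred at the origin. It is unspecified if there
  is none, but it is used only where such a tiling is at hand.\<close>

definition ref :: "'a \<Rightarrow> 'a tiling" where
  "ref a = (SOME S. S \<in> X \<and> src.occurs S (- (L a / 2)) (W a))"

text \<open>The small shift that aligns the image of \<open>T\<close> with the image of the
  reference tiling, a common origin for all tilings with supertile \<open>a\<close> centred at
  0.\<close>

definition snap :: "'a \<Rightarrow> 'a tiling \<Rightarrow> real \<Rightarrow> bool" where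
  "snap a T s \<longleftrightarrow> \<bar>s\<bar> < \<epsilon> \<and> tgt.agree (1/\<epsilon>) (h (ref a)) (translate (h T) s)"

lemma eps_window: "\<epsilon> < 1/\<epsilon>"
proof -
  have "\<epsilon> * \<epsilon> < 1 * 1" using eps by (intro mult_strict_mono) auto
  thus ?thesis using eps(1) by (simp add: field_simps)
qed

lemma snap_exists:
  assumes "T \<in> X" "src.occurs T (- (L a / 2)) (W a)"
  shows "\<exists>s. snap a T s"
proof -
  have ref: "ref a \<in> X" "src.occurs (ref a) (- (L a / 2)) (W a)"
    using someI[of "\<lambda>S. S \<in> X \<and> src.occurs S (- (L a / 2)) (W a)" T] assms by (simp_all add: ref_def)
  have "src.agree R (translate (ref a) (-0)) (translate T (-0))"
    by (rule src.agree_of_occurs[OF ref(1) assms(1) ref(2) assms(2)]) (use L_ge[of a] in \<open>simp_all add: L_def[symmetric]\<close>)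
  hence "tilings_close \<omega>\<psi> \<epsilon> (h (ref a)) (h T)" using close_image ref(1) assms(1) by simp
  thus ?thesis by (simp add: snap_def tgt.tilings_close_iff[OF eps(1)])
qed

lemma snap_unique:
  assumes "T \<in> X" "snap a T s" "snap a T s'"
  shows "s = s'"
proof (rule tgt.agree_shift_unique[OF h_space[OF assms(1)], of "1/\<epsilon>" "h (ref a)"])
  show "\<bar>s - s'\<bar> < tgt.wmin" using assms(2,3) eps unfolding snap_def by linarith
qed (use assms(2,3) eps(1) in \<open>auto simp: snap_def\<close>)

text \<open>Passing through the reference tiling, the two snaps predict the shift between the
  images, but only on a smaller window. Uniqueness identifies it with the shift \<open>v\<close>
  given by closeness, which works on the full window.\<close>

lemma snap_shift:
  assumes "T \<in> X" "T' \<in> X" "snap a T s" "snap a T' s'" "tilings_close \<omega>\<psi> \<epsilon> (h T) (h T')"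
  shows "\<bar>s' - s\<bar> < \<epsilon>" "tgt.agree (1/\<epsilon>) (h T) (translate (h T') (s' - s))"
proof -
  obtain v where v: "\<bar>v\<bar> < \<epsilon>" "tgt.agree (1/\<epsilon>) (h T) (translate (h T') v)"
    using assms(5) by (auto simp: tgt.tilings_close_iff[OF eps(1)])
  have s: "\<bar>s\<bar> < \<epsilon>" "\<bar>s'\<bar> < \<epsilon>" using assms(3,4) by (auto simp: snap_def)
  have "tgt.agree (1/\<epsilon> - \<epsilon>) (translate (h T) s) (translate (translate (h T') v) s)"
    by (rule tgt.agree_translate[OF v(2)]) (use s in simp)
  moreover have "tgt.agree (1/\<epsilon> - \<epsilon>) (h (ref a)) (translate (h T) s)"
    using assms(3) eps(1) unfolding snap_def by (auto intro: tgt.agree_mono)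
  ultimately have e: "tgt.agree (1/\<epsilon> - \<epsilon>) (h (ref a)) (translate (h T') (v + s))"
    using tgt.agree_trans by (metis translate_translate)
  have e': "tgt.agree (1/\<epsilon> - \<epsilon>) (h (ref a)) (translate (h T') s')"
    using assms(4) eps(1) unfolding snap_def by (auto intro: tgt.agree_mono)
  have "v + s = s'"
    \<comment> \<open>Three shifts below \<epsilon> are compared here, which is why 3 \<epsilon>
      must not exceed the shortest tile.\<close>
    by (rule tgt.agree_shift_unique[OF h_space[OF assms(2)] e e']) (use eps_window s v(1) eps(3) in linarith)+
  hence "v = s' - s" by simp
  thus "\<bar>s' - s\<bar> < \<epsilon>" "tgt.agree (1/\<epsilon>) (h T) (translate (h T') (s' - s))" using v by auto
qed

definition marked :: "'a \<Rightarrow> 'a \<Rightarrow> 'a tiling \<Rightarrow> bool" where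
  "marked a b T \<longleftrightarrow> T \<in> X \<and> src.occurs T (- (L a / 2)) (W a @ W b)"

definition gap :: "'a \<Rightarrow> 'a \<Rightarrow> real" where "gap a b = (L a + L b) / 2"

lemma marked_next:
  assumes "marked a b T"
  shows "translate T (- gap a b) \<in> X" "src.occurs (translate T (- gap a b)) (- (L b / 2)) (W b)"
proof -
  show "translate T (- gap a b) \<in> X" using assms src.translate_in_space by (simp add: marked_def)
  have "- (L a / 2) + src.len (W a) = - (L b / 2) + gap a b"
    by (simp add: gap_def L_def[symmetric] field_simps)
  thus "src.occurs (translate T (- gap a b)) (- (L b / 2)) (W b)"
    using assms by (simp add: marked_def src.occurs_append src.occurs_translate)
qed

lemma gap_pos: "gap a b > 0"
  using L_ge[of a] L_ge[of b] R_pos by (simp add: gap_def)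

text \<open>Between the two midpoints, every window of radius \<open>R\<close> lies inside the two
  supertiles, half a supertile being at least \<open>R\<close> long. So the images stay close all
  the way and \<open>lift_comparison\<close> applies, with the end shifts given by the
  snaps.\<close>

lemma step_well_defined:
  assumes "marked a b T" "marked a b T'" "snap a T s" "snap b (translate T (- gap a b)) s2"
    "snap a T' s'" "snap b (translate T' (- gap a b)) s2'"
  shows "lift T (gap a b) + s - s2 = lift T' (gap a b) + s' - s2'"
proof -
  have X: "T \<in> X" "T' \<in> X" using assms(1,2) by (auto simp: marked_def)
  have close: "tilings_close \<omega>\<psi> \<epsilon> (h (translate T (-t))) (h (translate T' (-t)))" if t: "0 \<le> t" "t \<le> gap a b" for t
  proof (rule close_image)
    show "src.agree R (translate T (-t)) (translate T' (-t))"
    proof (rule src.agree_of_occurs[OF X])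
      show "src.occurs T (- (L a / 2)) (W a @ W b)" "src.occurs T' (- (L a / 2)) (W a @ W b)"
        using assms(1,2) by (auto simp: marked_def)
      show "- (L a / 2) \<le> t - R" using t L_ge[of a] by simp
      show "t + R \<le> - (L a / 2) + src.len (W a @ W b)"
        using t L_ge[of b] by (simp add: gap_def L_def[symmetric])
    qed simp
  qed (use src.translate_in_space X in auto)
  have c0: "tilings_close \<omega>\<psi> \<epsilon> (h T) (h T')" using close[of 0] gap_pos[of a b] by simp
  have c1: "tilings_close \<omega>\<psi> \<epsilon> (h (translate T (- gap a b))) (h (translate T' (- gap a b)))"
    using close[of "gap a b"] gap_pos[of a b] by simp
  have "lift T (gap a b) - lift T 0 + (s2' - s2) = lift T' (gap a b) - lift T' 0 + (s' - s)"
  proof (rule lift_comparison[OF X _ eps(1) _ close])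
    show "2 * \<epsilon> \<le> tgt.wmin" using eps by linarith
    show "\<bar>s' - s\<bar> < \<epsilon>" "tgt.agree (1/\<epsilon>) (h (translate T (-0))) (translate (h (translate T' (-0))) (s' - s))"
      using snap_shift[OF X assms(3,5) c0] by simp_all
    show "\<bar>s2' - s2\<bar> < \<epsilon>"
      "tgt.agree (1/\<epsilon>) (h (translate T (- gap a b))) (translate (h (translate T' (- gap a b))) (s2' - s2))"
      using snap_shift[OF marked_next(1)[OF assms(1)] marked_next(1)[OF assms(2)] assms(4,6) c1] by simp_all
  qed (use gap_pos[of a b] in auto)
  thus ?thesis using X by simp
qed

text \<open>This is D(a, b) of the overview. The corrections by the snaps refer both ends to the
  reference tilings, and so the value does not depend on \<open>T\<close>.\<close>

definition step :: "'a \<Rightarrow> 'a \<Rightarrow> real" where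
  "step a b = (SOME v. \<exists>T s s2. marked a b T \<and> snap a T s \<and> snap b (translate T (- gap a b)) s2 \<and>
     v = lift T (gap a b) + s - s2)"

lemma step_eq:
  assumes "marked a b T" "snap a T s" "snap b (translate T (- gap a b)) s2"
  shows "step a b = lift T (gap a b) + s - s2"
proof -
  have "\<exists>T s s2. marked a b T \<and> snap a T s \<and> snap b (translate T (- gap a b)) s2 \<and> step a b = lift T (gap a b) + s - s2"
    unfolding step_def by (rule someI) (use assms in blast)
  then obtain T' s' s2' where T': "marked a b T'" "snap a T' s'" "snap b (translate T' (- gap a b)) s2'"
    "step a b = lift T' (gap a b) + s' - s2'" by blast
  show ?thesis using step_well_defined[OF assms(1) T'(1) assms(2,3) T'(2,3)] T'(4) by simp
qed

text \<open>The sum telescopes: the snap at each intermediate midpoint enters once with each sign,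
  and only those at the two ends remain, however many supertiles there are.\<close>

lemma lift_eq_pairsum:
  assumes "u \<noteq> []" "T \<in> X" "src.occurs T (- (L (hd u) / 2)) (concat (map W u))" "snap (hd u) T s"
    and "m = src.len (concat (map W u)) - L (hd u) / 2 - L (last u) / 2" "snap (last u) (translate T (-m)) s'"
  shows "lift T m + s - s' = pairsum step u"
  using assms
proof (induction u arbitrary: T s m rule: list_nonempty_induct)
  case (single a)
  have "m = 0" using single by (simp add: L_def)
  thus ?case using single snap_unique[of T a s s'] by simp
next
  case (cons a u)
  obtain b w where u: "u = b # w" using cons.hyps by (cases u) auto
  define g where "g = gap a b"
  have marked: "marked a b T" using cons.prems u by (simp add: marked_def src.occurs_append)
  obtain s2 where s2: "snap b (translate T (-g)) s2"
    using snap_exists[OF marked_next[OF marked]] unfolding g_def by blast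
  have eq: "- (L a / 2) + src.len (W a) = - (L b / 2) + g"
    by (simp add: g_def gap_def L_def[symmetric] field_simps)
  have "src.occurs T (- (L a / 2)) (W a @ concat (map W u))" using cons.prems(2) by simp
  hence "src.occurs T (- (L b / 2) + g) (concat (map W u))" unfolding src.occurs_append eq by blast
  moreover have "hd u = b" by (simp add: u)
  ultimately have occ: "src.occurs (translate T (-g)) (- (L (hd u) / 2)) (concat (map W u))"
    by (simp only: src.occurs_translate diff_minus_eq_add)
  have m: "m - g = src.len (concat (map W u)) - L (hd u) / 2 - L (last u) / 2"
    using cons.prems(4) u by (simp add: g_def gap_def L_def field_simps)
  have "lift (translate T (-g)) (m - g) + s2 - s' = pairsum step u"
  proof (rule cons.IH)
    show "translate T (-g) \<in> X" using marked_next(1)[OF marked] by (simp add: g_def)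
    show "snap (hd u) (translate T (-g)) s2" using s2 u by simp
    show "snap (last u) (translate (translate T (-g)) (- (m - g))) s'" using cons.prems(5) u by simp
  qed (fact occ m)+
  moreover have "step a b = lift T g + s - s2"
    using step_eq[OF marked _ s2[unfolded g_def], of s] cons.prems(3) by (simp add: g_def)
  moreover have "lift T m = lift T g + lift (translate T (-g)) (m - g)"
    using lift_cocycle[OF cons.prems(1), of g "m - g"] by simp
  ultimately show ?case by (simp add: u)
qed

end

section \<open>The estimate along a whole orbit\<close>

context supertile_markers
begin

lemma occurs_ends:
  assumes "v \<noteq> []" "src.occurs T y (concat (map W v))"
  shows "src.occurs T y (W (hd v))"
    and "src.occurs T (y + src.len (concat (map W v)) - L (last v)) (W (last v))"
proof -
  have "concat (map W v) = W (hd v) @ concat (map W (tl v))" using assms(1) by (cases v) auto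
  thus "src.occurs T y (W (hd v))" using assms(2) by (simp add: src.occurs_append)
  have eq: "concat (map W v) = concat (map W (butlast v)) @ W (last v)"
    using assms(1) by (cases v rule: rev_cases) auto
  hence "src.occurs T (y + src.len (concat (map W (butlast v)))) (W (last v))"
    using assms(2) by (simp add: src.occurs_append)
  moreover have "src.len (concat (map W v)) = src.len (concat (map W (butlast v))) + L (last v)"
    unfolding eq by (simp add: L_def)
  ultimately show "src.occurs T (y + src.len (concat (map W v)) - L (last v)) (W (last v))"
    by (simp add: add.assoc)
qed

lemma L_le: "L a \<le> src.lam ^ n * src.wmax"
  using src.wmax_ge[of a] src.lambda_ge_1 by (simp add: L_def W_def src.len_subst_word_pow mult_left_mono)

lemma lift_nearly_linear_forward:
  assumes "no_cycle_condition \<phi>"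
  shows "\<exists>\<kappa> B. \<forall>T\<in>X. \<forall>t\<ge>0. \<bar>lift T t - \<kappa> * t\<bar> \<le> B"
proof -
  obtain N \<kappa> B where B: "\<And>u. factor_of_iterate \<phi> u \<Longrightarrow> u \<noteq> [] \<Longrightarrow>
      \<bar>pairsum step ((subst_word \<phi> ^^ N) u) - \<kappa> * src.len u\<bar> \<le> B"
    using src.pairsum_balanced[OF assms, of step] by blast
  obtain K where K: "K > 0" "\<And>T t. T \<in> X \<Longrightarrow> \<bar>lift T t\<bar> \<le> K * (\<bar>t\<bar> + 1)" using lift_bound by blast
  \<comment> \<open>Level \<open>n\<close> makes a supertile determine the image, and
    \<open>N\<close> further levels bring the junctions into \<open>P_pairs\<close>.\<close>
  define M where "M = n + N"
  define \<mu> where "\<mu> = src.wmax * real (src.max_len M)"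
  define \<Lambda> where "\<Lambda> = src.lam ^ n * src.wmax"
  \<comment> \<open>The margin on both sides that makes the covering word longer than
    \<open>2 * max_len M\<close>, even for \<open>t = 0\<close>.\<close>
  define Q where "Q = \<mu> + 1"
  \<comment> \<open>Bounds the distance from 0 to the first midpoint \<open>m0\<close> and from
    \<open>t\<close> to the last midpoint \<open>m1\<close>.\<close>
  define Z where "Z = Q + src.wmax + \<mu> + \<Lambda>"
  \<comment> \<open>The pair sum is measured against \<open>u\<close>, whose length is
    \<open>lam ^ M\<close> times smaller than that of the stretch of \<open>T\<close> it
    describes.\<close>
  define \<kappa>' where "\<kappa>' = \<kappa> / src.lam ^ M"
  have pos: "\<mu> \<ge> 0" "\<Lambda> > 0" "src.wmax > 0" "src.lam ^ M > 0"
    using src.wmax_pos src.lambda_ge_1 by (simp_all add: \<mu>_def \<Lambda>_def)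
  have "\<bar>lift T t - \<kappa>' * t\<bar> \<le> 2 * (K * (Z + 1)) + B + 1 + \<bar>\<kappa>'\<bar> * \<Lambda> + \<bar>\<kappa>'\<bar> * (2 * Z)"
    if T: "T \<in> X" and t: "t \<ge> 0" for T t
  proof -
    have "-Q \<le> t + Q" using t pos by (simp add: Q_def)
    then obtain x w where w: "src.occurs T x w" "factor_of_iterate \<phi> w" "x \<le> -Q" "-Q \<le> x + src.wmax"
        "t + Q \<le> x + src.len w" "x + src.len w \<le> t + Q + src.wmax"
      using src.occurs_covering[OF T] by metis
    have "src.wmax * real (2 * src.max_len M) < src.len w"
      using w(3,5) t by (simp add: Q_def \<mu>_def)
    also have "\<dots> \<le> src.wmax * real (length w)" by (rule src.len_le)
    finally have "2 * src.max_len M < length w"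
      using src.wmax_pos by (simp only: mult_less_cancel_left_pos of_nat_less_iff)
    then obtain p u s where u: "w = p @ (subst_word \<phi> ^^ M) u @ s" "factor_of_iterate \<phi> u" "u \<noteq> []"
        "length p \<le> src.max_len M" "length s \<le> src.max_len M"
      using src.desubstitution[OF w(2)] by metis
    \<comment> \<open>The types of the level-n supertiles making up the level-M supertiles listed by
      \<open>u\<close>.\<close>
    define v where "v = (subst_word \<phi> ^^ N) u"
    have v: "v \<noteq> []" using u(3) by (simp add: v_def src.subst_word_pow_nonempty)
    have eq: "(subst_word \<phi> ^^ M) u = concat (map W v)"
      unfolding M_def v_def funpow_add comp_apply W_def by (rule subst_word_pow_concat)
    define l where "l = src.len (concat (map W v))"
    have lenp: "0 \<le> src.len p" "src.len p \<le> \<mu>" and lens: "0 \<le> src.len s" "src.len s \<le> \<mu>"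
    proof -
      have "src.len q \<le> \<mu>" if "length q \<le> src.max_len M" for q
        using order_trans[OF src.len_le[of q] mult_left_mono[of "real (length q)" "real (src.max_len M)" src.wmax]] that pos(3)
        by (simp add: \<mu>_def)
      thus "0 \<le> src.len p" "src.len p \<le> \<mu>" "0 \<le> src.len s" "src.len s \<le> \<mu>"
        using u(4,5) src.len_nonneg by blast+
    qed
    define y where "y = x + src.len p"
    have lw: "x + src.len w = y + l + src.len s" unfolding u(1) eq by (simp add: y_def l_def)
    have occ: "src.occurs T y (concat (map W v))" using w(1) unfolding u(1) eq by (simp add: src.occurs_append y_def)
    define a where "a = hd v"
    define b where "b = last v"
    define m0 where "m0 = y + L a / 2"
    define m1 where "m1 = y + l - L b / 2"
    define T0 where "T0 = translate T (-m0)"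
    have Lab: "0 \<le> L a" "L a \<le> \<Lambda>" "0 \<le> L b" "L b \<le> \<Lambda>"
      using L_le[of a] L_le[of b] L_ge[of a] L_ge[of b] R_pos by (simp_all add: \<Lambda>_def)
    have m0: "\<bar>m0\<bar> \<le> Z" and m1: "\<bar>t - m1\<bar> \<le> Z"
      using w(3-6) lw lenp lens Lab pos unfolding abs_le_iff m0_def m1_def y_def Z_def Q_def by auto
    have T0: "T0 \<in> X" using src.translate_in_space[OF T] by (simp add: T0_def)
    have "src.occurs T0 (- (L a / 2)) (W a)"
      using occurs_ends(1)[OF v occ] by (simp add: T0_def src.occurs_translate m0_def a_def)
    then obtain s0 where s0: "snap a T0 s0" using snap_exists[OF T0] by blast
    have tr: "translate T0 (- (m1 - m0)) = translate T (-m1)" by (simp add: T0_def)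
    have "src.occurs (translate T (-m1)) (- (L b / 2)) (W b)"
      using occurs_ends(2)[OF v occ] by (simp add: src.occurs_translate m1_def b_def l_def algebra_simps)
    then obtain s1 where s1: "snap b (translate T (-m1)) s1" using snap_exists src.translate_in_space[OF T] by blast
    have "lift T0 (m1 - m0) + s0 - s1 = pairsum step v"
    proof (rule lift_eq_pairsum[OF v T0])
      show "src.occurs T0 (- (L (hd v) / 2)) (concat (map W v))"
        using occ by (simp add: T0_def src.occurs_translate m0_def a_def)
      show "m1 - m0 = src.len (concat (map W v)) - L (hd v) / 2 - L (last v) / 2"
        by (simp add: m0_def m1_def l_def a_def b_def)
    qed (use s0 s1 tr in \<open>simp_all add: a_def b_def\<close>)
    moreover have "\<bar>pairsum step v - \<kappa> * src.len u\<bar> \<le> B" using B[OF u(2,3)] by (simp add: v_def)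
    moreover have "\<kappa> * src.len u = \<kappa>' * l"
      using src.len_subst_word_pow[of M u] src.lambda_ge_1 unfolding eq l_def \<kappa>'_def by auto
    moreover have "\<bar>s0\<bar> < 1/2" "\<bar>s1\<bar> < 1/2" using s0 s1 eps(2) by (auto simp: snap_def)
    ultimately have e1: "\<bar>lift T0 (m1 - m0) - \<kappa>' * l\<bar> \<le> B + 1" by linarith
    have e2: "\<bar>\<kappa>' * l - \<kappa>' * (m1 - m0)\<bar> \<le> \<bar>\<kappa>'\<bar> * \<Lambda>"
    proof -
      have "\<bar>l - (m1 - m0)\<bar> \<le> \<Lambda>" using Lab unfolding abs_le_iff m0_def m1_def by auto
      thus ?thesis unfolding right_diff_distrib[symmetric] abs_mult by (rule mult_left_mono) simp
    qed
    have e3: "\<bar>\<kappa>' * (m1 - m0) - \<kappa>' * t\<bar> \<le> \<bar>\<kappa>'\<bar> * (2 * Z)"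
    proof -
      have "\<bar>(m1 - m0) - t\<bar> \<le> 2 * Z" using m0 m1 by linarith
      thus ?thesis unfolding right_diff_distrib[symmetric] abs_mult by (rule mult_left_mono) simp
    qed
    have e4: "\<bar>lift T m0\<bar> \<le> K * (Z + 1)"
      by (rule order_trans[OF K(2)[OF T] mult_left_mono]) (use m0 K(1) in auto)
    have e5: "\<bar>lift (translate T (-m1)) (t - m1)\<bar> \<le> K * (Z + 1)"
      by (rule order_trans[OF K(2)[OF src.translate_in_space[OF T]] mult_left_mono]) (use m1 K(1) in auto)
    \<comment> \<open>The middle part is controlled by the pair sum, and the two ends have length at
      most \<open>Z\<close>, where \<open>lift_bound\<close> suffices.\<close>
    have "lift T t = lift T m0 + lift T0 (m1 - m0) + lift (translate T (-m1)) (t - m1)"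
      using lift_diff[OF T, of t m1] lift_diff[OF T, of m1 m0] by (simp add: T0_def)
    thus ?thesis using e1 e2 e3 e4 e5 by linarith
  qed
  thus ?thesis by blast
qed

end

context tiling_map
begin

lemma lift_nearly_linear:
  assumes "no_cycle_condition \<phi>"
  obtains \<kappa> B where "\<And>T t. T \<in> X \<Longrightarrow> \<bar>lift T t - \<kappa> * t\<bar> \<le> B"
proof -
  define \<epsilon> where "\<epsilon> = min (1/2) (tgt.wmin / 3)"
  have eps: "0 < \<epsilon>" "\<epsilon> \<le> 1/2" "3 * \<epsilon> \<le> tgt.wmin" using tgt.wmin_pos by (auto simp: \<epsilon>_def)
  obtain \<delta> where \<delta>: "\<delta> > 0"
    "\<And>T T'. T \<in> X \<Longrightarrow> T' \<in> X \<Longrightarrow> tilings_close \<omega>\<phi> \<delta> T T' \<Longrightarrow> tilings_close \<omega>\<psi> \<epsilon> (h T) (h T')"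
    using uniformly_continuous[OF eps(1)] by metis
  \<comment> \<open>Large enough that every level-n supertile is at least twice as long as the
    window radius 1/\<delta>.\<close>
  obtain n where n: "2 * (1/\<delta>) / src.wmin < src.lam ^ n"
    using real_arch_pow[OF src.lambda_gt_1] by blast
  interpret supertile_markers \<phi> \<omega>\<phi> r\<phi> \<psi> \<omega>\<psi> r\<psi> h \<epsilon> "1/\<delta>" n
  proof
    show "tilings_close \<omega>\<psi> \<epsilon> (h T) (h T')" if "T \<in> X" "T' \<in> X" "src.agree (1/\<delta>) T T'" for T T'
    proof (rule \<delta>(2)[OF that(1,2)])
      show "tilings_close \<omega>\<phi> \<delta> T T'"
        unfolding src.tilings_close_iff[OF \<delta>(1)] using that(3) \<delta>(1) by (intro exI[of _ 0]) simp
    qed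
    show "2 * (1/\<delta>) \<le> src.len ((subst_word \<phi> ^^ n) [a])" for a
    proof -
      have "2 * (1/\<delta>) \<le> src.lam ^ n * src.wmin" using n[unfolded pos_divide_less_eq[OF src.wmin_pos]] by simp
      also have "\<dots> \<le> src.lam ^ n * \<omega>\<phi> $ a" using src.wmin_le src.lambda_ge_1 by (intro mult_left_mono) auto
      finally show ?thesis by (simp add: src.len_subst_word_pow)
    qed
  qed (use eps \<delta>(1) in auto)
  obtain \<kappa> B where B: "\<And>T t. T \<in> X \<Longrightarrow> t \<ge> 0 \<Longrightarrow> \<bar>lift T t - \<kappa> * t\<bar> \<le> B"
    using lift_nearly_linear_forward[OF assms] by blast
  have "\<bar>lift T t - \<kappa> * t\<bar> \<le> B" if T: "T \<in> X" for T t
  proof (cases "t \<ge> 0")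
    case False
    \<comment> \<open>A negative time for \<open>T\<close> is a positive time for the tiling
      reached, with the same slope and bound.\<close>
    have "lift T t = - lift (translate T (-t)) (-t)"
      using lift_cocycle[OF T, of t "-t"] T by simp
    thus ?thesis using B[OF src.translate_in_space[OF T], of "-t" "-t"] False by simp
  qed (use B T in blast)
  thus thesis using that by blast
qed

end

section \<open>Proximality\<close>

definition proximal_along :: "('a tiling \<Rightarrow> 'a tiling \<Rightarrow> real) \<Rightarrow> 'a tiling \<Rightarrow> 'a tiling \<Rightarrow> (nat \<Rightarrow> real) \<Rightarrow> bool" where
  "proximal_along d T T' t \<longleftrightarrow> (\<lambda>k. d (translate T (- t k)) (translate T' (- t k))) \<longlonglongrightarrow> 0"

lemma unbounded_subsequence:
  fixes t :: "nat \<Rightarrow> real"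
  assumes "filterlim (\<lambda>k. \<bar>t k\<bar>) at_top sequentially"
  shows "\<exists>s :: nat \<Rightarrow> nat. strict_mono s \<and>
    (filterlim (\<lambda>k. t (s k)) at_top sequentially \<or> filterlim (\<lambda>k. t (s k)) at_bot sequentially)"
proof (cases "\<exists>\<^sub>F k in sequentially. t k \<ge> 0")
  case True
  then obtain s :: "nat \<Rightarrow> nat" where s: "strict_mono s" "\<And>k. t (s k) \<ge> 0"
    using not_eventually_sequentiallyD[of "\<lambda>k. \<not> t k \<ge> 0"] unfolding frequently_def by auto
  have "filterlim (\<lambda>k. \<bar>t (s k)\<bar>) at_top sequentially"
    using filterlim_compose[OF assms filterlim_subseq[OF s(1)]] .
  thus ?thesis using s by (intro exI[of _ s]) simp
next
  case False
  hence ev: "eventually (\<lambda>k. t k < 0) sequentially" by (simp add: not_frequently not_le)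
  have "filterlim (\<lambda>k. - \<bar>t k\<bar>) at_bot sequentially"
    using assms by (simp add: filterlim_uminus_at_bot)
  moreover have "eventually (\<lambda>k. - \<bar>t k\<bar> = t k) sequentially"
    using ev by eventually_elim simp
  ultimately have "filterlim t at_bot sequentially"
    by (simp cong: filterlim_cong)
  thus ?thesis by (intro exI[of _ id]) (simp add: strict_mono_def)
qed

text \<open>If the slope of the lift is negative, times tending to plus infinity go to times tending
  to minus infinity. Asking only that the absolute values tend to infinity avoids following the
  direction.\<close>

lemma proximal_iff_along:
  "proximal d T T' \<longleftrightarrow> (\<exists>t. filterlim (\<lambda>k. \<bar>t k\<bar>) at_top sequentially \<and> proximal_along d T T' t)"
proof
  assume "proximal d T T'"
  then obtain t where t: "filterlim t at_top sequentially \<or> filterlim t at_bot sequentially" "proximal_along d T T' t"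
    unfolding proximal_def forward_proximal_def backward_proximal_def proximal_along_def by blast
  have "filterlim (\<lambda>k. \<bar>t k\<bar>) at_top sequentially" if "filterlim t at_top sequentially" for t :: "nat \<Rightarrow> real"
    using filterlim_compose[OF filterlim_abs_real that] .
  from this[of t] this[of "\<lambda>k. - t k"] have "filterlim (\<lambda>k. \<bar>t k\<bar>) at_top sequentially"
    using t(1) by (auto simp: filterlim_uminus_at_bot)
  thus "\<exists>t. filterlim (\<lambda>k. \<bar>t k\<bar>) at_top sequentially \<and> proximal_along d T T' t" using t(2) by blast
next
  assume "\<exists>t. filterlim (\<lambda>k. \<bar>t k\<bar>) at_top sequentially \<and> proximal_along d T T' t"
  then obtain t where t: "proximal_along d T T' t" and lim: "filterlim (\<lambda>k. \<bar>t k\<bar>) at_top sequentially" by blast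
  obtain s where s: "strict_mono (s :: nat \<Rightarrow> nat)"
    "filterlim (\<lambda>k. t (s k)) at_top sequentially \<or> filterlim (\<lambda>k. t (s k)) at_bot sequentially"
    using unbounded_subsequence[OF lim] by blast
  have "(\<lambda>k. d (translate T (- t (s k))) (translate T' (- t (s k)))) \<longlonglongrightarrow> 0"
    using LIMSEQ_subseq_LIMSEQ[OF t[unfolded proximal_along_def] s(1)] by (simp add: comp_def)
  thus "proximal d T T'"
    using s(2) unfolding proximal_def forward_proximal_def backward_proximal_def by blast
qed

context tiling_map
begin

text \<open>If \<open>h\<close> sends \<open>T - t\<close> to \<open>h T - u\<close> and \<open>T' - t\<close> to \<open>h T' - u'\<close>, then \<open>u - u'\<close> stays bounded because
  both lifts are linear in \<open>t\<close> with the same slope; a limit point of \<open>u - u'\<close> is the required \<open>t\<^sub>0\<close>.\<close>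

lemma proximal_image:
  assumes "no_cycle_condition \<phi>"
    and metrics: "compatible_metric \<phi> \<omega>\<phi> d\<phi>" "compatible_metric \<psi> \<omega>\<psi> d\<psi>"
    and T: "T \<in> X" "T' \<in> X" and prox: "proximal d\<phi> T T'"
    and proper: "\<And>t. \<bar>t\<bar> \<le> K * (\<bar>lift T t\<bar> + 1)" and "K > 0"
  shows "\<exists>t0. proximal d\<psi> (h T) (translate (h T') t0)"
proof -
  obtain t where t: "filterlim (\<lambda>k. \<bar>t k\<bar>) at_top sequentially" "proximal_along d\<phi> T T' t"
    using prox unfolding proximal_iff_along by blast
  obtain \<kappa> B where B: "\<And>T t. T \<in> X \<Longrightarrow> \<bar>lift T t - \<kappa> * t\<bar> \<le> B"
    using lift_nearly_linear[OF assms(1)] by metis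
  define D where "D k = lift T (t k) - lift T' (t k)" for k
  have "D k \<in> {-(2 * B)..2 * B}" for k
    using B[OF T(1), of "t k"] B[OF T(2), of "t k"] by (auto simp: D_def)
  then obtain t0 s where s: "strict_mono (s :: nat \<Rightarrow> nat)" "(D \<circ> s) \<longlonglongrightarrow> t0"
    using compact_Icc[of "-(2*B)" "2*B", THEN compact_imp_seq_compact] unfolding seq_compact_def by metis
  define u where "u k = lift T (t (s k))" for k
  have tr: "translate S v \<in> Y" if "S \<in> Y" for S v using tgt.translate_in_space[OF that] .
  \<comment> \<open>By \<open>proper\<close>, a bounded lift would force bounded times.\<close>
  have "filterlim (\<lambda>k. \<bar>u k\<bar>) at_top sequentially"
    unfolding filterlim_at_top
  proof
    fix c
    have "filterlim (\<lambda>k. \<bar>t (s k)\<bar>) at_top sequentially"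
      using filterlim_compose[OF t(1) filterlim_subseq[OF s(1)]] .
    hence "eventually (\<lambda>k. \<bar>t (s k)\<bar> \<ge> K * (c + 1)) sequentially" by (simp add: filterlim_at_top)
    thus "eventually (\<lambda>k. c \<le> \<bar>u k\<bar>) sequentially"
    proof eventually_elim
      case (elim k)
      hence "K * (c + 1) \<le> K * (\<bar>u k\<bar> + 1)" using proper[of "t (s k)"] by (simp add: u_def)
      thus ?case using \<open>K > 0\<close> by simp
    qed
  qed
  moreover have "proximal_along d\<psi> (h T) (translate (h T') t0) u"
    unfolding proximal_along_def
  proof (subst tgt.dist_tendsto_0_iff[OF metrics(2)])
    have "\<forall>\<epsilon>>0. eventually (\<lambda>k. tilings_close \<omega>\<phi> \<epsilon> (translate T (- t k)) (translate T' (- t k))) sequentially"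
      using t(2) unfolding proximal_along_def
      by (subst (asm) src.dist_tendsto_0_iff[OF metrics(1)]) (use src.translate_in_space T in auto)
    hence c: "eventually (\<lambda>k. tilings_close \<omega>\<phi> \<epsilon> (translate T (- t (s k))) (translate T' (- t (s k)))) sequentially" if "\<epsilon> > 0" for \<epsilon>
      using eventually_subseq[OF s(1)] that by blast
    show "\<forall>\<epsilon>>0. eventually (\<lambda>k. tilings_close \<omega>\<psi> \<epsilon> (translate (h T) (- u k)) (translate (translate (h T') t0) (- u k))) sequentially"
    proof (intro allI impI)
      fix \<epsilon> :: real assume "\<epsilon> > 0"
      show "eventually (\<lambda>k. tilings_close \<omega>\<psi> \<epsilon> (translate (h T) (- u k)) (translate (translate (h T') t0) (- u k))) sequentially"
      \<comment> \<open>The intermediate tiling is the image of T' at the time in question. It is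
        close to the image of T by uniform continuity, and close to the fixed translate because
        \<open>D (s k)\<close> tends to \<open>t0\<close>.\<close>
      proof (rule tgt.eventually_close_trans[OF _ _ \<open>\<epsilon> > 0\<close>])
        fix \<epsilon> :: real assume e: "\<epsilon> > 0"
        obtain \<delta> where \<delta>: "\<delta> > 0"
          "\<And>T T'. T \<in> X \<Longrightarrow> T' \<in> X \<Longrightarrow> tilings_close \<omega>\<phi> \<delta> T T' \<Longrightarrow> tilings_close \<omega>\<psi> \<epsilon> (h T) (h T')"
          using uniformly_continuous[OF e] by metis
        show "eventually (\<lambda>k. tilings_close \<omega>\<psi> \<epsilon> (translate (h T) (- u k)) (translate (h T') (D (s k) - u k))) sequentially"
          using c[OF \<delta>(1)]
        proof eventually_elim
          case (elim k)
          have "h (translate T (- t (s k))) = translate (h T) (- u k)" using lift[OF T(1)] by (simp add: u_def)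
          moreover have "h (translate T' (- t (s k))) = translate (h T') (D (s k) - u k)"
            using lift[OF T(2)] by (simp add: u_def D_def)
          ultimately show ?case
            using \<delta>(2)[OF src.translate_in_space[OF T(1)] src.translate_in_space[OF T(2)] elim] by simp
        qed
        have "eventually (\<lambda>k. dist (D (s k)) t0 < \<epsilon>) sequentially"
          using tendstoD[OF s(2) e] by simp
        thus "eventually (\<lambda>k. tilings_close \<omega>\<psi> \<epsilon> (translate (h T') (D (s k) - u k)) (translate (translate (h T') t0) (- u k))) sequentially"
        proof eventually_elim
          case (elim k)
          have "tilings_close \<omega>\<psi> \<epsilon> (translate (h T') (D (s k) - u k)) (translate (translate (h T') (D (s k) - u k)) (t0 - D (s k)))"
            using elim by (intro tgt.close_translate) (simp add: dist_real_def abs_minus_commute)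
          thus ?case by (simp add: algebra_simps)
        qed
      qed
    qed
  qed (use tr h_space[OF T(1)] h_space[OF T(2)] in auto)
  ultimately show ?thesis unfolding proximal_iff_along by blast
qed

end

theorem theorem4p16:
  fixes \<phi> :: "'a::finite \<Rightarrow> 'a list" and \<psi> :: "'b::finite \<Rightarrow> 'b list"
    and \<omega>\<phi> r\<phi> :: "real^'a" and \<omega>\<psi> r\<psi> :: "real^'b"
    and d\<phi> :: "'a tiling \<Rightarrow> 'a tiling \<Rightarrow> real" and d\<psi> :: "'b tiling \<Rightarrow> 'b tiling \<Rightarrow> real"
    and h :: "'a tiling \<Rightarrow> 'b tiling" and T T' :: "'a tiling"
  assumes "substitution \<phi>" and "strong_pisot \<phi>"
    and "substitution \<psi>" and "strong_pisot \<psi>"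
    and "left_pf_vector \<phi> \<omega>\<phi>" and "right_pf_vector \<phi> r\<phi>"
    and "left_pf_vector \<psi> \<omega>\<psi>" and "right_pf_vector \<psi> r\<psi>"
    and "compatible_metric \<phi> \<omega>\<phi> d\<phi>" and "compatible_metric \<psi> \<omega>\<psi> d\<psi>"
    and "GCC \<phi> r\<phi>" and "GCC \<psi> r\<psi>"
    and "no_cycle_condition \<phi>" and "no_cycle_condition \<psi>"
    and "homeomorphic_map (tiling_topology \<phi> \<omega>\<phi>) (tiling_topology \<psi> \<omega>\<psi>) h"
    and "T \<in> tiling_space \<phi> \<omega>\<phi>" and "T' \<in> tiling_space \<phi> \<omega>\<phi>"
    and "proximal d\<phi> T T'"
  shows "\<exists>t0::real. proximal d\<psi> (h T) (translate (h T') t0)"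
proof -
  obtain g where g: "homeomorphic_maps (tiling_topology \<phi> \<omega>\<phi>) (tiling_topology \<psi> \<omega>\<psi>) h g"
    using assms(15) homeomorphic_map_maps by blast
  interpret H: tiling_map \<phi> \<omega>\<phi> r\<phi> \<psi> \<omega>\<psi> r\<psi> h
    by unfold_locales (use assms g in \<open>simp_all add: homeomorphic_maps_def\<close>)
  interpret G: tiling_map \<psi> \<omega>\<psi> r\<psi> \<phi> \<omega>\<phi> r\<phi> g
    by unfold_locales (use g in \<open>simp_all add: homeomorphic_maps_def\<close>)
  have gh: "g (h S) = S" if "S \<in> tiling_space \<phi> \<omega>\<phi>" for S
    using g that by (simp add: homeomorphic_maps_def topspace_tiling_topology)
  obtain K where K: "K > 0" "\<And>S t. S \<in> tiling_space \<psi> \<omega>\<psi> \<Longrightarrow> \<bar>G.lift S t\<bar> \<le> K * (\<bar>t\<bar> + 1)"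
    using G.lift_bound by blast
  \<comment> \<open>By aperiodicity the lift of \<open>g\<close> at \<open>h T\<close> inverts the
    lift of \<open>h\<close> at \<open>T\<close>, so its linear growth bound becomes a lower bound
    for the latter.\<close>
  have "\<bar>t\<bar> \<le> K * (\<bar>H.lift T t\<bar> + 1)" for t
  proof -
    have "translate T (-t) = g (h (translate T (-t)))"
      using gh[OF H.src.translate_in_space[OF assms(16)]] by simp
    also have "\<dots> = g (translate (h T) (- H.lift T t))" by (simp add: H.lift[OF assms(16)])
    also have "\<dots> = translate (g (h T)) (- G.lift (h T) (H.lift T t))" by (rule G.lift[OF H.h_space[OF assms(16)]])
    finally have "translate T (-t) = translate T (- G.lift (h T) (H.lift T t))" by (simp add: gh[OF assms(16)])
    from H.src.aperiodic[OF assms(16) this] have "G.lift (h T) (H.lift T t) = t" by simp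
    thus ?thesis using K(2)[OF H.h_space[OF assms(16)], of "H.lift T t"] by simp
  qed
  thus ?thesis
    using H.proximal_image[OF assms(13) assms(9,10) assms(16,17,18)] K(1) by blast
qed

end
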